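(* Let $n\ge 1$ and let $(M^{2n+1},\phi,\xi,\eta,g)$ be a Kenmotsu manifold of dimension $2n+1$. Suppose that $g$ represents a gradient almost $*$-conformal $\eta$-Ricci soliton, i.e. there exist smooth functions $f,\lambda:M\to\mathbb{R}$ and real constants $\mu,p$ such that $$\operatorname{Hess} f+S^*+\Big[\lambda-\Big(\frac{p}{2}+\frac{1}{2n+1}\Big)\Big]g+\mu\,\eta\otimes\eta=0,$$ where $S^*$ is the $*$-Ricci tensor of $M$. Then either $(M,g)$ is Einstein, i.e. its Ricci tensor satisfies $S=a\,g$ for some constant $a$, or there exists a nonempty open subset of $M$ on which the potential vector field $V=Df$ (the gradient of $f$) is pointwise collinear with the characteristic vector field $\xi$.
   Context: An almost contact metric manifold $(M^{2n+1},\phi,\xi,\eta,g)$ is a smooth $(2n+1)$-dimensional manifold with a $(1,1)$-tensor field $\phi$, a vector field $\xi$ (the characteristic or Reeb vector field), a 1-form $\eta$ and a Riemannian metric $g$ satisfying $\phi^2=-I+\eta\otimes\xi$, $\eta(\xi)=1$ and $g(\phi X,\phi Y)=g(X,Y)-\eta(X)\eta(Y)$ for all vector fields $X,Y$ (consequently $\phi\xi=0$, $\eta\circ\phi=0$, $\eta(X)=g(X,\xi)$, $g(\phi X,Y)=-g(X,\phi Y)$). It is a Kenmotsu manifold if, with $\nabla$ the Levi-Civita connection of $g$, $(\nabla_X\phi)Y=g(\phi X,Y)\xi-\eta(Y)\phi X$ for all vector fields $X,Y$. $R$ denotes the Riemann curvature tensor, $R(X,Y)Z=\nabla_X\nabla_YZ-\nabla_Y\nabla_XZ-\nabla_{[X,Y]}Z$,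 and $S$ the Ricci tensor. The $*$-Ricci tensor is $S^*(X,Y)=\frac12\operatorname{trace}\{Z\mapsto\phi(R(X,\phi Y)Z)\}$. $\operatorname{Hess}f(X,Y)=g(\nabla_XDf,Y)$, where $Df$ is the $g$-gradient of $f$. "$V$ pointwise collinear with $\xi$ on an open set $O$" means that $V=c\,\xi$ on $O$ for some function $c$ on $O$. *)

theory Defs
  imports "HOL-Analysis.Analysis"
begin

section \<open>Smooth maps between Euclidean spaces\<close>

text \<open>
  These notions are only used for an open set \<open>S\<close>. In finite dimension, \<open>f\<close> is of class
  \<open>C\<^sup>\<infinity>\<close> on \<open>S\<close> iff all its iterated directional derivatives exist and are (Frechet)
  differentiable on \<open>S\<close>.
\<close>

primrec higher_differentiable_on ::
    "nat \<Rightarrow> 'e::euclidean_space set \<Rightarrow> ('e \<Rightarrow> 'f::euclidean_space) \<Rightarrow> bool" where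
  "higher_differentiable_on 0 S f \<longleftrightarrow> continuous_on S f"
| "higher_differentiable_on (Suc k) S f \<longleftrightarrow>
     (\<forall>x\<in>S. f differentiable (at x)) \<and>
     (\<forall>v. higher_differentiable_on k S (\<lambda>x. frechet_derivative f (at x) v))"

definition smooth_on :: "'e::euclidean_space set \<Rightarrow> ('e \<Rightarrow> 'f::euclidean_space) \<Rightarrow> bool" where
  "smooth_on S f \<longleftrightarrow> (\<forall>k. higher_differentiable_on k S f)"

section \<open>Smooth manifolds\<close>

text \<open>
  The manifold is the whole type \<open>'a\<close> (Hausdorff and second countable by its sort) together with
  a smooth atlas. A chart is a pair of its domain and its coordinate map; values of the coordinate
  map outside the domain are irrelevant. The dimension is \<open>CARD('m)\<close>.
\<close>

type_synonym ('a, 'm) chart = "'a set \<times> ('a \<Rightarrow> real ^ 'm)"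

definition chart_inv :: "('a, 'm::finite) chart \<Rightarrow> real ^ 'm \<Rightarrow> 'a" where
  "chart_inv c = inv_into (fst c) (snd c)"

definition smooth_atlas ::
    "('a::{t2_space, second_countable_topology}, 'm::finite) chart set \<Rightarrow> bool" where
  "smooth_atlas A \<longleftrightarrow>
     (\<Union>c\<in>A. fst c) = UNIV \<and>
     (\<forall>c\<in>A. open (fst c) \<and> open (snd c ` fst c) \<and>
        homeomorphism (fst c) (snd c ` fst c) (snd c) (chart_inv c)) \<and>
     (\<forall>c\<in>A. \<forall>d\<in>A. smooth_on (snd c ` (fst c \<inter> fst d)) (snd d \<circ> chart_inv c))"

definition smooth_functions :: "('a, 'm::finite) chart set \<Rightarrow> ('a \<Rightarrow> real) set" where
  "smooth_functions A = {f. \<forall>c\<in>A. smooth_on (snd c ` fst c) (f \<circ> chart_inv c)}"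

text \<open>
  A preferred chart is chosen at every point \<open>p\<close>, and the tangent space at \<open>p\<close> is identified with
  \<open>real ^ 'm\<close> by means of that chart. In any other chart \<open>c\<close> around \<open>p\<close>, the components of the
  tangent vector \<open>v\<close> at \<open>p\<close> are obtained by applying the derivative of the change of coordinates.
  Thus a (not necessarily smooth) vector field is a function \<open>'a \<Rightarrow> real ^ 'm\<close>, a field of
  endomorphisms of the tangent spaces is a function \<open>'a \<Rightarrow> real ^ 'm \<Rightarrow> real ^ 'm\<close>, and so on.
  The preferred chart may jump from point to point, so smoothness of a vector field must be (and
  is) tested on its components in the charts of the atlas.
\<close>

definition chart_at :: "('a, 'm::finite) chart set \<Rightarrow> 'a \<Rightarrow> ('a, 'm) chart" where
  "chart_at A p = (SOME c. c \<in> A \<and> p \<in> fst c)"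

definition components ::
    "('a, 'm::finite) chart set \<Rightarrow> ('a, 'm) chart \<Rightarrow> 'a \<Rightarrow> real ^ 'm \<Rightarrow> real ^ 'm" where
  "components A c p v =
     (let b = chart_at A p in frechet_derivative (snd c \<circ> chart_inv b) (at (snd b p)) v)"

definition local_rep ::
    "('a, 'm::finite) chart set \<Rightarrow> ('a, 'm) chart \<Rightarrow> ('a \<Rightarrow> real ^ 'm) \<Rightarrow> real ^ 'm \<Rightarrow> real ^ 'm" where
  "local_rep A c X x = components A c (chart_inv c x) (X (chart_inv c x))"

definition vector_fields :: "('a, 'm::finite) chart set \<Rightarrow> ('a \<Rightarrow> real ^ 'm) set" where
  "vector_fields A = {X. \<forall>c\<in>A. smooth_on (snd c ` fst c) (local_rep A c X)}"

text \<open>\<open>differential A f p v\<close> is \<open>df\<^sub>p(v)\<close>; hence \<open>X f\<close> is \<open>\<lambda>p. differential A f p (X p)\<close>.\<close>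

definition differential ::
    "('a, 'm::finite) chart set \<Rightarrow> ('a \<Rightarrow> real) \<Rightarrow> 'a \<Rightarrow> real ^ 'm \<Rightarrow> real" where
  "differential A f p v =
     (let b = chart_at A p in frechet_derivative (f \<circ> chart_inv b) (at (snd b p)) v)"

text \<open>
  The bracket is \<open>[X,Y] = DY(X) - DX(Y)\<close> in coordinates, i.e. \<open>[X,Y] f = X (Y f) - Y (X f)\<close>. It is
  computed in the preferred chart at \<open>p\<close>, in which the components of \<open>X\<close> at \<open>p\<close> are \<open>X p\<close>.
\<close>

definition lie_bracket ::
    "('a, 'm::finite) chart set \<Rightarrow> ('a \<Rightarrow> real ^ 'm) \<Rightarrow> ('a \<Rightarrow> real ^ 'm) \<Rightarrow> 'a \<Rightarrow> real ^ 'm" where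
  "lie_bracket A X Y p =
     (let b = chart_at A p in
        frechet_derivative (local_rep A b Y) (at (snd b p)) (X p) -
        frechet_derivative (local_rep A b X) (at (snd b p)) (Y p))"

section \<open>Tensor fields and Riemannian metrics\<close>

definition one_form :: "('a, 'm::finite) chart set \<Rightarrow> ('a \<Rightarrow> real ^ 'm \<Rightarrow> real) \<Rightarrow> bool" where
  "one_form A \<eta> \<longleftrightarrow>
     (\<forall>p. linear (\<eta> p)) \<and>
     (\<forall>X\<in>vector_fields A. (\<lambda>p. \<eta> p (X p)) \<in> smooth_functions A)"

definition tensor_field_11 ::
    "('a, 'm::finite) chart set \<Rightarrow> ('a \<Rightarrow> real ^ 'm \<Rightarrow> real ^ 'm) \<Rightarrow> bool" where
  "tensor_field_11 A \<phi> \<longleftrightarrow>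
     (\<forall>p. linear (\<phi> p)) \<and>
     (\<forall>X\<in>vector_fields A. (\<lambda>p. \<phi> p (X p)) \<in> vector_fields A)"

definition riemannian_metric ::
    "('a, 'm::finite) chart set \<Rightarrow> ('a \<Rightarrow> real ^ 'm \<Rightarrow> real ^ 'm \<Rightarrow> real) \<Rightarrow> bool" where
  "riemannian_metric A g \<longleftrightarrow>
     (\<forall>p. bilinear (g p) \<and> (\<forall>u v. g p u v = g p v u) \<and> (\<forall>v. v \<noteq> 0 \<longrightarrow> g p v v > 0)) \<and>
     (\<forall>X\<in>vector_fields A. \<forall>Y\<in>vector_fields A. (\<lambda>p. g p (X p) (Y p)) \<in> smooth_functions A)"

definition gradient ::
    "('a, 'm::finite) chart set \<Rightarrow> ('a \<Rightarrow> real ^ 'm \<Rightarrow> real ^ 'm \<Rightarrow> real) \<Rightarrow> ('a \<Rightarrow> real) \<Rightarrow>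
     'a \<Rightarrow> real ^ 'm" where
  "gradient A g f p = (THE u. \<forall>v. g p u v = differential A f p v)"

section \<open>Levi-Civita connection and curvature\<close>

type_synonym ('a, 'm) connection =
  "('a \<Rightarrow> real ^ 'm) \<Rightarrow> ('a \<Rightarrow> real ^ 'm) \<Rightarrow> 'a \<Rightarrow> real ^ 'm"

definition affine_connection ::
    "('a, 'm::finite) chart set \<Rightarrow> ('a, 'm) connection \<Rightarrow> bool" where
  "affine_connection A D \<longleftrightarrow>
     (\<forall>X\<in>vector_fields A. \<forall>Y\<in>vector_fields A. D X Y \<in> vector_fields A) \<and>
     (\<forall>X\<in>vector_fields A. \<forall>X'\<in>vector_fields A. \<forall>Y\<in>vector_fields A. \<forall>p.
        D (\<lambda>q. X q + X' q) Y p = D X Y p + D X' Y p) \<and>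
     (\<forall>X\<in>vector_fields A. \<forall>Y\<in>vector_fields A. \<forall>Y'\<in>vector_fields A. \<forall>p.
        D X (\<lambda>q. Y q + Y' q) p = D X Y p + D X Y' p) \<and>
     (\<forall>h\<in>smooth_functions A. \<forall>X\<in>vector_fields A. \<forall>Y\<in>vector_fields A. \<forall>p.
        D (\<lambda>q. h q *\<^sub>R X q) Y p = h p *\<^sub>R D X Y p) \<and>
     (\<forall>h\<in>smooth_functions A. \<forall>X\<in>vector_fields A. \<forall>Y\<in>vector_fields A. \<forall>p.
        D X (\<lambda>q. h q *\<^sub>R Y q) p = differential A h p (X p) *\<^sub>R Y p + h p *\<^sub>R D X Y p)"

text \<open>By the fundamental theorem of Riemannian geometry, this determines \<open>D\<close> on vector fields.\<close>

definition levi_civita_connection ::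
    "('a, 'm::finite) chart set \<Rightarrow> ('a \<Rightarrow> real ^ 'm \<Rightarrow> real ^ 'm \<Rightarrow> real) \<Rightarrow>
     ('a, 'm) connection \<Rightarrow> bool" where
  "levi_civita_connection A g D \<longleftrightarrow>
     affine_connection A D \<and>
     (\<forall>X\<in>vector_fields A. \<forall>Y\<in>vector_fields A. \<forall>p.
        D X Y p - D Y X p = lie_bracket A X Y p) \<and>
     (\<forall>X\<in>vector_fields A. \<forall>Y\<in>vector_fields A. \<forall>Z\<in>vector_fields A. \<forall>p.
        differential A (\<lambda>q. g q (Y q) (Z q)) p (X p) =
          g p (D X Y p) (Z p) + g p (Y p) (D X Z p))"

definition curvature ::
    "('a, 'm::finite) chart set \<Rightarrow> ('a, 'm) connection \<Rightarrow>
     ('a \<Rightarrow> real ^ 'm) \<Rightarrow> ('a \<Rightarrow> real ^ 'm) \<Rightarrow> ('a \<Rightarrow> real ^ 'm) \<Rightarrow> 'a \<Rightarrow> real ^ 'm" where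
  "curvature A D X Y Z p = D X (D Y Z) p - D Y (D X Z) p - D (lie_bracket A X Y) Z p"

definition hessian ::
    "('a, 'm::finite) chart set \<Rightarrow> ('a \<Rightarrow> real ^ 'm \<Rightarrow> real ^ 'm \<Rightarrow> real) \<Rightarrow> ('a, 'm) connection \<Rightarrow>
     ('a \<Rightarrow> real) \<Rightarrow> ('a \<Rightarrow> real ^ 'm) \<Rightarrow> ('a \<Rightarrow> real ^ 'm) \<Rightarrow> 'a \<Rightarrow> real" where
  "hessian A g D f X Y p = g p (D X (gradient A g f) p) (Y p)"

text \<open>
  The trace at \<open>p\<close> of an operator \<open>T\<close> on vector fields that is linear over the smooth functions,
  i.e. the trace of the induced endomorphism of the tangent space at \<open>p\<close>. A tangent vector is
  extended to a vector field in order to apply \<open>T\<close>; the value of \<open>T Z\<close> at \<open>p\<close> depends only on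
  \<open>Z p\<close>, so the choice of the extension is immaterial. The curvature operators below are of this kind.
\<close>

definition extension ::
    "('a, 'm::finite) chart set \<Rightarrow> 'a \<Rightarrow> real ^ 'm \<Rightarrow> 'a \<Rightarrow> real ^ 'm" where
  "extension A p v = (SOME Z. Z \<in> vector_fields A \<and> Z p = v)"

definition trace_at ::
    "('a, 'm::finite) chart set \<Rightarrow> 'a \<Rightarrow> (('a \<Rightarrow> real ^ 'm) \<Rightarrow> 'a \<Rightarrow> real ^ 'm) \<Rightarrow> real" where
  "trace_at A p T = trace (matrix (\<lambda>v. T (extension A p v) p))"

text \<open>
  The sign convention \<open>S(X,Y) = trace (Z \<mapsto> R(Z,X)Y)\<close> is the one for which round spheres have
  positive Ricci tensor.
\<close>

definition ricci ::
    "('a, 'm::finite) chart set \<Rightarrow> ('a, 'm) connection \<Rightarrow>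
     ('a \<Rightarrow> real ^ 'm) \<Rightarrow> ('a \<Rightarrow> real ^ 'm) \<Rightarrow> 'a \<Rightarrow> real" where
  "ricci A D X Y p = trace_at A p (\<lambda>Z. curvature A D Z X Y)"

definition star_ricci ::
    "('a, 'm::finite) chart set \<Rightarrow> ('a, 'm) connection \<Rightarrow> ('a \<Rightarrow> real ^ 'm \<Rightarrow> real ^ 'm) \<Rightarrow>
     ('a \<Rightarrow> real ^ 'm) \<Rightarrow> ('a \<Rightarrow> real ^ 'm) \<Rightarrow> 'a \<Rightarrow> real" where
  "star_ricci A D \<phi> X Y p =
     1 / 2 * trace_at A p (\<lambda>Z q. \<phi> q (curvature A D X (\<lambda>r. \<phi> r (Y r)) Z q))"

definition einstein ::
    "('a, 'm::finite) chart set \<Rightarrow> ('a \<Rightarrow> real ^ 'm \<Rightarrow> real ^ 'm \<Rightarrow> real) \<Rightarrow>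
     ('a, 'm) connection \<Rightarrow> bool" where
  "einstein A g D \<longleftrightarrow>
     (\<exists>a::real. \<forall>X\<in>vector_fields A. \<forall>Y\<in>vector_fields A. \<forall>p.
        ricci A D X Y p = a * g p (X p) (Y p))"

section \<open>Kenmotsu manifolds\<close>

definition almost_contact_metric ::
    "('a::{t2_space, second_countable_topology}, 'm::finite) chart set \<Rightarrow>
     ('a \<Rightarrow> real ^ 'm \<Rightarrow> real ^ 'm) \<Rightarrow> ('a \<Rightarrow> real ^ 'm) \<Rightarrow> ('a \<Rightarrow> real ^ 'm \<Rightarrow> real) \<Rightarrow>
     ('a \<Rightarrow> real ^ 'm \<Rightarrow> real ^ 'm \<Rightarrow> real) \<Rightarrow> bool" where
  "almost_contact_metric A \<phi> \<xi> \<eta> g \<longleftrightarrow>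
     smooth_atlas A \<and> odd CARD('m) \<and>
     tensor_field_11 A \<phi> \<and> \<xi> \<in> vector_fields A \<and> one_form A \<eta> \<and> riemannian_metric A g \<and>
     (\<forall>p v. \<phi> p (\<phi> p v) = - v + \<eta> p v *\<^sub>R \<xi> p) \<and>
     (\<forall>p. \<eta> p (\<xi> p) = 1) \<and>
     (\<forall>p u v. g p (\<phi> p u) (\<phi> p v) = g p u v - \<eta> p u * \<eta> p v)"

text \<open>The left-hand side of the last condition is \<open>(\<nabla>\<^sub>X \<phi>) Y = \<nabla>\<^sub>X (\<phi> Y) - \<phi> (\<nabla>\<^sub>X Y)\<close>.\<close>

definition kenmotsu ::
    "('a::{t2_space, second_countable_topology}, 'm::finite) chart set \<Rightarrow>
     ('a \<Rightarrow> real ^ 'm \<Rightarrow> real ^ 'm) \<Rightarrow> ('a \<Rightarrow> real ^ 'm) \<Rightarrow> ('a \<Rightarrow> real ^ 'm \<Rightarrow> real) \<Rightarrow>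
     ('a \<Rightarrow> real ^ 'm \<Rightarrow> real ^ 'm \<Rightarrow> real) \<Rightarrow> ('a, 'm) connection \<Rightarrow> bool" where
  "kenmotsu A \<phi> \<xi> \<eta> g D \<longleftrightarrow>
     almost_contact_metric A \<phi> \<xi> \<eta> g \<and>
     levi_civita_connection A g D \<and>
     (\<forall>X\<in>vector_fields A. \<forall>Y\<in>vector_fields A. \<forall>p.
        D X (\<lambda>q. \<phi> q (Y q)) p - \<phi> p (D X Y p) =
          g p (\<phi> p (X p)) (Y p) *\<^sub>R \<xi> p - \<eta> p (Y p) *\<^sub>R \<phi> p (X p))"

definition gradient_almost_star_conformal_eta_ricci_soliton ::
    "nat \<Rightarrow> ('a, 'm::finite) chart set \<Rightarrow>
     ('a \<Rightarrow> real ^ 'm \<Rightarrow> real ^ 'm) \<Rightarrow> ('a \<Rightarrow> real ^ 'm \<Rightarrow> real) \<Rightarrow>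
     ('a \<Rightarrow> real ^ 'm \<Rightarrow> real ^ 'm \<Rightarrow> real) \<Rightarrow> ('a, 'm) connection \<Rightarrow>
     ('a \<Rightarrow> real) \<Rightarrow> ('a \<Rightarrow> real) \<Rightarrow> real \<Rightarrow> real \<Rightarrow> bool" where
  "gradient_almost_star_conformal_eta_ricci_soliton n A \<phi> \<eta> g D f lam \<mu> P \<longleftrightarrow>
     f \<in> smooth_functions A \<and> lam \<in> smooth_functions A \<and>
     (\<forall>X\<in>vector_fields A. \<forall>Y\<in>vector_fields A. \<forall>p.
        hessian A g D f X Y p + star_ricci A D \<phi> X Y p +
        (lam p - (P / 2 + 1 / (2 * real n + 1))) * g p (X p) (Y p) +
        \<mu> * (\<eta> p (X p) * \<eta> p (Y p)) = 0)"

end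

theory Submission
  imports Defs
begin

text \<open>
  On a Kenmotsu manifold \<open>\<nabla>\<^sub>X \<xi> = X - \<eta>(X)\<xi>\<close>, so \<open>R(X,Y)\<xi> = \<eta>(X)Y - \<eta>(Y)X\<close> and the tensor
  \<open>K(X,Y)Z = R(X,Y)Z + g(Y,Z)X - g(X,Z)Y\<close> kills \<open>\<xi>\<close> and commutes with \<open>\<phi>\<close>. As for Kaehler
  curvature, this makes \<open>S\<^sup>*\<close> a Ricci-type trace: \<open>S\<^sup>* = S + (2n-1) g + \<eta>\<otimes>\<eta>\<close>, and the second Bianchi
  identity gives \<open>\<nabla>\<^sub>\<xi> K = -2K\<close>, hence \<open>\<nabla>\<^sub>\<xi> Q = -2Q - 4n\<close> for the Ricci operator \<open>Q\<close>.
  Writing the soliton equation as \<open>\<nabla>\<^sub>Y Df = -QY - \<sigma>Y - m\<eta>(Y)\<xi>\<close> and comparing the resulting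
  expression for \<open>R(\<xi>,Y)Df\<close> with the known one yields \<open>S = (a-2n) g - a \<eta>\<otimes>\<eta>\<close>, where
  \<open>d(f+\<sigma>) = (a+m)\<eta>\<close>; applying \<open>d\<close> once more shows that \<open>da\<close> is a multiple of \<open>\<eta>\<close>. The trace of
  \<open>X \<mapsto> R(X,Y)Df\<close>, computed in two ways, then shows that \<open>a Df\<close> is a multiple of \<open>\<xi>\<close>. If \<open>a\<close>
  vanishes identically the metric is Einstein, and otherwise \<open>Df\<close> is collinear with \<open>\<xi>\<close> on the
  open set where \<open>a \<noteq> 0\<close>.
\<close>

section \<open>Calculus of smooth maps between Euclidean spaces\<close>

text \<open>The laws of \<open>D\<close> are given only for global smooth fields, while the decisive
  algebra takes place in a single tangent space. Hence the long preparation: tensorial operators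
  must be shown to descend to points, traces must be differentiated through cut-off frames, and Df
  must be proved smooth before \<open>D\<close> may be applied to it. The coefficient -2 in the law
  for K arises because \<nabla>\<xi> is the identity on the kernel of \<eta> and enters the second
  Bianchi identity twice, through [\<xi>,X] and through [Y,\<xi>]. Every Kenmotsu manifold satisfies
  S(Y,\<xi>) = -2n \<eta>(Y); comparing this with the \<xi>-component of the formula for Q is what
  forces d(f+\<sigma>) to be a multiple of \<eta>. In the two evaluations of S(Y,Df) the term -2n
  df(Y) occurs on both sides and cancels. What survives is a df(Y) against multiples of \<eta>(Y):
  only the product a Df is controlled, and this is the source of the alternative in the
  conclusion.\<close>

lemma frechet_derivative_eqI:
  "(f has_derivative f') (at x) \<Longrightarrow> frechet_derivative f (at x) = f'"
  by (metis frechet_derivative_at)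

lemma has_derivative_frechet:
  "f differentiable (at x) \<Longrightarrow> (f has_derivative frechet_derivative f (at x)) (at x)"
  by (simp add: frechet_derivative_works)

text \<open>Both functions have the same candidate derivatives at \<open>x\<close>, so the choice
  inside \<open>frechet_derivative\<close> returns the same value even at a point of
  non-differentiability.\<close>

lemma frechet_derivative_cong_open:
  assumes "open S" "x \<in> S" "\<And>y. y \<in> S \<Longrightarrow> f y = g y"
  shows "frechet_derivative f (at x) = frechet_derivative g (at x)"
proof -
  have "(f has_derivative f') (at x) \<longleftrightarrow> (g has_derivative f') (at x)" for f'
    using assms has_derivative_transform_within_open[of f f' x UNIV S g]
      has_derivative_transform_within_open[of g f' x UNIV S f] by auto
  then show ?thesis by (simp add: frechet_derivative_def)
qed

lemma higher_differentiable_on_cong: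
  assumes "open S" "\<And>x. x \<in> S \<Longrightarrow> f x = g x" "higher_differentiable_on k S f"
  shows "higher_differentiable_on k S g"
  using assms(2,3)
proof (induction k arbitrary: f g)
  case 0
  then show ?case using continuous_on_cong[of S S f g] by simp
next
  case (Suc k)
  have "frechet_derivative f (at x) v = frechet_derivative g (at x) v" if "x \<in> S" for x v
    using frechet_derivative_cong_open[OF assms(1) that, of f g] Suc.prems(1) by simp
  moreover have "g differentiable (at x)" if "x \<in> S" for x
  proof -
    have "(f has_derivative frechet_derivative f (at x)) (at x)"
      using Suc.prems(2) that by (simp add: has_derivative_frechet)
    then have "(g has_derivative frechet_derivative f (at x)) (at x)"
      by (rule has_derivative_transform_within_open[OF _ assms(1) that]) (use Suc.prems(1) in auto)
    then show ?thesis by (auto simp: differentiable_def)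
  qed
  moreover have "higher_differentiable_on k S (\<lambda>x. frechet_derivative g (at x) v)" for v
    using Suc.IH[of "\<lambda>x. frechet_derivative f (at x) v"] calculation(1) Suc.prems(2) by simp
  ultimately show ?case by simp
qed

lemma higher_differentiable_on_local:
  assumes "\<And>x. x \<in> S \<Longrightarrow> \<exists>U. open U \<and> x \<in> U \<and> higher_differentiable_on k U f"
  shows "higher_differentiable_on k S f"
  using assms
proof (induction k arbitrary: f)
  case 0
  show ?case unfolding higher_differentiable_on.simps
  proof (intro continuous_at_imp_continuous_on ballI)
    show "isCont f x" if "x \<in> S" for x
      using 0[OF that] by (auto simp: continuous_on_eq_continuous_at)
  qed
next
  case (Suc k)
  show ?case unfolding higher_differentiable_on.simps
  proof (intro conjI ballI allI)
    show "f differentiable (at x)" if "x \<in> S" for x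
      using Suc.prems[OF that] by auto
    show "higher_differentiable_on k S (\<lambda>x. frechet_derivative f (at x) v)" for v
    proof (rule Suc.IH)
      show "\<exists>U. open U \<and> x \<in> U \<and> higher_differentiable_on k U (\<lambda>x. frechet_derivative f (at x) v)"
        if "x \<in> S" for x
        using Suc.prems[OF that] by auto
    qed
  qed
qed

lemma higher_differentiable_on_subset:
  "higher_differentiable_on k S f \<Longrightarrow> T \<subseteq> S \<Longrightarrow> higher_differentiable_on k T f"
proof (induction k arbitrary: f)
  case 0
  then show ?case by (auto intro: continuous_on_subset)
next
  case (Suc k)
  then show ?case by (auto simp: subset_eq)
qed

lemma higher_differentiable_on_Suc_D:
  "higher_differentiable_on (Suc k) S f \<Longrightarrow> higher_differentiable_on k S f"
proof (induction k arbitrary: f)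
  case 0
  then show ?case
    by (simp add: continuous_at_imp_continuous_on differentiable_imp_continuous_within)
next
  case (Suc k)
  then show ?case by (metis higher_differentiable_on.simps(2))
qed

lemma higher_differentiable_on_const: "higher_differentiable_on k S (\<lambda>x. c)"
  by (induction k arbitrary: c) auto

lemma higher_differentiable_on_add:
  assumes "open S" "higher_differentiable_on k S f" "higher_differentiable_on k S g"
  shows "higher_differentiable_on k S (\<lambda>x. f x + g x)"
  using assms(2,3)
proof (induction k arbitrary: f g)
  case 0
  then show ?case by (simp add: continuous_on_add)
next
  case (Suc k)
  have d: "frechet_derivative (\<lambda>x. f x + g x) (at x) v =
      frechet_derivative f (at x) v + frechet_derivative g (at x) v" if "x \<in> S" for x v
    using Suc.prems that
    by (subst frechet_derivative_eqI[OF has_derivative_add[OF has_derivative_frechet has_derivative_frechet]]) auto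
  have "higher_differentiable_on k S (\<lambda>x. frechet_derivative (\<lambda>x. f x + g x) (at x) v)" for v
    by (rule higher_differentiable_on_cong[OF assms(1) _ Suc.IH[of "\<lambda>x. frechet_derivative f (at x) v" "\<lambda>x. frechet_derivative g (at x) v"]]) (use d Suc.prems in auto)
  then show ?case using Suc.prems by auto
qed

text \<open>Each term of the product rule keeps one factor undifferentiated, so the induction step
  also uses that \<open>f\<close> and \<open>g\<close> themselves belong to the lower class
  \<open>k\<close>.\<close>

lemma higher_differentiable_on_scaleR:
  fixes f :: "'e::euclidean_space \<Rightarrow> real" and g :: "'e \<Rightarrow> 'f::euclidean_space"
  assumes "open S" "higher_differentiable_on k S f" "higher_differentiable_on k S g"
  shows "higher_differentiable_on k S (\<lambda>x. f x *\<^sub>R g x)"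
  using assms(2,3)
proof (induction k arbitrary: f g)
  case 0
  then show ?case by (simp add: continuous_on_scaleR)
next
  case (Suc k)
  have d: "frechet_derivative (\<lambda>x. f x *\<^sub>R g x) (at x) v =
      f x *\<^sub>R frechet_derivative g (at x) v + frechet_derivative f (at x) v *\<^sub>R g x" if "x \<in> S" for x v
    using Suc.prems that
    by (subst frechet_derivative_eqI[OF has_derivative_scaleR[OF has_derivative_frechet has_derivative_frechet]]) auto
  have "higher_differentiable_on k S (\<lambda>x. frechet_derivative (\<lambda>x. f x *\<^sub>R g x) (at x) v)" for v
    by (rule higher_differentiable_on_cong[OF assms(1) _ higher_differentiable_on_add[OF assms(1)
          Suc.IH[of f "\<lambda>x. frechet_derivative g (at x) v"]
          Suc.IH[of "\<lambda>x. frechet_derivative f (at x) v" g]]])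
      (use d Suc.prems higher_differentiable_on_Suc_D[OF Suc.prems(1)] higher_differentiable_on_Suc_D[OF Suc.prems(2)]
        in \<open>auto simp del: higher_differentiable_on.simps(1)\<close>)
  then show ?case using Suc.prems by auto
qed

lemma higher_differentiable_on_mult:
  fixes f g :: "'e::euclidean_space \<Rightarrow> real"
  assumes "open S" "higher_differentiable_on k S f" "higher_differentiable_on k S g"
  shows "higher_differentiable_on k S (\<lambda>x. f x * g x)"
  using higher_differentiable_on_scaleR[OF assms] by simp

lemma higher_differentiable_on_sum:
  assumes "open S" "finite I" "\<And>i. i \<in> I \<Longrightarrow> higher_differentiable_on k S (f i)"
  shows "higher_differentiable_on k S (\<lambda>x. \<Sum>i\<in>I. f i x)"
  using assms(2,3)
  by (induction I rule: finite_induct)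
     (auto intro!: higher_differentiable_on_add assms(1) higher_differentiable_on_const)

lemma higher_differentiable_on_prod:
  fixes f :: "'i \<Rightarrow> 'e::euclidean_space \<Rightarrow> real"
  assumes "open S" "finite I" "\<And>i. i \<in> I \<Longrightarrow> higher_differentiable_on k S (f i)"
  shows "higher_differentiable_on k S (\<lambda>x. \<Prod>i\<in>I. f i x)"
  using assms(2,3)
  by (induction I rule: finite_induct)
     (auto intro!: higher_differentiable_on_mult assms(1) higher_differentiable_on_const)

lemma higher_differentiable_on_linear:
  assumes "open S" "bounded_linear L" "higher_differentiable_on k S f"
  shows "higher_differentiable_on k S (\<lambda>x. L (f x))"
  using assms(3)
proof (induction k arbitrary: f)
  case 0
  then show ?case using bounded_linear.continuous_on[OF assms(2)] by simp
next
  case (Suc k)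
  have h: "((\<lambda>x. L (f x)) has_derivative (\<lambda>v. L (frechet_derivative f (at x) v))) (at x)" if "x \<in> S" for x
    using Suc.prems that by (auto intro!: bounded_linear.has_derivative[OF assms(2)] has_derivative_frechet)
  have "higher_differentiable_on k S (\<lambda>x. frechet_derivative (\<lambda>x. L (f x)) (at x) v)" for v
    by (rule higher_differentiable_on_cong[OF assms(1) _ Suc.IH[of "\<lambda>x. frechet_derivative f (at x) v"]])
       (use frechet_derivative_eqI[OF h] Suc.prems in auto)
  then show ?case using h by (auto simp: differentiable_def)
qed

lemma higher_differentiable_on_id: "higher_differentiable_on k S (\<lambda>x. x)"
  by (cases k) (auto intro: higher_differentiable_on_const)

text \<open>The class is defined through fixed directions, but the chain rule differentiates
  \<open>g\<close> in a direction that varies with \<open>x\<close>. Expanding that direction in the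
  basis gives products of real functions with composites of directional derivatives of
  \<open>g\<close>; the induction therefore generalises over \<open>g\<close> and keeps
  \<open>f\<close> fixed.\<close>

lemma higher_differentiable_on_compose:
  fixes f :: "'e::euclidean_space \<Rightarrow> 'f::euclidean_space" and g :: "'f \<Rightarrow> 'h::euclidean_space"
  assumes "open S" "open T" "f ` S \<subseteq> T"
    "higher_differentiable_on k S f" "higher_differentiable_on k T g"
  shows "higher_differentiable_on k S (\<lambda>x. g (f x))"
  using assms(4,5)
proof (induction k arbitrary: g)
  case 0
  then show ?case using continuous_on_compose2[of T g S f] assms(3) by auto
next
  case (Suc k)
  have h: "((\<lambda>x. g (f x)) has_derivative
      (\<lambda>v. frechet_derivative g (at (f x)) (frechet_derivative f (at x) v))) (at x)" if "x \<in> S" for x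
    using Suc.prems that assms(3)
    by (intro has_derivative_compose[of f _ x UNIV g]) (auto intro!: has_derivative_frechet)
  have e: "frechet_derivative (\<lambda>x. g (f x)) (at x) v =
      (\<Sum>b\<in>Basis. (frechet_derivative f (at x) v \<bullet> b) *\<^sub>R frechet_derivative g (at (f x)) b)"
    if "x \<in> S" for x v
  proof -
    have l: "linear (frechet_derivative g (at (f x)))"
      using Suc.prems that assms(3) by (auto intro!: linear_frechet_derivative)
    have "frechet_derivative g (at (f x)) (frechet_derivative f (at x) v) =
        frechet_derivative g (at (f x)) (\<Sum>b\<in>Basis. (frechet_derivative f (at x) v \<bullet> b) *\<^sub>R b)"
      by (simp add: euclidean_representation)
    then show ?thesis
      using frechet_derivative_eqI[OF h[OF that]] by (simp add: linear_sum[OF l] linear_scale[OF l])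
  qed
  have k: "higher_differentiable_on k S f" "higher_differentiable_on k T g"
    using Suc.prems higher_differentiable_on_Suc_D by auto
  have "higher_differentiable_on k S (\<lambda>x. frechet_derivative (\<lambda>x. g (f x)) (at x) v)" for v
  proof (rule higher_differentiable_on_cong[OF assms(1)])
    show "higher_differentiable_on k S (\<lambda>x. \<Sum>b\<in>Basis.
        (frechet_derivative f (at x) v \<bullet> b) *\<^sub>R frechet_derivative g (at (f x)) b)"
      using Suc.prems k(1)
      by (intro higher_differentiable_on_sum higher_differentiable_on_scaleR assms(1) finite_Basis
          higher_differentiable_on_linear[of S "\<lambda>y. y \<bullet> _"] bounded_linear_inner_left
          Suc.IH[of "\<lambda>y. frechet_derivative g (at y) _"]) auto
  qed (simp add: e)
  then show ?case using h by (auto simp: differentiable_def)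
qed

text \<open>The derivative is minus the square of the reciprocal times the derivative of
  \<open>f\<close>, so the reciprocal reappears at the lower level and induction on \<open>k\<close>
  alone suffices.\<close>

lemma higher_differentiable_on_inverse:
  fixes f :: "'e::euclidean_space \<Rightarrow> real"
  assumes "open S" "\<And>x. x \<in> S \<Longrightarrow> f x \<noteq> 0" "higher_differentiable_on k S f"
  shows "higher_differentiable_on k S (\<lambda>x. inverse (f x))"
  using assms(3)
proof (induction k)
  case 0
  then show ?case using assms(2) by (auto intro!: continuous_on_inverse)
next
  case (Suc k)
  have h: "((\<lambda>x. inverse (f x)) has_derivative
      (\<lambda>v. - (inverse (f x) * frechet_derivative f (at x) v * inverse (f x)))) (at x)" if "x \<in> S" for x
    by (intro Deriv.has_derivative_inverse has_derivative_frechet assms(2)[OF that])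
       (use Suc.prems that in auto)
  have i: "higher_differentiable_on k S (\<lambda>x. inverse (f x))"
    using Suc higher_differentiable_on_Suc_D by blast
  have "higher_differentiable_on k S (\<lambda>x. frechet_derivative (\<lambda>x. inverse (f x)) (at x) v)" for v
    by (rule higher_differentiable_on_cong[OF assms(1) _ higher_differentiable_on_scaleR[OF assms(1)
          higher_differentiable_on_const[of _ _ "-1"] higher_differentiable_on_scaleR[OF assms(1) i
          higher_differentiable_on_scaleR[OF assms(1) _ i]]],
          of "\<lambda>x. frechet_derivative f (at x) v"])
      (use frechet_derivative_eqI[OF h] Suc.prems in \<open>auto simp: algebra_simps\<close>)
  then show ?case using h by (auto simp: differentiable_def)
qed

section \<open>Closure properties of smooth maps\<close>

lemma smooth_on_cong:
  assumes "open S" "\<And>x. x \<in> S \<Longrightarrow> f x = g x" "smooth_on S f"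
  shows "smooth_on S g"
  using assms higher_differentiable_on_cong[of S f g] by (auto simp: smooth_on_def)

lemma smooth_on_local:
  assumes "\<And>x. x \<in> S \<Longrightarrow> \<exists>U. open U \<and> x \<in> U \<and> smooth_on U f"
  shows "smooth_on S f"
  unfolding smooth_on_def
proof
  fix k show "higher_differentiable_on k S f"
    using assms by (intro higher_differentiable_on_local) (auto simp: smooth_on_def)
qed

lemma smooth_on_subset: "smooth_on S f \<Longrightarrow> T \<subseteq> S \<Longrightarrow> smooth_on T f"
  unfolding smooth_on_def by (blast intro: higher_differentiable_on_subset)

lemma smooth_on_const: "smooth_on S (\<lambda>x. c)"
  by (simp add: smooth_on_def higher_differentiable_on_const)

lemma smooth_on_id: "smooth_on S (\<lambda>x. x)"
  by (simp add: smooth_on_def higher_differentiable_on_id)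

lemma smooth_on_add:
  "open S \<Longrightarrow> smooth_on S f \<Longrightarrow> smooth_on S g \<Longrightarrow> smooth_on S (\<lambda>x. f x + g x)"
  by (simp add: smooth_on_def higher_differentiable_on_add)

lemma smooth_on_scaleR:
  fixes f :: "'e::euclidean_space \<Rightarrow> real"
  shows "open S \<Longrightarrow> smooth_on S f \<Longrightarrow> smooth_on S g \<Longrightarrow> smooth_on S (\<lambda>x. f x *\<^sub>R g x)"
  by (simp add: smooth_on_def higher_differentiable_on_scaleR)

lemma smooth_on_mult:
  fixes f g :: "'e::euclidean_space \<Rightarrow> real"
  shows "open S \<Longrightarrow> smooth_on S f \<Longrightarrow> smooth_on S g \<Longrightarrow> smooth_on S (\<lambda>x. f x * g x)"
  using smooth_on_scaleR[of S f g] by simp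

lemma smooth_on_sum:
  "open S \<Longrightarrow> finite I \<Longrightarrow> (\<And>i. i \<in> I \<Longrightarrow> smooth_on S (f i)) \<Longrightarrow> smooth_on S (\<lambda>x. \<Sum>i\<in>I. f i x)"
  by (simp add: smooth_on_def higher_differentiable_on_sum)

lemma smooth_on_prod:
  fixes f :: "'i \<Rightarrow> 'e::euclidean_space \<Rightarrow> real"
  shows "open S \<Longrightarrow> finite I \<Longrightarrow> (\<And>i. i \<in> I \<Longrightarrow> smooth_on S (f i)) \<Longrightarrow> smooth_on S (\<lambda>x. \<Prod>i\<in>I. f i x)"
  by (simp add: smooth_on_def higher_differentiable_on_prod)

lemma smooth_on_linear:
  "open S \<Longrightarrow> bounded_linear L \<Longrightarrow> smooth_on S f \<Longrightarrow> smooth_on S (\<lambda>x. L (f x))"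
  by (simp add: smooth_on_def higher_differentiable_on_linear)

lemma smooth_on_vec_nth:
  "open S \<Longrightarrow> smooth_on S f \<Longrightarrow> smooth_on S (\<lambda>x. f x $ i)"
  by (rule smooth_on_linear[OF _ bounded_linear_vec_nth])

lemma smooth_on_compose:
  "open S \<Longrightarrow> open T \<Longrightarrow> f ` S \<subseteq> T \<Longrightarrow> smooth_on S f \<Longrightarrow> smooth_on T g \<Longrightarrow> smooth_on S (\<lambda>x. g (f x))"
  using higher_differentiable_on_compose[of S T f _ g] by (auto simp: smooth_on_def)

lemma smooth_on_inverse:
  fixes f :: "'e::euclidean_space \<Rightarrow> real"
  shows "open S \<Longrightarrow> (\<And>x. x \<in> S \<Longrightarrow> f x \<noteq> 0) \<Longrightarrow> smooth_on S f \<Longrightarrow> smooth_on S (\<lambda>x. inverse (f x))"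
  by (simp add: smooth_on_def higher_differentiable_on_inverse)

lemma smooth_on_D: "smooth_on S f \<Longrightarrow> higher_differentiable_on k S f"
  by (simp add: smooth_on_def)

lemma smooth_on_differentiable: "smooth_on S f \<Longrightarrow> x \<in> S \<Longrightarrow> f differentiable (at x)"
  using smooth_on_D[of S f "Suc 0"] by simp

lemma smooth_on_continuous: "smooth_on S f \<Longrightarrow> continuous_on S f"
  using smooth_on_D[of S f 0] by simp

lemma smooth_on_frechet_derivative:
  "smooth_on S f \<Longrightarrow> smooth_on S (\<lambda>x. frechet_derivative f (at x) v)"
  unfolding smooth_on_def[of S "\<lambda>x. frechet_derivative f (at x) v"]
proof
  show "higher_differentiable_on k S (\<lambda>x. frechet_derivative f (at x) v)" if "smooth_on S f" for k
    using smooth_on_D[OF that, of "Suc k"] by simp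
qed

text \<open>The varying direction \<open>w x\<close> is expanded in the basis, which leaves
  derivatives in fixed directions with smooth coefficients.\<close>

lemma smooth_on_frechet_derivative_field:
  assumes "open S" "smooth_on S f" "smooth_on S w"
  shows "smooth_on S (\<lambda>x. frechet_derivative f (at x) (w x))"
proof (rule smooth_on_cong[OF assms(1)])
  show "smooth_on S (\<lambda>x. \<Sum>b\<in>Basis. (w x \<bullet> b) *\<^sub>R frechet_derivative f (at x) b)"
    using assms by (intro smooth_on_sum smooth_on_scaleR finite_Basis smooth_on_frechet_derivative
        smooth_on_linear[of S "\<lambda>y. y \<bullet> _"] bounded_linear_inner_left) auto
next
  fix x assume "x \<in> S"
  then have l: "linear (frechet_derivative f (at x))"
    using assms(2) by (intro linear_frechet_derivative smooth_on_differentiable)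
  have "frechet_derivative f (at x) (w x) = frechet_derivative f (at x) (\<Sum>b\<in>Basis. (w x \<bullet> b) *\<^sub>R b)"
    by (simp add: euclidean_representation)
  then show "(\<Sum>b\<in>Basis. (w x \<bullet> b) *\<^sub>R frechet_derivative f (at x) b) = frechet_derivative f (at x) (w x)"
    by (simp add: linear_sum[OF l] linear_scale[OF l])
qed


section \<open>Symmetry of second derivatives\<close>

lemma DERIV_along_line:
  fixes f :: "'e::euclidean_space \<Rightarrow> real"
  assumes "f differentiable (at (w + s *\<^sub>R u))"
  shows "((\<lambda>s. f (w + s *\<^sub>R u)) has_field_derivative frechet_derivative f (at (w + s *\<^sub>R u)) u) (at s)"
proof -
  have "((\<lambda>s. w + s *\<^sub>R u) has_derivative (\<lambda>r. r *\<^sub>R u)) (at s)"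
    by (auto intro!: derivative_eq_intros)
  from has_derivative_compose[OF this has_derivative_frechet[OF assms]]
  have "((\<lambda>s. f (w + s *\<^sub>R u)) has_derivative (\<lambda>r. frechet_derivative f (at (w + s *\<^sub>R u)) (r *\<^sub>R u))) (at s)" .
  then show ?thesis
    using linear_scale[OF linear_frechet_derivative[OF assms]]
    by (simp add: has_field_derivative_def mult.commute[of _ "frechet_derivative f _ u"])
qed

text \<open>Two applications of the mean value theorem: first along \<open>u\<close> to the
  difference of \<open>f\<close> across the step in direction \<open>v\<close>, then along
  \<open>v\<close> to the derivative of \<open>f\<close> in direction \<open>u\<close>.\<close>

lemma second_difference_mean_value:
  fixes f :: "'e::euclidean_space \<Rightarrow> real"
  assumes f: "higher_differentiable_on (Suc (Suc k)) S f" and h: "0 < h"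
    and S: "\<And>s t. 0 \<le> s \<Longrightarrow> s \<le> h \<Longrightarrow> 0 \<le> t \<Longrightarrow> t \<le> h \<Longrightarrow> x + s *\<^sub>R u + t *\<^sub>R v \<in> S"
  obtains s t where "0 \<le> s" "s \<le> h" "0 \<le> t" "t \<le> h"
    "f (x + h *\<^sub>R u + h *\<^sub>R v) - f (x + h *\<^sub>R u) - f (x + h *\<^sub>R v) + f x =
      h * h * frechet_derivative (\<lambda>y. frechet_derivative f (at y) u) (at (x + s *\<^sub>R u + t *\<^sub>R v)) v"
proof -
  let ?d = "\<lambda>y. frechet_derivative f (at y) u"
  let ?\<phi> = "\<lambda>s. f (x + h *\<^sub>R v + s *\<^sub>R u) - f (x + s *\<^sub>R u)"
  have d: "f differentiable (at y)" "?d differentiable (at y)" if "y \<in> S" for y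
    using f that by auto
  have "(?\<phi> has_field_derivative ?d (x + h *\<^sub>R v + s *\<^sub>R u) - ?d (x + s *\<^sub>R u)) (at s)"
    if "0 \<le> s" "s \<le> h" for s
    using S[of s h] S[of s 0] that h
    by (intro DERIV_diff DERIV_along_line d) (auto simp: add_ac)
  then obtain s where s: "0 < s" "s < h" "?\<phi> h - ?\<phi> 0 = (h - 0) * (?d (x + h *\<^sub>R v + s *\<^sub>R u) - ?d (x + s *\<^sub>R u))"
    using MVT2[OF h, of ?\<phi> "\<lambda>s. ?d (x + h *\<^sub>R v + s *\<^sub>R u) - ?d (x + s *\<^sub>R u)"] by blast
  let ?\<psi> = "\<lambda>t. ?d (x + s *\<^sub>R u + t *\<^sub>R v)"
  have "(?\<psi> has_field_derivative frechet_derivative ?d (at (x + s *\<^sub>R u + t *\<^sub>R v)) v) (at t)"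
    if "0 \<le> t" "t \<le> h" for t
    using S[of s t] that s by (intro DERIV_along_line d) auto
  then obtain t where t: "0 < t" "t < h"
    "?\<psi> h - ?\<psi> 0 = (h - 0) * frechet_derivative ?d (at (x + s *\<^sub>R u + t *\<^sub>R v)) v"
    using MVT2[OF h, of ?\<psi> "\<lambda>t. frechet_derivative ?d (at (x + s *\<^sub>R u + t *\<^sub>R v)) v"] by blast
  show thesis
  proof (rule that[of s t])
    show "f (x + h *\<^sub>R u + h *\<^sub>R v) - f (x + h *\<^sub>R u) - f (x + h *\<^sub>R v) + f x =
      h * h * frechet_derivative ?d (at (x + s *\<^sub>R u + t *\<^sub>R v)) v"
      using s(3) t(3) by (simp add: add_ac)
  qed (use s t in auto)
qed

text \<open>The second difference is symmetric in \<open>u\<close> and \<open>v\<close>. It thus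
  equals both mixed derivatives, taken at two points near \<open>x\<close>, up to the common factor
  \<open>h * h\<close>; continuity of the mixed derivatives brings both points to
  \<open>x\<close>.\<close>

lemma second_derivative_symmetric:
  fixes f :: "'e::euclidean_space \<Rightarrow> real"
  assumes "open S" "x \<in> S" and f: "higher_differentiable_on (Suc (Suc 0)) S f"
  shows "frechet_derivative (\<lambda>y. frechet_derivative f (at y) u) (at x) v =
    frechet_derivative (\<lambda>y. frechet_derivative f (at y) v) (at x) u"
proof -
  let ?G = "\<lambda>y. frechet_derivative (\<lambda>y. frechet_derivative f (at y) u) (at y) v"
  let ?H = "\<lambda>y. frechet_derivative (\<lambda>y. frechet_derivative f (at y) v) (at y) u"
  have "continuous_on S ?G" "continuous_on S ?H" using f by auto
  then have c: "isCont ?G x" "isCont ?H x"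
    using assms by (auto simp: continuous_on_eq_continuous_at)
  have "\<bar>?G x - ?H x\<bar> < e" if "e > 0" for e
  proof -
    obtain d1 where d1: "d1 > 0" "\<And>y. dist y x < d1 \<Longrightarrow> dist (?G y) (?G x) < e / 2"
      using c(1) \<open>e > 0\<close> unfolding continuous_at_eps_delta by (meson half_gt_zero)
    obtain d2 where d2: "d2 > 0" "\<And>y. dist y x < d2 \<Longrightarrow> dist (?H y) (?H x) < e / 2"
      using c(2) \<open>e > 0\<close> unfolding continuous_at_eps_delta by (meson half_gt_zero)
    obtain d3 where d3: "d3 > 0" "\<And>y. dist y x < d3 \<Longrightarrow> y \<in> S"
      using assms(1,2) by (meson open_dist)
    define d where "d = min d1 (min d2 d3)"
    \<comment> \<open>The summand 1 keeps the denominator positive when \<open>u\<close> and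
      \<open>v\<close> both vanish; the factor 2 keeps the whole parallelogram within distance
      \<open>d / 2\<close> of \<open>x\<close>.\<close>
    define h where "h = d / (2 * (norm u + norm v + 1))"
    have d: "d > 0" using d1 d2 d3 by (simp add: d_def)
    have n: "norm u + norm v + 1 > 0" by (simp add: add_nonneg_pos)
    have h: "h > 0" using d n by (simp add: h_def)
    have near: "dist (x + s *\<^sub>R a + t *\<^sub>R b) x < d"
      if "0 \<le> s" "s \<le> h" "0 \<le> t" "t \<le> h" and ab: "(a, b) = (u, v) \<or> (a, b) = (v, u)" for s t a b
    proof -
      have "dist (x + s *\<^sub>R a + t *\<^sub>R b) x \<le> norm (s *\<^sub>R a) + norm (t *\<^sub>R b)"
        by (metis add.commute add_diff_cancel_left' dist_norm group_cancel.add1 norm_triangle_ineq)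
      also have "\<dots> \<le> h * norm a + h * norm b"
        using that by (auto intro!: add_mono mult_right_mono)
      also have "\<dots> = h * (norm u + norm v)"
        using ab by (auto simp: algebra_simps)
      also have "\<dots> \<le> h * (norm u + norm v + 1)"
        using h by simp
      also have "\<dots> = d / 2" using n by (simp add: h_def field_simps)
      also have "\<dots> < d" using d by simp
      finally show ?thesis .
    qed
    have inS: "x + s *\<^sub>R a + t *\<^sub>R b \<in> S"
      if "0 \<le> s" "s \<le> h" "0 \<le> t" "t \<le> h" "(a, b) = (u, v) \<or> (a, b) = (v, u)" for s t a b
      using near[OF that] by (intro d3(2)) (simp add: d_def)
    obtain s t where st: "0 \<le> s" "s \<le> h" "0 \<le> t" "t \<le> h"
      "f (x + h *\<^sub>R u + h *\<^sub>R v) - f (x + h *\<^sub>R u) - f (x + h *\<^sub>R v) + f x = h * h * ?G (x + s *\<^sub>R u + t *\<^sub>R v)"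
      by (rule second_difference_mean_value[OF f h, of x u v]) (rule inS; simp)
    obtain s' t' where st': "0 \<le> s'" "s' \<le> h" "0 \<le> t'" "t' \<le> h"
      "f (x + h *\<^sub>R v + h *\<^sub>R u) - f (x + h *\<^sub>R v) - f (x + h *\<^sub>R u) + f x = h * h * ?H (x + s' *\<^sub>R v + t' *\<^sub>R u)"
      by (rule second_difference_mean_value[OF f h, of x v u]) (rule inS; simp)
    have "h * h * ?G (x + s *\<^sub>R u + t *\<^sub>R v) = h * h * ?H (x + s' *\<^sub>R v + t' *\<^sub>R u)"
    proof -
      have "f (x + h *\<^sub>R v + h *\<^sub>R u) - f (x + h *\<^sub>R v) - f (x + h *\<^sub>R u) + f x =
          f (x + h *\<^sub>R u + h *\<^sub>R v) - f (x + h *\<^sub>R u) - f (x + h *\<^sub>R v) + f x"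
        by (simp add: add_ac)
      then show ?thesis using st(5) st'(5) by (simp only:)
    qed
    then have eq: "?G (x + s *\<^sub>R u + t *\<^sub>R v) = ?H (x + s' *\<^sub>R v + t' *\<^sub>R u)"
      using h by simp
    have "dist (?G (x + s *\<^sub>R u + t *\<^sub>R v)) (?G x) < e / 2"
      using near[OF st(1-4), of u v] by (intro d1(2)) (simp add: d_def)
    moreover have "dist (?H (x + s' *\<^sub>R v + t' *\<^sub>R u)) (?H x) < e / 2"
      using near[OF st'(1-4), of v u] by (intro d2(2)) (simp add: d_def)
    ultimately show ?thesis using eq unfolding dist_real_def by linarith
  qed
  \<comment> \<open>If the two values differed, taking their distance as \<open>e\<close> would give
    \<open>e < e\<close>.\<close>
  from this[of "\<bar>?G x - ?H x\<bar>"] show ?thesis by (cases "?G x = ?H x") auto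
qed

text \<open>The span of these functions is closed under differentiation, whence they are smooth at \<open>0\<close>.\<close>

definition flat_exp :: "nat \<Rightarrow> real \<Rightarrow> real" where
  "flat_exp j t = (if t > 0 then inverse t ^ j * exp (- inverse t) else 0)"

lemma flat_exp_tendsto_0: "((flat_exp j) \<longlongrightarrow> 0) (at 0)"
proof -
  have "((\<lambda>t. inverse t ^ j / exp (inverse t)) \<longlongrightarrow> 0) (at_right (0::real))"
    by (rule filterlim_compose[OF tendsto_power_div_exp_0 filterlim_inverse_at_top_right])
  then have r: "(flat_exp j \<longlongrightarrow> 0) (at_right 0)"
    by (rule Lim_transform_eventually)
       (auto simp: eventually_at_filter flat_exp_def exp_minus field_simps)
  have l: "(flat_exp j \<longlongrightarrow> 0) (at_left 0)"
    by (rule Lim_transform_eventually[OF tendsto_const])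
       (auto simp: eventually_at_filter flat_exp_def)
  show ?thesis using l r by (simp add: filterlim_at_split)
qed

lemma flat_exp_has_derivative:
  "(flat_exp j has_field_derivative flat_exp (j + 2) t - real j * flat_exp (j + 1) t) (at t)"
proof -
  consider "t > 0" | "t < 0" | "t = 0" by linarith
  then show ?thesis
  proof cases
    case 1
    have "((\<lambda>t. inverse t ^ j * exp (- inverse t)) has_field_derivative
        flat_exp (j + 2) t - real j * flat_exp (j + 1) t) (at t)"
    proof -
      have "((\<lambda>t. inverse t ^ j) has_field_derivative - (real j * inverse t ^ (j + 1))) (at t)"
      proof (cases j)
        case (Suc i)
        have "((\<lambda>t. inverse t ^ Suc i) has_field_derivative real (Suc i) * (- (inverse t ^ Suc (Suc 0)) * inverse t ^ i)) (at t)"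
          using DERIV_power[OF DERIV_inverse[of t UNIV], of "Suc i"] 1 by (simp del: power_Suc)
        then show ?thesis by (simp add: Suc mult_ac)
      qed simp
      moreover have "((\<lambda>t. exp (- inverse t)) has_field_derivative exp (- inverse t) * (inverse t ^ 2)) (at t)"
        using 1 by (auto intro!: derivative_eq_intros simp: power2_eq_square field_simps)
      ultimately show ?thesis
        using 1 by (auto intro!: DERIV_cong[OF DERIV_mult] simp: flat_exp_def algebra_simps power_add power2_eq_square)
    qed
    then show ?thesis
      by (rule has_field_derivative_transform_within_open[of _ _ _ "{0<..}"]) (use 1 in \<open>auto simp: flat_exp_def\<close>)
  next
    case 2
    have "((\<lambda>t. 0) has_field_derivative flat_exp (j + 2) t - real j * flat_exp (j + 1) t) (at t)"
      using 2 by (simp add: flat_exp_def)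
    then show ?thesis
      by (rule has_field_derivative_transform_within_open[of _ _ _ "{..<0}"]) (use 2 in \<open>auto simp: flat_exp_def\<close>)
  next
    case 3
    \<comment> \<open>The difference quotient at 0 is the next function of the family,
      \<open>flat_exp (Suc j)\<close>, which tends to 0.\<close>
    have "((\<lambda>t. (flat_exp j t - flat_exp j 0) / (t - 0)) \<longlongrightarrow> 0) (at 0)"
      by (rule Lim_transform_eventually[OF flat_exp_tendsto_0[of "Suc j"]])
         (auto simp: eventually_at_filter flat_exp_def field_simps)
    then show ?thesis using 3 by (simp add: has_field_derivative_iff flat_exp_def)
  qed
qed

lemma smooth_on_flat_exp: "smooth_on S (flat_exp j)"
proof -
  have "higher_differentiable_on k UNIV (flat_exp j)" for k j
  proof (induction k arbitrary: j)
    case 0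
    show ?case
      using flat_exp_has_derivative by (auto intro!: continuous_at_imp_continuous_on DERIV_isCont)
  next
    case (Suc k)
    have d: "(flat_exp j has_derivative (\<lambda>v. (flat_exp (j + 2) t - real j * flat_exp (j + 1) t) * v)) (at t)" for t
      using flat_exp_has_derivative[of j t] by (simp add: has_field_derivative_def mult_commute_abs)
    have e: "frechet_derivative (flat_exp j) (at t) v = v * flat_exp (j + 2) t + (- real j * v) * flat_exp (j + 1) t" for t v
      by (simp add: frechet_derivative_eqI[OF d] algebra_simps)
    have "higher_differentiable_on k UNIV (\<lambda>t. v * flat_exp (j + 2) t + (- real j * v) * flat_exp (j + 1) t)" for v
      by (intro higher_differentiable_on_add higher_differentiable_on_mult higher_differentiable_on_const Suc open_UNIV)
    then show ?case using d by (auto simp: e differentiable_def)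
  qed
  then show ?thesis
    by (auto simp: smooth_on_def intro: higher_differentiable_on_subset)
qed

text \<open>A radial profile without plateau: \<open>\<beta>\<close> peaks at \<open>a\<close>, so
  its derivative vanishes there. This first-order flatness is what makes the later cut-offs
  invisible in first derivatives at the point.\<close>

lemma bump_function_exists:
  fixes a :: "'e::euclidean_space"
  assumes "r > 0"
  obtains \<beta> :: "'e \<Rightarrow> real" where "smooth_on UNIV \<beta>" "\<beta> a = 1" "(\<beta> has_derivative (\<lambda>v. 0)) (at a)"
    "\<And>x. x \<notin> cball a r \<Longrightarrow> \<beta> x = 0"
proof -
  define \<beta> where "\<beta> x = flat_exp 0 (r\<^sup>2 - (x - a) \<bullet> (x - a)) / flat_exp 0 (r\<^sup>2)" for x
  have p: "flat_exp 0 (r\<^sup>2) \<noteq> 0" using assms by (simp add: flat_exp_def)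
  have q: "smooth_on UNIV (\<lambda>x. (x - a) \<bullet> (x - a))"
  proof (rule smooth_on_cong[OF open_UNIV])
    show "smooth_on UNIV (\<lambda>x. \<Sum>b\<in>Basis. ((x + - a) \<bullet> b) * ((x + - a) \<bullet> b))"
      by (intro smooth_on_sum smooth_on_mult open_UNIV finite_Basis smooth_on_add smooth_on_id smooth_on_const
          smooth_on_linear[of _ "\<lambda>y. y \<bullet> _"] bounded_linear_inner_left)
  qed (simp add: euclidean_inner[symmetric])
  have i: "smooth_on UNIV (\<lambda>x. r\<^sup>2 + (-1) * ((x - a) \<bullet> (x - a)))"
    by (intro smooth_on_add smooth_on_mult smooth_on_const q open_UNIV)
  have "smooth_on UNIV (\<lambda>x. inverse (flat_exp 0 (r\<^sup>2)) * flat_exp 0 (r\<^sup>2 + (-1) * ((x - a) \<bullet> (x - a))))"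
    by (intro smooth_on_mult smooth_on_const open_UNIV smooth_on_compose[OF open_UNIV open_UNIV _ i]
        smooth_on_flat_exp) auto
  then have "smooth_on UNIV \<beta>"
    by (rule smooth_on_cong[OF open_UNIV, rotated]) (simp add: \<beta>_def field_simps)
  moreover have "\<beta> a = 1" using p by (simp add: \<beta>_def)
  moreover have "(\<beta> has_derivative (\<lambda>v. 0)) (at a)"
  proof -
    have 1: "((\<lambda>x. r\<^sup>2 - (x - a) \<bullet> (x - a)) has_derivative (\<lambda>v. 0)) (at a)"
      by (auto intro!: derivative_eq_intros)
    have "(flat_exp 0 has_derivative (\<lambda>v. (flat_exp (0 + 2) (r\<^sup>2) - real 0 * flat_exp (0 + 1) (r\<^sup>2)) * v)) (at (r\<^sup>2 - (a - a) \<bullet> (a - a)))"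
      using flat_exp_has_derivative[of 0 "r\<^sup>2"] unfolding has_field_derivative_def by simp
    from has_derivative_compose[OF 1 this]
    have "((\<lambda>x. flat_exp 0 (r\<^sup>2 - (x - a) \<bullet> (x - a))) has_derivative (\<lambda>v. 0)) (at a)" by simp
    from has_derivative_scaleR_right[OF this, of "inverse (flat_exp 0 (r\<^sup>2))"]
    show ?thesis by (simp add: \<beta>_def[abs_def] divide_inverse mult.commute)
  qed
  moreover have "\<beta> x = 0" if "x \<notin> cball a r" for x
  proof -
    have "r\<^sup>2 \<le> (norm (x - a))\<^sup>2"
      using that assms by (intro power_mono) (auto simp: dist_norm norm_minus_commute)
    then show ?thesis by (simp add: \<beta>_def flat_exp_def power2_norm_eq_inner)
  qed
  ultimately show thesis by (rule that)
qed

section \<open>Functions and vector fields on a manifold\<close>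

locale smooth_manifold =
  fixes A :: "('a::{t2_space, second_countable_topology}, 'm::finite) chart set"
  assumes atlas: "smooth_atlas A"
begin

section \<open>Charts and components of tangent vectors\<close>

lemma chart_facts:
  assumes "c \<in> A"
  shows "open (fst c)" "open (snd c ` fst c)" "continuous_on (fst c) (snd c)"
    "continuous_on (snd c ` fst c) (chart_inv c)"
    "p \<in> fst c \<Longrightarrow> chart_inv c (snd c p) = p"
    "x \<in> snd c ` fst c \<Longrightarrow> snd c (chart_inv c x) = x"
    "x \<in> snd c ` fst c \<Longrightarrow> chart_inv c x \<in> fst c"
proof -
  have h: "open (fst c)" "open (snd c ` fst c)" "homeomorphism (fst c) (snd c ` fst c) (snd c) (chart_inv c)"
    using atlas assms by (auto simp: smooth_atlas_def)
  then show "open (fst c)" "open (snd c ` fst c)" "continuous_on (fst c) (snd c)"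
    "continuous_on (snd c ` fst c) (chart_inv c)"
    "p \<in> fst c \<Longrightarrow> chart_inv c (snd c p) = p"
    "x \<in> snd c ` fst c \<Longrightarrow> snd c (chart_inv c x) = x"
    "x \<in> snd c ` fst c \<Longrightarrow> chart_inv c x \<in> fst c"
    by (auto simp: homeomorphism_def)
qed

lemma chart_at_mem: "chart_at A p \<in> A" "p \<in> fst (chart_at A p)"
proof -
  have "\<exists>c. c \<in> A \<and> p \<in> fst c" using atlas UN_iff[of p fst A] by (auto simp only: smooth_atlas_def)
  from someI_ex[OF this] show "chart_at A p \<in> A" "p \<in> fst (chart_at A p)"
    by (auto simp: chart_at_def)
qed

lemma open_chart_image:
  assumes "c \<in> A" "open W"
  shows "open (snd c ` (fst c \<inter> W))"
proof -
  have "snd c ` (fst c \<inter> W) = (snd c ` fst c) \<inter> chart_inv c -` W"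
    using chart_facts[OF assms(1)] by force
  then show ?thesis
    using continuous_on_open_vimage[OF chart_facts(2)[OF assms(1)], of "chart_inv c"]
      chart_facts(4)[OF assms(1)] assms(2) by (metis Int_commute)
qed

lemma smooth_on_chart_local:
  assumes "c \<in> A" "\<And>p. p \<in> fst c \<Longrightarrow> \<exists>W. open W \<and> p \<in> W \<and> smooth_on (snd c ` (fst c \<inter> W)) F"
  shows "smooth_on (snd c ` fst c) F"
proof (rule smooth_on_local)
  fix x assume "x \<in> snd c ` fst c"
  then obtain p where p: "p \<in> fst c" "x = snd c p" by auto
  obtain W where "open W" "p \<in> W" "smooth_on (snd c ` (fst c \<inter> W)) F" using assms(2)[OF p(1)] by auto
  then show "\<exists>U. open U \<and> x \<in> U \<and> smooth_on U F"
    using open_chart_image[OF assms(1), of W] p by (intro exI[of _ "snd c ` (fst c \<inter> W)"]) auto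
qed

lemma transition_smooth:
  "c \<in> A \<Longrightarrow> d \<in> A \<Longrightarrow> smooth_on (snd c ` (fst c \<inter> fst d)) (snd d \<circ> chart_inv c)"
  using atlas by (auto simp: smooth_atlas_def)

lemma transition_differentiable:
  "c \<in> A \<Longrightarrow> d \<in> A \<Longrightarrow> p \<in> fst c \<Longrightarrow> p \<in> fst d \<Longrightarrow> (snd d \<circ> chart_inv c) differentiable (at (snd c p))"
  by (rule smooth_on_differentiable[OF transition_smooth]) auto

lemma chart_chain:
  assumes "c \<in> A" "d \<in> A" "p \<in> fst c" "p \<in> fst d" "(F \<circ> chart_inv d) differentiable (at (snd d p))"
  shows "frechet_derivative (F \<circ> chart_inv c) (at (snd c p)) v =
    frechet_derivative (F \<circ> chart_inv d) (at (snd d p))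
      (frechet_derivative (snd d \<circ> chart_inv c) (at (snd c p)) v)"
proof -
  have o: "open (snd c ` (fst c \<inter> fst d))" "snd c p \<in> snd c ` (fst c \<inter> fst d)"
    using open_chart_image assms chart_facts by auto
  have e: "frechet_derivative (F \<circ> chart_inv c) (at (snd c p)) =
      frechet_derivative ((F \<circ> chart_inv d) \<circ> (snd d \<circ> chart_inv c)) (at (snd c p))"
    by (rule frechet_derivative_cong_open[OF o])
       (use chart_facts(5)[OF assms(1)] chart_facts(5)[OF assms(2)] in auto)
  have s: "(snd d \<circ> chart_inv c) (snd c p) = snd d p"
    using chart_facts(5)[OF assms(1,3)] by simp
  have "((F \<circ> chart_inv d) \<circ> (snd d \<circ> chart_inv c) has_derivative
      (frechet_derivative (F \<circ> chart_inv d) (at (snd d p))) \<circ>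
      (frechet_derivative (snd d \<circ> chart_inv c) (at (snd c p)))) (at (snd c p))"
    using assms(5) transition_differentiable[OF assms(1-4)] s
    by (intro diff_chain_at has_derivative_frechet) (auto intro!: has_derivative_frechet)
  from frechet_derivative_eqI[OF this] e show ?thesis by simp
qed

lemma components_linear:
  assumes "c \<in> A" "p \<in> fst c" shows "linear (components A c p)"
  unfolding components_def Let_def
  by (rule linear_frechet_derivative[OF transition_differentiable[OF chart_at_mem(1) assms(1) chart_at_mem(2) assms(2)]])

lemma transition_self:
  assumes "c \<in> A" "p \<in> fst c"
  shows "frechet_derivative (snd c \<circ> chart_inv c) (at (snd c p)) v = v"
proof -
  have "frechet_derivative (snd c \<circ> chart_inv c) (at (snd c p)) = frechet_derivative (\<lambda>x. x) (at (snd c p))"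
    by (rule frechet_derivative_cong_open[OF chart_facts(2)[OF assms(1)]]) (use assms chart_facts in auto)
  then show ?thesis by simp
qed

lemma components_self: "components A (chart_at A p) p v = v"
  by (simp add: components_def Let_def transition_self chart_at_mem)

lemma components_transition:
  assumes "c \<in> A" "d \<in> A" "p \<in> fst c" "p \<in> fst d"
  shows "components A d p v = frechet_derivative (snd d \<circ> chart_inv c) (at (snd c p)) (components A c p v)"
  unfolding components_def Let_def
  by (rule chart_chain[OF chart_at_mem(1) assms(1) chart_at_mem(2) assms(3) transition_differentiable[OF assms]])

text \<open>Inverse of \<open>components A c p\<close>: it turns components in the chart
  \<open>c\<close> into those in the preferred chart, which by convention are the tangent vector
  itself.\<close>

definition lift :: "('a, 'm) chart \<Rightarrow> 'a \<Rightarrow> real ^ 'm \<Rightarrow> real ^ 'm" where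
  "lift c p w = frechet_derivative (snd (chart_at A p) \<circ> chart_inv c) (at (snd c p)) w"

lemma components_lift_transition:
  assumes "c \<in> A" "d \<in> A" "p \<in> fst c" "p \<in> fst d"
  shows "components A d p (lift c p w) = frechet_derivative (snd d \<circ> chart_inv c) (at (snd c p)) w"
  unfolding components_def Let_def lift_def
  by (rule chart_chain[symmetric, OF assms(1) chart_at_mem(1) assms(3) chart_at_mem(2)
        transition_differentiable[OF chart_at_mem(1) assms(2) chart_at_mem(2) assms(4)]])

lemma lift_components: "c \<in> A \<Longrightarrow> p \<in> fst c \<Longrightarrow> lift c p (components A c p v) = v"
  using components_transition[OF _ chart_at_mem(1) _ chart_at_mem(2), of c p v]
  by (simp add: lift_def components_self)

lemma lift_linear: "c \<in> A \<Longrightarrow> p \<in> fst c \<Longrightarrow> linear (lift c p)"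
  unfolding lift_def
  by (rule linear_frechet_derivative[OF transition_differentiable[OF _ chart_at_mem(1) _ chart_at_mem(2)]])

section \<open>The ring of smooth functions and its module of vector fields\<close>

lemma function_smooth: "f \<in> smooth_functions A \<Longrightarrow> c \<in> A \<Longrightarrow> smooth_on (snd c ` fst c) (f \<circ> chart_inv c)"
  by (simp add: smooth_functions_def)

lemma field_smooth: "X \<in> vector_fields A \<Longrightarrow> c \<in> A \<Longrightarrow> smooth_on (snd c ` fst c) (local_rep A c X)"
  by (simp add: vector_fields_def)

lemma function_differentiable:
  "f \<in> smooth_functions A \<Longrightarrow> c \<in> A \<Longrightarrow> p \<in> fst c \<Longrightarrow> (f \<circ> chart_inv c) differentiable (at (snd c p))"
  using smooth_on_differentiable[OF function_smooth] by auto

lemma function_continuous: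
  assumes "f \<in> smooth_functions A" shows "continuous_on UNIV f"
proof (intro continuous_at_imp_continuous_on ballI)
  fix p
  let ?c = "chart_at A p"
  have "continuous_on (fst ?c) (\<lambda>q. (f \<circ> chart_inv ?c) (snd ?c q))"
    using smooth_on_continuous[OF function_smooth[OF assms chart_at_mem(1)]] chart_facts(3)[OF chart_at_mem(1)]
    by (rule continuous_on_compose2) auto
  then have "continuous_on (fst ?c) f"
    by (rule continuous_on_cong[THEN iffD1, OF refl, rotated])
       (auto simp: chart_facts(5)[OF chart_at_mem(1)])
  then show "isCont f p"
    using chart_at_mem[of p] chart_facts(1) continuous_on_eq_continuous_at by blast
qed

lemma functions_const: "(\<lambda>p. k) \<in> smooth_functions A"
  by (simp add: smooth_functions_def o_def smooth_on_const)

lemma functions_add: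
  "f \<in> smooth_functions A \<Longrightarrow> h \<in> smooth_functions A \<Longrightarrow> (\<lambda>p. f p + h p) \<in> smooth_functions A"
  using chart_facts(2) by (simp add: smooth_functions_def o_def smooth_on_add)

lemma functions_mult:
  "f \<in> smooth_functions A \<Longrightarrow> h \<in> smooth_functions A \<Longrightarrow> (\<lambda>p. f p * h p) \<in> smooth_functions A"
  using chart_facts(2) by (simp add: smooth_functions_def o_def smooth_on_mult)

lemma functions_uminus:
  "f \<in> smooth_functions A \<Longrightarrow> (\<lambda>p. - f p) \<in> smooth_functions A"
  using functions_mult[OF functions_const[of "-1"]] by simp

lemma functions_diff:
  "f \<in> smooth_functions A \<Longrightarrow> h \<in> smooth_functions A \<Longrightarrow> (\<lambda>p. f p - h p) \<in> smooth_functions A"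
  using functions_add[OF _ functions_uminus] by simp

lemma functions_sum:
  "(\<And>i. i \<in> I \<Longrightarrow> f i \<in> smooth_functions A) \<Longrightarrow> (\<lambda>p. \<Sum>i\<in>I. f i p) \<in> smooth_functions A"
  by (induction I rule: infinite_finite_induct) (auto intro: functions_const functions_add)

lemma local_rep_add:
  "c \<in> A \<Longrightarrow> x \<in> snd c ` fst c \<Longrightarrow>
    local_rep A c (\<lambda>p. X p + Y p) x = local_rep A c X x + local_rep A c Y x"
  by (simp add: local_rep_def linear_add[OF components_linear] chart_facts(7))

lemma local_rep_scaleR:
  "c \<in> A \<Longrightarrow> x \<in> snd c ` fst c \<Longrightarrow>
    local_rep A c (\<lambda>p. f p *\<^sub>R X p) x = (f \<circ> chart_inv c) x *\<^sub>R local_rep A c X x"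
  by (simp add: local_rep_def linear_scale[OF components_linear] chart_facts(7))

lemma fields_add:
  assumes "X \<in> vector_fields A" "Y \<in> vector_fields A"
  shows "(\<lambda>p. X p + Y p) \<in> vector_fields A"
  unfolding vector_fields_def
proof safe
  fix a b assume c: "(a, b) \<in> A"
  show "smooth_on (snd (a,b) ` fst (a,b)) (local_rep A (a,b) (\<lambda>p. X p + Y p))"
    by (rule smooth_on_cong[OF _ _ smooth_on_add[OF _ field_smooth[OF assms(1) c] field_smooth[OF assms(2) c]]])
       (use local_rep_add[OF c] chart_facts(2)[OF c] in auto)
qed

lemma fields_scaleR:
  assumes "f \<in> smooth_functions A" "X \<in> vector_fields A"
  shows "(\<lambda>p. f p *\<^sub>R X p) \<in> vector_fields A"
  unfolding vector_fields_def
proof safe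
  fix a b assume c: "(a, b) \<in> A"
  show "smooth_on (snd (a,b) ` fst (a,b)) (local_rep A (a,b) (\<lambda>p. f p *\<^sub>R X p))"
    by (rule smooth_on_cong[OF _ _ smooth_on_scaleR[OF _ function_smooth[OF assms(1) c] field_smooth[OF assms(2) c]]])
       (use local_rep_scaleR[OF c] chart_facts(2)[OF c] in auto)
qed

lemma fields_scaleR_const: "X \<in> vector_fields A \<Longrightarrow> (\<lambda>p. k *\<^sub>R X p) \<in> vector_fields A"
  by (rule fields_scaleR[OF functions_const])

lemma fields_uminus: "X \<in> vector_fields A \<Longrightarrow> (\<lambda>p. - X p) \<in> vector_fields A"
  using fields_scaleR_const[of X "-1"] by simp

lemma fields_diff:
  "X \<in> vector_fields A \<Longrightarrow> Y \<in> vector_fields A \<Longrightarrow> (\<lambda>p. X p - Y p) \<in> vector_fields A"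
  using fields_add[OF _ fields_uminus] by simp

lemma fields_zero: "(\<lambda>p. 0) \<in> vector_fields A"
  unfolding vector_fields_def
proof (intro CollectI ballI)
  fix c assume c: "c \<in> A"
  show "smooth_on (snd c ` fst c) (local_rep A c (\<lambda>p. 0))"
    by (rule smooth_on_cong[OF chart_facts(2)[OF c] _ smooth_on_const[of _ 0]])
       (auto simp only: local_rep_def linear_0[OF components_linear[OF c chart_facts(7)[OF c]]])
qed

lemma fields_sum:
  "(\<And>i. i \<in> I \<Longrightarrow> X i \<in> vector_fields A) \<Longrightarrow> (\<lambda>p. \<Sum>i\<in>I. X i p) \<in> vector_fields A"
  by (induction I rule: infinite_finite_induct) (auto intro: fields_zero fields_add)

section \<open>Differentials and Lie brackets\<close>

lemma differential_chart:
  assumes "f \<in> smooth_functions A" "c \<in> A" "p \<in> fst c"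
  shows "differential A f p v = frechet_derivative (f \<circ> chart_inv c) (at (snd c p)) (components A c p v)"
  unfolding differential_def components_def Let_def
  by (rule chart_chain[OF chart_at_mem(1) assms(2) chart_at_mem(2) assms(3) function_differentiable[OF assms]])

lemma differential_has_derivative:
  "f \<in> smooth_functions A \<Longrightarrow>
    (f \<circ> chart_inv (chart_at A p) has_derivative differential A f p) (at (snd (chart_at A p) p))"
  using has_derivative_frechet[OF function_differentiable[OF _ chart_at_mem]]
  by (simp add: differential_def[abs_def] Let_def)

lemma differential_eqI:
  "(f \<circ> chart_inv (chart_at A p) has_derivative f') (at (snd (chart_at A p) p)) \<Longrightarrow> differential A f p v = f' v"
  by (simp add: differential_def Let_def frechet_derivative_eqI)

lemma differential_linear: "f \<in> smooth_functions A \<Longrightarrow> linear (differential A f p)"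
  using differential_has_derivative has_derivative_linear by blast

lemma differential_const: "differential A (\<lambda>p. k) p v = 0"
  by (rule differential_eqI) (simp add: o_def)

lemma differential_add:
  "f \<in> smooth_functions A \<Longrightarrow> h \<in> smooth_functions A \<Longrightarrow>
    differential A (\<lambda>q. f q + h q) p v = differential A f p v + differential A h p v"
  by (rule differential_eqI)
     (use has_derivative_add[OF differential_has_derivative[of f p] differential_has_derivative[of h p]] in \<open>simp add: o_def\<close>)

lemma differential_mult:
  assumes "f \<in> smooth_functions A" "h \<in> smooth_functions A"
  shows "differential A (\<lambda>q. f q * h q) p v = differential A f p v * h p + f p * differential A h p v"
proof (rule differential_eqI)
  show "((\<lambda>q. f q * h q) \<circ> chart_inv (chart_at A p) has_derivative
    (\<lambda>v. differential A f p v * h p + f p * differential A h p v)) (at (snd (chart_at A p) p))"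
    using has_derivative_mult[OF differential_has_derivative[of f p] differential_has_derivative[of h p]] assms
    by (simp add: o_def chart_facts(5)[OF chart_at_mem] add.commute)
qed

lemma differential_cmult:
  "f \<in> smooth_functions A \<Longrightarrow> differential A (\<lambda>q. k * f q) p v = k * differential A f p v"
  by (simp add: differential_mult functions_const differential_const)

lemma differential_uminus:
  "f \<in> smooth_functions A \<Longrightarrow> differential A (\<lambda>q. - f q) p v = - differential A f p v"
  using differential_cmult[of f "-1"] by simp

lemma differential_diff:
  "f \<in> smooth_functions A \<Longrightarrow> h \<in> smooth_functions A \<Longrightarrow>
    differential A (\<lambda>q. f q - h q) p v = differential A f p v - differential A h p v"
  using differential_add[OF _ functions_uminus] by (simp add: differential_uminus)

lemma differential_sum:
  "(\<And>i. i \<in> I \<Longrightarrow> f i \<in> smooth_functions A) \<Longrightarrow>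
    differential A (\<lambda>q. \<Sum>i\<in>I. f i q) p v = (\<Sum>i\<in>I. differential A (f i) p v)"
  by (induction I rule: infinite_finite_induct)
     (auto simp: differential_const differential_add functions_sum)

lemma functions_differential:
  assumes "f \<in> smooth_functions A" "X \<in> vector_fields A"
  shows "(\<lambda>p. differential A f p (X p)) \<in> smooth_functions A"
  unfolding smooth_functions_def
proof safe
  fix a b assume c: "(a, b) \<in> A"
  let ?c = "(a, b)"
  show "smooth_on (snd ?c ` fst ?c) ((\<lambda>p. differential A f p (X p)) \<circ> chart_inv ?c)"
  proof (rule smooth_on_cong[OF chart_facts(2)[OF c] _
        smooth_on_frechet_derivative_field[OF chart_facts(2)[OF c] function_smooth[OF assms(1) c] field_smooth[OF assms(2) c]]])
    fix x assume x: "x \<in> snd ?c ` fst ?c"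
    show "frechet_derivative (f \<circ> chart_inv ?c) (at x) (local_rep A ?c X x) =
        ((\<lambda>p. differential A f p (X p)) \<circ> chart_inv ?c) x"
      using differential_chart[OF assms(1) c chart_facts(7)[OF c x], of "X (chart_inv ?c x)"]
      by (simp only: chart_facts(6)[OF c x] local_rep_def o_def)
  qed
qed

lemma local_rep_at: "local_rep A (chart_at A p) X (snd (chart_at A p) p) = X p"
  by (simp add: local_rep_def chart_facts(5)[OF chart_at_mem] components_self)

text \<open>Splits a second derivative of \<open>f\<close> into a part that differentiates the
  coefficients of \<open>Y\<close> and the coordinate Hessian of \<open>f\<close>. The Hessian is
  symmetric, so it cancels in a commutator and only the coordinate expression of the bracket
  remains.\<close>

lemma differential_along_field:
  fixes p
  assumes "f \<in> smooth_functions A" "Y \<in> vector_fields A"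
  defines "b \<equiv> chart_at A p" and "x \<equiv> snd (chart_at A p) p"
  shows "differential A (\<lambda>q. differential A f q (Y q)) p u =
    differential A f p (frechet_derivative (local_rep A b Y) (at x) u) +
    frechet_derivative (\<lambda>y. frechet_derivative (f \<circ> chart_inv b) (at y) u) (at x) (Y p)"
proof -
  let ?F = "f \<circ> chart_inv b" and ?S = "snd b ` fst b"
  have bA: "b \<in> A" and x: "x \<in> ?S" using chart_at_mem[of p] by (auto simp: b_def x_def)
  note S = chart_facts(2)[OF bA]
  have sF: "smooth_on ?S ?F" by (rule function_smooth[OF assms(1) bA])
  have sY: "smooth_on ?S (local_rep A b Y)" by (rule field_smooth[OF assms(2) bA])
  let ?H = "\<lambda>v w. frechet_derivative (\<lambda>y. frechet_derivative ?F (at y) v) (at x) w"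
  have sym: "?H v w = ?H w v" for v w
    by (rule second_derivative_symmetric[OF S x smooth_on_D[OF sF]])
  have lH: "linear (?H v)" for v
    by (intro linear_frechet_derivative smooth_on_differentiable[OF smooth_on_frechet_derivative[OF sF] x])
  have Yx: "local_rep A b Y x = Y p" by (simp add: b_def x_def local_rep_at)
  let ?Y' = "frechet_derivative (local_rep A b Y) (at x)"
  have "((\<lambda>y. \<Sum>e\<in>Basis. (local_rep A b Y y \<bullet> e) * frechet_derivative ?F (at y) e) has_derivative
      (\<lambda>v. \<Sum>e\<in>Basis. (local_rep A b Y x \<bullet> e) * ?H e v + (?Y' v \<bullet> e) * frechet_derivative ?F (at x) e)) (at x)"
    by (intro has_derivative_sum has_derivative_mult has_derivative_inner_left has_derivative_frechet
        smooth_on_differentiable[OF sY x] smooth_on_differentiable[OF smooth_on_frechet_derivative[OF sF] x])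
  moreover have "(\<Sum>e\<in>Basis. (local_rep A b Y y \<bullet> e) * frechet_derivative ?F (at y) e) =
      ((\<lambda>q. differential A f q (Y q)) \<circ> chart_inv b) y" if y: "y \<in> ?S" for y
  proof -
    have l: "linear (frechet_derivative ?F (at y))"
      by (rule linear_frechet_derivative[OF smooth_on_differentiable[OF sF y]])
    have "frechet_derivative ?F (at y) (local_rep A b Y y) =
        frechet_derivative ?F (at y) (\<Sum>e\<in>Basis. (local_rep A b Y y \<bullet> e) *\<^sub>R e)"
      by (simp add: euclidean_representation)
    also have "\<dots> = (\<Sum>e\<in>Basis. (local_rep A b Y y \<bullet> e) * frechet_derivative ?F (at y) e)"
      by (simp only: linear_sum[OF l] linear_scale[OF l] real_scaleR_def)
    finally show ?thesis
      using differential_chart[OF assms(1) bA chart_facts(7)[OF bA y], of "Y (chart_inv b y)"]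
      by (simp add: chart_facts(6)[OF bA y] local_rep_def o_def)
  qed
  ultimately have "((\<lambda>q. differential A f q (Y q)) \<circ> chart_inv b has_derivative
      (\<lambda>v. \<Sum>e\<in>Basis. (local_rep A b Y x \<bullet> e) * ?H e v + (?Y' v \<bullet> e) * frechet_derivative ?F (at x) e)) (at x)"
    by (rule has_derivative_transform_within_open[OF _ S x]) auto
  then have "differential A (\<lambda>q. differential A f q (Y q)) p u =
      (\<Sum>e\<in>Basis. (Y p \<bullet> e) * ?H e u + (?Y' u \<bullet> e) * frechet_derivative ?F (at x) e)"
    unfolding Yx unfolding b_def x_def by (rule differential_eqI)
  also have "\<dots> = (\<Sum>e\<in>Basis. (Y p \<bullet> e) * ?H u e) + (\<Sum>e\<in>Basis. (?Y' u \<bullet> e) * frechet_derivative ?F (at x) e)"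
    by (simp add: sum.distrib sym[of _ u])
  also have "(\<Sum>e\<in>Basis. (Y p \<bullet> e) * ?H u e) = ?H u (\<Sum>e\<in>Basis. (Y p \<bullet> e) *\<^sub>R e)"
    by (simp only: linear_sum[OF lH] linear_scale[OF lH] real_scaleR_def)
  also have "(\<Sum>e\<in>Basis. (?Y' u \<bullet> e) * frechet_derivative ?F (at x) e) =
      frechet_derivative ?F (at x) (\<Sum>e\<in>Basis. (?Y' u \<bullet> e) *\<^sub>R e)"
    using linear_frechet_derivative[OF smooth_on_differentiable[OF sF x]]
    by (simp only: linear_sum linear_scale real_scaleR_def)
  finally show ?thesis
    by (simp only: euclidean_representation differential_def Let_def b_def x_def add.commute)
qed

lemma lie_bracket_differential:
  assumes "f \<in> smooth_functions A" "X \<in> vector_fields A" "Y \<in> vector_fields A"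
  shows "differential A f p (lie_bracket A X Y p) =
    differential A (\<lambda>q. differential A f q (Y q)) p (X p) -
    differential A (\<lambda>q. differential A f q (X q)) p (Y p)"
proof -
  let ?b = "chart_at A p"
  have "frechet_derivative (\<lambda>y. frechet_derivative (f \<circ> chart_inv ?b) (at y) (X p)) (at (snd ?b p)) (Y p) =
    frechet_derivative (\<lambda>y. frechet_derivative (f \<circ> chart_inv ?b) (at y) (Y p)) (at (snd ?b p)) (X p)"
    using function_smooth[OF assms(1) chart_at_mem(1)] chart_at_mem
    by (intro second_derivative_symmetric[OF chart_facts(2)[OF chart_at_mem(1)] _ smooth_on_D]) auto
  then show ?thesis
    using assms by (simp add: differential_along_field lie_bracket_def Let_def linear_diff[OF differential_linear])
qed

section \<open>Cut-off functions and fields, global frames\<close>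

lemma cutoff_field:
  assumes c: "c \<in> A" and K: "compact K" "K \<subseteq> snd c ` fst c"
    and h: "smooth_on (snd c ` fst c) h" "\<And>x. x \<notin> K \<Longrightarrow> h x = 0"
  shows "(\<lambda>q. if q \<in> fst c then lift c q (h (snd c q)) else 0) \<in> vector_fields A" (is "?X \<in> _")
  unfolding vector_fields_def
proof (intro CollectI ballI)
  fix d assume d: "d \<in> A"
  \<comment> \<open>Since the space is Hausdorff, the compact image is closed. Its complement is
    then an open neighbourhood of every point outside the chart domain, and the field vanishes on
    it.\<close>
  have cK: "closed (chart_inv c ` K)"
    by (intro compact_imp_closed compact_continuous_image K continuous_on_subset[OF chart_facts(4)[OF c]])
  show "smooth_on (snd d ` fst d) (local_rep A d ?X)"
  proof (rule smooth_on_chart_local[OF d])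
    fix p assume p: "p \<in> fst d"
    show "\<exists>W. open W \<and> p \<in> W \<and> smooth_on (snd d ` (fst d \<inter> W)) (local_rep A d ?X)"
    proof (cases "p \<in> fst c")
      case True
      let ?W = "fst c" and ?U = "snd d ` (fst d \<inter> fst c)" and ?T = "snd c ` (fst c \<inter> fst d)"
      have o: "open ?U" "open ?T" using open_chart_image chart_facts(1) c d by auto
      have 1: "smooth_on ?T (\<lambda>x. frechet_derivative (snd d \<circ> chart_inv c) (at x) (h x))"
        by (intro smooth_on_frechet_derivative_field o transition_smooth c d smooth_on_subset[OF h(1)]) auto
      have 2: "smooth_on ?U (snd c \<circ> chart_inv d)" by (rule transition_smooth[OF d c])
      have "smooth_on ?U (\<lambda>x. frechet_derivative (snd d \<circ> chart_inv c) (at ((snd c \<circ> chart_inv d) x)) (h ((snd c \<circ> chart_inv d) x)))"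
        by (rule smooth_on_compose[OF o _ 2 1]) (use chart_facts(5)[OF d] in auto)
      then have "smooth_on ?U (local_rep A d ?X)"
        by (rule smooth_on_cong[OF o(1), rotated])
           (auto simp: local_rep_def chart_facts(5)[OF d] components_lift_transition c d)
      then show ?thesis using chart_facts(1)[OF c] True by blast
    next
      case False
      let ?W = "- (chart_inv c ` K)"
      have "open ?W" using cK by auto
      moreover have "p \<in> ?W" using False K(2) chart_facts(7)[OF c] by auto
      moreover have "smooth_on (snd d ` (fst d \<inter> ?W)) (local_rep A d ?X)"
      proof (rule smooth_on_cong[OF open_chart_image[OF d \<open>open ?W\<close>] _ smooth_on_const[of _ 0]])
        fix x assume "x \<in> snd d ` (fst d \<inter> ?W)"
        then obtain q where q: "q \<in> fst d" "q \<in> ?W" "x = snd d q" by auto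
        have "?X q = 0"
        proof (cases "q \<in> fst c")
          case True
          then have "snd c q \<notin> K" using q(2) chart_facts(5)[OF c True] by force
          then show ?thesis using h(2) True linear_0[OF lift_linear[OF c True]] by simp
        qed simp
        then show "0 = local_rep A d ?X x"
          using linear_0[OF components_linear[OF d q(1)]] q(3) chart_facts(5)[OF d q(1)]
          by (simp only: local_rep_def)
      qed
      ultimately show ?thesis by blast
    qed
  qed
qed

lemma cutoff_function:
  assumes c: "c \<in> A" and K: "compact K" "K \<subseteq> snd c ` fst c"
    and h: "smooth_on (snd c ` fst c) h" "\<And>x. x \<notin> K \<Longrightarrow> h x = 0"
  shows "(\<lambda>q. if q \<in> fst c then h (snd c q) else 0) \<in> smooth_functions A" (is "?f \<in> _")
  unfolding smooth_functions_def
proof (intro CollectI ballI)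
  fix d assume d: "d \<in> A"
  have cK: "closed (chart_inv c ` K)"
    by (intro compact_imp_closed compact_continuous_image K continuous_on_subset[OF chart_facts(4)[OF c]])
  show "smooth_on (snd d ` fst d) (?f \<circ> chart_inv d)"
  proof (rule smooth_on_chart_local[OF d])
    fix p assume p: "p \<in> fst d"
    show "\<exists>W. open W \<and> p \<in> W \<and> smooth_on (snd d ` (fst d \<inter> W)) (?f \<circ> chart_inv d)"
    proof (cases "p \<in> fst c")
      case True
      let ?W = "fst c" and ?U = "snd d ` (fst d \<inter> fst c)"
      have o: "open ?U" using open_chart_image chart_facts(1) c d by auto
      have 2: "smooth_on ?U (snd c \<circ> chart_inv d)" by (rule transition_smooth[OF d c])
      have "smooth_on ?U (\<lambda>x. h ((snd c \<circ> chart_inv d) x))"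
        by (rule smooth_on_compose[OF o chart_facts(2)[OF c] _ 2 h(1)]) (use chart_facts(5)[OF d] in auto)
      then have "smooth_on ?U (?f \<circ> chart_inv d)"
        by (rule smooth_on_cong[OF o(1), rotated]) (auto simp: chart_facts(5)[OF d])
      then show ?thesis using chart_facts(1)[OF c] True by blast
    next
      case False
      let ?W = "- (chart_inv c ` K)"
      have "open ?W" using cK by auto
      moreover have "p \<in> ?W" using False K(2) chart_facts(7)[OF c] by auto
      moreover have "smooth_on (snd d ` (fst d \<inter> ?W)) (?f \<circ> chart_inv d)"
      proof (rule smooth_on_cong[OF open_chart_image[OF d \<open>open ?W\<close>] _ smooth_on_const[of _ 0]])
        fix x assume "x \<in> snd d ` (fst d \<inter> ?W)"
        then obtain q where q: "q \<in> fst d" "q \<in> ?W" "x = snd d q" by auto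
        have "snd c q \<notin> K" if "q \<in> fst c"
          using q(2) chart_facts(5)[OF c that] by force
        then show "0 = (?f \<circ> chart_inv d) x"
          using q chart_facts(5)[OF d q(1)] h(2) by simp
      qed
      ultimately show ?thesis by blast
    qed
  qed
qed

lemma chart_bump:
  fixes p
  obtains \<beta> K where "smooth_on UNIV \<beta>" "\<beta> (snd (chart_at A p) p) = (1::real)"
    "(\<beta> has_derivative (\<lambda>v. 0)) (at (snd (chart_at A p) p))"
    "compact K" "K \<subseteq> snd (chart_at A p) ` fst (chart_at A p)" "\<And>x. x \<notin> K \<Longrightarrow> \<beta> x = 0"
proof -
  let ?c = "chart_at A p"
  obtain r where r: "r > 0" "cball (snd ?c p) r \<subseteq> snd ?c ` fst ?c"
    using chart_facts(2)[OF chart_at_mem(1)] chart_at_mem(2) open_contains_cball by (metis imageI)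
  obtain \<beta> :: "real ^ 'm \<Rightarrow> real" where "smooth_on UNIV \<beta>" "\<beta> (snd ?c p) = 1"
    "(\<beta> has_derivative (\<lambda>v. 0)) (at (snd ?c p))" "\<And>x. x \<notin> cball (snd ?c p) r \<Longrightarrow> \<beta> x = 0"
    using bump_function_exists[OF r(1), of "snd ?c p"] by metis
  then show thesis using r by (intro that[of \<beta> "cball (snd ?c p) r"]) auto
qed

text \<open>A coordinate times a bump function is global, and its differential at \<open>p\<close>
  is that of the coordinate because the bump has value 1 and derivative 0 there.\<close>

lemma coordinate_function_exists:
  obtains h where "h \<in> smooth_functions A" "\<And>v. differential A h p v = v $ i"
proof -
  let ?c = "chart_at A p"
  let ?x = "snd ?c p"
  obtain \<beta> K where \<beta>: "smooth_on UNIV \<beta>" "\<beta> ?x = (1::real)" "(\<beta> has_derivative (\<lambda>v. 0)) (at ?x)"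
    "compact K" "K \<subseteq> snd ?c ` fst ?c" "\<And>x. x \<notin> K \<Longrightarrow> \<beta> x = 0"
    using chart_bump[of p] by blast
  let ?h = "\<lambda>q. if q \<in> fst ?c then \<beta> (snd ?c q) * snd ?c q $ i else 0"
  note o = chart_facts(2)[OF chart_at_mem(1), of p]
  have "?h \<in> smooth_functions A"
    by (rule cutoff_function[OF chart_at_mem(1) \<beta>(4,5), of "\<lambda>x. \<beta> x * x $ i"])
       (use \<beta>(6) in \<open>auto intro!: smooth_on_mult o smooth_on_vec_nth smooth_on_id smooth_on_subset[OF \<beta>(1)]\<close>)
  moreover have "differential A ?h p v = v $ i" for v
  proof (rule differential_eqI)
    have "((\<lambda>x. \<beta> x * x $ i) has_derivative (\<lambda>v. v $ i)) (at ?x)"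
      using has_derivative_mult[OF \<beta>(3) bounded_linear_imp_has_derivative[OF bounded_linear_vec_nth[of i]]] \<beta>(2)
      by simp
    then show "(?h \<circ> chart_inv ?c has_derivative (\<lambda>v. v $ i)) (at ?x)"
      by (rule has_derivative_transform_within_open[OF _ o])
         (use chart_at_mem chart_facts(6,7)[OF chart_at_mem(1)] in auto)
  qed
  ultimately show thesis by (rule that)
qed

text \<open>Lets identities between tangent vectors be tested on functions; the Jacobi identity is
  obtained in this way.\<close>

lemma differentials_separate:
  "(\<And>h. h \<in> smooth_functions A \<Longrightarrow> differential A h p u = differential A h p v) \<Longrightarrow> u = v"
  by (metis coordinate_function_exists vec_eq_iff)

abbreviation C where "C \<equiv> smooth_functions A"
abbreviation V where "V \<equiv> vector_fields A"

text \<open>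
  A coordinate frame around \<open>p\<close> and its dual coframe, both multiplied by the same bump function (of
  square \<open>w\<close>) so that they are globally defined; this reduces pointwise and local statements to
  linearity over the smooth functions. As \<open>w\<close> has value 1 and differential 0 at \<open>p\<close>, the cut-off is
  invisible in first derivatives at \<open>p\<close>.
\<close>

definition frame_at :: "'a \<Rightarrow> ('m \<Rightarrow> 'a \<Rightarrow> real ^ 'm) \<Rightarrow> ('m \<Rightarrow> 'a \<Rightarrow> real ^ 'm \<Rightarrow> real) \<Rightarrow> ('a \<Rightarrow> real) \<Rightarrow> bool" where
  "frame_at p E \<theta> w \<longleftrightarrow>
    (\<forall>i. E i \<in> V) \<and> (\<forall>i q. linear (\<theta> i q)) \<and> (\<forall>i. \<forall>X\<in>V. (\<lambda>q. \<theta> i q (X q)) \<in> C) \<and>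
    w \<in> C \<and> w p = 1 \<and> (\<forall>v. differential A w p v = 0) \<and>
    (\<forall>i. E i p = axis i 1) \<and> (\<forall>i v. \<theta> i p v = v $ i) \<and>
    (\<forall>q v. (\<Sum>i\<in>UNIV. \<theta> i q v *\<^sub>R E i q) = w q *\<^sub>R v)"

lemma frame_at_exists: obtains E \<theta> w where "frame_at p E \<theta> w"
proof -
  let ?c = "chart_at A p"
  let ?x = "snd ?c p"
  note c = chart_at_mem(1)[of p]
  obtain \<beta> K where \<beta>: "smooth_on UNIV \<beta>" "\<beta> ?x = (1::real)" "(\<beta> has_derivative (\<lambda>v. 0)) (at ?x)"
    "compact K" "K \<subseteq> snd ?c ` fst ?c" "\<And>x. x \<notin> K \<Longrightarrow> \<beta> x = 0"
    using chart_bump[of p] by blast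
  note o = chart_facts(2)[OF c]
  define E where "E i = (\<lambda>q. if q \<in> fst ?c then lift ?c q (\<beta> (snd ?c q) *\<^sub>R axis i 1) else 0)" for i :: 'm
  define \<theta> where "\<theta> i q v = (if q \<in> fst ?c then \<beta> (snd ?c q) * components A ?c q v $ i else 0)" for i q v
  define w where "w q = (if q \<in> fst ?c then \<beta> (snd ?c q) * \<beta> (snd ?c q) else 0)" for q
  have \<beta>c: "smooth_on (snd ?c ` fst ?c) \<beta>" by (rule smooth_on_subset[OF \<beta>(1)]) auto
  have wC: "w \<in> smooth_functions A"
    unfolding w_def[abs_def]
    by (rule cutoff_function[OF c \<beta>(4,5), of "\<lambda>x. \<beta> x * \<beta> x"]) (use \<beta>(6) in \<open>auto intro!: smooth_on_mult o \<beta>c\<close>)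
  show thesis
  proof (rule that[of E \<theta> w], unfold frame_at_def, intro conjI allI ballI)
    show "E i \<in> vector_fields A" for i
      unfolding E_def
      by (rule cutoff_field[OF c \<beta>(4,5), of "\<lambda>x. \<beta> x *\<^sub>R axis i 1"])
         (use \<beta>(6) in \<open>auto intro!: smooth_on_scaleR o \<beta>c smooth_on_const\<close>)
    show "linear (\<theta> i q)" for i q
      by (rule linearI) (auto simp: \<theta>_def linear_add[OF components_linear] linear_scale[OF components_linear] c algebra_simps)
    show "(\<lambda>q. \<theta> i q (X q)) \<in> smooth_functions A" if X: "X \<in> vector_fields A" for i X
    proof -
      have "(\<lambda>q. if q \<in> fst ?c then \<beta> (snd ?c q) * local_rep A ?c X (snd ?c q) $ i else 0) \<in> smooth_functions A"
        by (rule cutoff_function[OF c \<beta>(4,5), of "\<lambda>x. \<beta> x * local_rep A ?c X x $ i"])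
           (use \<beta>(6) in \<open>auto intro!: smooth_on_mult o \<beta>c smooth_on_vec_nth field_smooth X c\<close>)
      moreover have "(\<lambda>q. if q \<in> fst ?c then \<beta> (snd ?c q) * local_rep A ?c X (snd ?c q) $ i else 0) =
          (\<lambda>q. \<theta> i q (X q))"
        by (auto simp: \<theta>_def local_rep_def chart_facts(5)[OF c])
      ultimately show ?thesis by simp
    qed
    show "w \<in> smooth_functions A" by fact
    show "w p = 1" using \<beta>(2) chart_at_mem(2) by (simp add: w_def)
    show "differential A w p v = 0" for v
    proof (rule differential_eqI)
      have "((\<lambda>x. \<beta> x * \<beta> x) has_derivative (\<lambda>v. 0)) (at ?x)"
        using has_derivative_mult[OF \<beta>(3) \<beta>(3)] by simp
      then show "(w \<circ> chart_inv ?c has_derivative (\<lambda>v. 0)) (at ?x)"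
        by (rule has_derivative_transform_within_open[OF _ o])
           (use chart_at_mem chart_facts(6,7)[OF c] in \<open>auto simp: w_def\<close>)
    qed
    show "E i p = axis i 1" for i
      using lift_components[OF c chart_at_mem(2), of "axis i 1"] chart_at_mem(2) \<beta>(2)
      by (simp add: E_def components_self)
    show "\<theta> i p v = v $ i" for i v
      using chart_at_mem(2) \<beta>(2) by (simp add: \<theta>_def components_self)
    show "(\<Sum>i\<in>UNIV. \<theta> i q v *\<^sub>R E i q) = w q *\<^sub>R v" for q v
    proof (cases "q \<in> fst ?c")
      case True
      note l = lift_linear[OF c True]
      have "(\<Sum>i\<in>UNIV. \<theta> i q v *\<^sub>R E i q) =
          w q *\<^sub>R lift ?c q (\<Sum>i\<in>UNIV. components A ?c q v $ i *\<^sub>R axis i 1)"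
        using True by (simp add: \<theta>_def E_def w_def linear_sum[OF l] linear_scale[OF l] scaleR_sum_right mult_ac)
      also have "(\<Sum>i\<in>UNIV. components A ?c q v $ i *\<^sub>R axis i 1) = components A ?c q v"
        by (simp add: vec_eq_iff axis_def if_distrib cong: if_cong)
      finally show ?thesis using lift_components[OF c True] by simp
    qed (simp add: \<theta>_def w_def)
  qed
qed

end

section \<open>Curvature algebra of a Kenmotsu tangent space\<close>

lemma trace_matrix: "trace (matrix T) = (\<Sum>i\<in>UNIV. T (axis i 1) $ i)"
  by (simp add: trace_def matrix_def)

lemma vec_axis_expansion: "(\<Sum>i\<in>UNIV. v $ i *\<^sub>R axis i 1) = (v :: real ^ 'm)"
  by (simp add: vec_eq_iff axis_def if_distrib cong: if_cong)

lemma linear_axis_expansion: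
  fixes l :: "real ^ 'm \<Rightarrow> 'b::real_vector"
  assumes "linear l" shows "l v = (\<Sum>i\<in>UNIV. v $ i *\<^sub>R l (axis i 1))"
  by (subst vec_axis_expansion[of v, symmetric]) (simp only: linear_sum[OF assms] linear_scale[OF assms])

lemma trace_matrix_rank_one:
  fixes l :: "real ^ 'm \<Rightarrow> real"
  assumes "linear l" shows "trace (matrix (\<lambda>v. l v *\<^sub>R w)) = l w"
  using linear_axis_expansion[OF assms, of w] by (simp add: trace_matrix mult.commute)

lemma trace_matrix_add:
  fixes S T :: "real ^ 'm \<Rightarrow> real ^ 'm"
  shows "trace (matrix (\<lambda>v. S v + T v)) = trace (matrix S) + trace (matrix T)"
  by (simp add: trace_matrix sum.distrib)

lemma trace_matrix_diff:
  fixes S T :: "real ^ 'm \<Rightarrow> real ^ 'm"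
  shows "trace (matrix (\<lambda>v. S v - T v)) = trace (matrix S) - trace (matrix T)"
  by (simp add: trace_matrix sum_subtractf)

lemma trace_matrix_scaleR:
  fixes T :: "real ^ 'm \<Rightarrow> real ^ 'm"
  shows "trace (matrix (\<lambda>v. k *\<^sub>R T v)) = k * trace (matrix T)"
  by (simp add: trace_matrix sum_distrib_left)

lemma trace_matrix_sum:
  fixes T :: "'i \<Rightarrow> real ^ 'm \<Rightarrow> real ^ 'm"
  shows "trace (matrix (\<lambda>v. \<Sum>i\<in>I. T i v)) = (\<Sum>i\<in>I. trace (matrix (T i)))"
  unfolding trace_matrix sum_component by (rule sum.swap)

lemma trace_matrix_ident: "trace (matrix (\<lambda>v :: real ^ 'm. v)) = real CARD('m)"
  by (simp add: trace_matrix)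

lemma trace_matrix_zero: "trace (matrix (\<lambda>v. 0 :: real ^ 'm)) = 0"
  by (simp add: trace_matrix)

lemma trace_matrix_commute:
  fixes S T :: "real ^ 'm \<Rightarrow> real ^ 'm"
  assumes "linear S" "linear T"
  shows "trace (matrix (\<lambda>v. S (T v))) = trace (matrix (\<lambda>v. T (S v)))"
  using matrix_compose[OF assms(2,1)] matrix_compose[OF assms] trace_mul_sym[of "matrix S" "matrix T"]
  by (simp add: o_def)

text \<open>\<open>\<Gamma>\<close> identifies the space with its dual by means of \<open>G\<close>.
  Under it \<open>S\<close> becomes the transpose of \<open>T\<close>, and a trace is unchanged by
  conjugation and by transposition.\<close>

lemma trace_matrix_adjoint:
  fixes S T :: "real ^ 'm \<Rightarrow> real ^ 'm" and G :: "real ^ 'm \<Rightarrow> real ^ 'm \<Rightarrow> real"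
  assumes G: "bilinear G" "\<And>v. v \<noteq> 0 \<Longrightarrow> G v v > 0"
    and lin: "linear S" "linear T" and adj: "\<And>u v. G (S u) v = G u (T v)"
  shows "trace (matrix S) = trace (matrix T)"
proof -
  define \<Gamma> where "\<Gamma> u = (\<chi> i. G u (axis i 1))" for u
  \<comment> \<open>The matrix of \<open>T'\<close> is the transpose of the matrix of
    \<open>T\<close> in the standard basis.\<close>
  define T' where "T' w = (\<chi> i. \<Sum>j\<in>UNIV. T (axis i 1) $ j * w $ j)" for w :: "real ^ 'm"
  have l1: "linear (\<lambda>u. G u v)" "linear (G u)" for u v using G(1) by (auto simp: bilinear_def)
  have l\<Gamma>: "linear \<Gamma>"
    by (rule linearI) (simp_all add: \<Gamma>_def vec_eq_iff linear_add[OF l1(1)] linear_scale[OF l1(1)])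
  have lT': "linear T'"
    by (rule linearI) (simp_all add: T'_def vec_eq_iff algebra_simps sum.distrib sum_distrib_left)
  have \<Gamma>G: "G u v = (\<Sum>i\<in>UNIV. v $ i * \<Gamma> u $ i)" for u v
    using linear_axis_expansion[OF l1(2), of u v] by (simp add: \<Gamma>_def)
  have "inj \<Gamma>"
  proof (rule linear_injective_0[OF l\<Gamma>, THEN iffD2], intro allI impI)
    fix u assume "\<Gamma> u = 0"
    then have "G u u = 0" by (simp add: \<Gamma>G)
    then show "u = 0" using G(2)[of u] by force
  qed
  then obtain \<Delta> where \<Delta>: "linear \<Delta>" "\<Delta> \<circ> \<Gamma> = id" "\<Gamma> \<circ> \<Delta> = id"
    using linear_injective_isomorphism[OF l\<Gamma>] linear_injective_left_inverse[OF l\<Gamma>]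
      linear_inverse_left[OF l\<Gamma>] by blast
  have "\<Gamma> (S u) = T' (\<Gamma> u)" for u
  proof (rule vec_eq_iff[THEN iffD2], rule allI)
    fix i
    have "\<Gamma> (S u) $ i = G u (T (axis i 1))" by (simp add: \<Gamma>_def adj)
    also have "\<dots> = T' (\<Gamma> u) $ i" by (simp add: T'_def \<Gamma>G)
    finally show "\<Gamma> (S u) $ i = T' (\<Gamma> u) $ i" .
  qed
  then have S: "S u = \<Delta> (T' (\<Gamma> u))" for u
    by (metis \<Delta>(2) comp_def id_def)
  have "trace (matrix S) = trace (matrix (\<lambda>u. \<Delta> (T' (\<Gamma> u))))" by (simp add: S[abs_def])
  also have "\<dots> = trace (matrix (\<lambda>u. T' (\<Gamma> (\<Delta> u))))"
    using trace_matrix_commute[OF \<Delta>(1) linear_compose[OF l\<Gamma> lT']] by (simp add: o_def)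
  also have "\<dots> = trace (matrix T')" using \<Delta>(3) by (simp add: fun_eq_iff)
  also have "\<dots> = trace (matrix T)"
    by (simp add: trace_matrix T'_def axis_def if_distrib cong: if_cong)
  finally show ?thesis .
qed

section \<open>Linear algebra of an almost contact metric tangent space\<close>

locale almost_contact_space =
  fixes G :: "real ^ 'm \<Rightarrow> real ^ 'm \<Rightarrow> real" and \<phi> :: "real ^ 'm \<Rightarrow> real ^ 'm"
    and \<xi> :: "real ^ 'm" and \<eta> :: "real ^ 'm \<Rightarrow> real"
  assumes bilinear: "bilinear G" and sym: "G u v = G v u" and pos: "v \<noteq> 0 \<Longrightarrow> G v v > 0"
    and linear_phi: "linear \<phi>" and linear_eta: "linear \<eta>"
    and phi_phi: "\<phi> (\<phi> v) = - v + \<eta> v *\<^sub>R \<xi>" and eta_xi: "\<eta> \<xi> = 1"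
    and G_phi_phi: "G (\<phi> u) (\<phi> v) = G u v - \<eta> u * \<eta> v"
begin

lemmas G_linear = bilinear_ladd[OF bilinear] bilinear_radd[OF bilinear]
  bilinear_lsub[OF bilinear] bilinear_rsub[OF bilinear] bilinear_lmul[OF bilinear] bilinear_rmul[OF bilinear]
  bilinear_lneg[OF bilinear] bilinear_rneg[OF bilinear] bilinear_lzero[OF bilinear] bilinear_rzero[OF bilinear]

lemmas phi_linear = linear_add[OF linear_phi] linear_diff[OF linear_phi] linear_neg[OF linear_phi]
  linear_scale[OF linear_phi] linear_0[OF linear_phi]

lemmas eta_linear = linear_add[OF linear_eta] linear_diff[OF linear_eta] linear_neg[OF linear_eta]
  linear_scale[OF linear_eta] linear_0[OF linear_eta]

lemma xi_nonzero: "\<xi> \<noteq> 0"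
  using eta_xi by (auto simp: eta_linear)

text \<open>Applying the law for the square of \<open>\<phi>\<close> to \<open>\<phi> \<xi>\<close>
  shows that \<open>\<phi> \<xi>\<close> is a multiple of \<open>\<xi>\<close>. A further
  application of \<open>\<phi>\<close> squares the factor and gives 0, so the factor
  vanishes.\<close>

lemma phi_xi: "\<phi> \<xi> = 0"
proof -
  have z: "\<phi> (\<phi> \<xi>) = 0" by (simp add: phi_phi eta_xi)
  have "0 = - \<phi> \<xi> + \<eta> (\<phi> \<xi>) *\<^sub>R \<xi>"
    using phi_phi[of "\<phi> \<xi>"] by (simp only: z phi_linear)
  then have 1: "\<phi> \<xi> = \<eta> (\<phi> \<xi>) *\<^sub>R \<xi>" by (metis add_uminus_conv_diff add.commute eq_iff_diff_eq_0)
  have "\<phi> (\<phi> \<xi>) = \<eta> (\<phi> \<xi>) *\<^sub>R \<phi> \<xi>" by (metis 1 linear_scale linear_phi)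
  also have "\<dots> = (\<eta> (\<phi> \<xi>) * \<eta> (\<phi> \<xi>)) *\<^sub>R \<xi>" by (metis 1 scaleR_scaleR)
  finally have "\<eta> (\<phi> \<xi>) = 0" using z xi_nonzero by simp
  then show ?thesis using 1 by simp
qed

lemma G_xi: "G u \<xi> = \<eta> u" "G \<xi> u = \<eta> u"
  using G_phi_phi[of u \<xi>] sym[of u \<xi>] by (simp_all add: phi_xi eta_xi G_linear)

lemma eta_phi: "\<eta> (\<phi> v) = 0"
proof -
  have "\<phi> (\<phi> (\<phi> v)) = - \<phi> v" by (simp add: phi_phi[of v] phi_linear phi_xi)
  then show ?thesis using phi_phi[of "\<phi> v"] xi_nonzero by simp
qed

lemma G_phi_left: "G (\<phi> u) v = - G u (\<phi> v)"
  using G_phi_phi[of u "\<phi> v"] by (simp add: phi_phi G_linear eta_phi G_xi)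

end

section \<open>Algebraic curvature tensors of Kenmotsu type\<close>

locale kenmotsu_curvature_space = almost_contact_space G \<phi> \<xi> \<eta>
  for G :: "real ^ 'm \<Rightarrow> real ^ 'm \<Rightarrow> real" and \<phi> \<xi> \<eta> +
  fixes R :: "real ^ 'm \<Rightarrow> real ^ 'm \<Rightarrow> real ^ 'm \<Rightarrow> real ^ 'm"
  assumes linear_R: "linear (\<lambda>u. R u v w)" "linear (\<lambda>v. R u v w)" "linear (\<lambda>w. R u v w)"
    and R_skew: "R u v w = - R v u w"
    and R_bianchi: "R u v w + R v w u + R w u v = 0"
    and G_R_skew: "G (R u v w) z = - G w (R u v z)"
    and R_xi: "R u v \<xi> = \<eta> u *\<^sub>R v - \<eta> v *\<^sub>R u"
    and R_phi: "R u v (\<phi> w) = \<phi> (R u v w) + G v w *\<^sub>R \<phi> u - G u w *\<^sub>R \<phi> v + G u (\<phi> w) *\<^sub>R v - G v (\<phi> w) *\<^sub>R u"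
begin

text \<open>The metric of a Kenmotsu manifold is locally a warped product of a line with a Kaehler
  manifold; \<open>K\<close> is the part of the curvature coming from the Kaehler factor.\<close>

definition K where "K u v w = R u v w + G v w *\<^sub>R u - G u w *\<^sub>R v"

definition Ric where "Ric v w = trace (matrix (\<lambda>u. R u v w))"

definition KRic where "KRic v w = trace (matrix (\<lambda>u. K u v w))"

lemma linear_K: "linear (\<lambda>u. K u v w)" "linear (\<lambda>v. K u v w)" "linear (\<lambda>w. K u v w)"
  by (rule linearI; simp add: K_def linear_add[OF linear_R(1)] linear_add[OF linear_R(2)] linear_add[OF linear_R(3)]
      linear_scale[OF linear_R(1)] linear_scale[OF linear_R(2)] linear_scale[OF linear_R(3)] G_linear algebra_simps)+

lemma K_skew: "K u v w = - K v u w"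
  using R_skew[of u v w] by (simp add: K_def)

lemma K_bianchi: "K u v w + K v w u + K w u v = 0"
  using R_bianchi[of u v w] sym[of u v] sym[of v w] sym[of u w] by (simp add: K_def algebra_simps)

lemma G_K_skew: "G (K u v w) z = - G w (K u v z)"
  using G_R_skew[of u v w z] sym[of w u] sym[of w v] by (simp add: K_def G_linear algebra_simps)

lemma K_xi: "K u v \<xi> = 0"
  by (simp add: K_def R_xi G_xi)

lemma eta_K: "\<eta> (K u v w) = 0"
  using G_K_skew[of u v w \<xi>] by (simp add: G_xi K_xi G_linear)

lemma K_phi: "K u v (\<phi> w) = \<phi> (K u v w)"
  by (simp add: K_def R_phi phi_linear)

text \<open>The octahedron argument: the four first Bianchi identities obtained by rotating the
  arguments, combined with skewness in each pair, force the interchange of the two pairs.\<close>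

lemma K_pair: "G (K u v w) z = G (K w z u) v"
proof -
  have a: "G (K a b c) d = - G (K b a c) d" for a b c d
    by (subst K_skew) (simp add: G_linear)
  have b: "G (K a b c) d = - G (K a b d) c" for a b c d
    using G_K_skew[of a b c d] sym by simp
  have c: "G (K a b c) d + G (K b c a) d + G (K c a b) d = 0" for a b c d
    using arg_cong[OF K_bianchi[of a b c], of "\<lambda>x. G x d"] by (simp add: G_linear)
  show ?thesis
    using c[of u v w z] c[of v w z u] c[of w z u v] c[of z u v w]
      a[of u v w z] a[of w z u v] b[of u v w z] b[of w z u v]
      a[of v w z u] a[of w u v z] a[of v z u w] a[of z u v w] a[of u w z v] a[of z v w u]
      b[of v w u z] b[of w u v z] b[of v z u w] b[of z u v w] b[of z v w u] b[of w z v u] b[of u z w v] b[of u v z w]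
      a[of u v z w] a[of w z v u] a[of v w u z] a[of w u z v] a[of z u w v]
    by linarith
qed

text \<open>Pair symmetry moves \<open>\<phi>\<close> from the first pair to the second, where it
  commutes with \<open>K\<close>. It then drops out because \<open>\<phi>\<close> preserves
  \<open>G\<close> up to an \<eta>-term that \<open>eta_K\<close> kills.\<close>

lemma K_phi_phi: "K (\<phi> u) (\<phi> v) w = K u v w"
proof -
  have "G (K (\<phi> u) (\<phi> v) w) z = G (K u v w) z" for z
  proof -
    have "G (K (\<phi> u) (\<phi> v) w) z = G (\<phi> (K w z u)) (\<phi> v)" by (simp add: K_pair[of "\<phi> u"] K_phi)
    also have "\<dots> = G (K u v w) z" by (simp add: G_phi_phi eta_K K_pair[of u])
    finally show ?thesis .
  qed
  then have "G (K (\<phi> u) (\<phi> v) w - K u v w) (K (\<phi> u) (\<phi> v) w - K u v w) = 0"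
    by (simp add: G_linear)
  then show ?thesis using pos[of "K (\<phi> u) (\<phi> v) w - K u v w"] by (cases "K (\<phi> u) (\<phi> v) w = K u v w") auto
qed

text \<open>By pair symmetry, the maps whose traces define the two sides are adjoint to each other
  with respect to \<open>G\<close>.\<close>

lemma KRic_sym: "KRic v w = KRic w v"
  unfolding KRic_def
proof (rule trace_matrix_adjoint[OF bilinear pos linear_K(1) linear_K(1)])
  show "G (K u v w) z = G u (K z w v)" for u z
  proof -
    have "G (K u v w) z = G (K w z u) v" by (rule K_pair)
    also have "\<dots> = - G u (K w z v)" by (rule G_K_skew)
    also have "\<dots> = G u (K z w v)" by (subst K_skew) (simp add: G_linear)
    finally show ?thesis .
  qed
qed

lemma linear_G: "linear (G u)" "linear (\<lambda>u. G u v)"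
  using bilinear by (auto simp: bilinear_def)

lemma Ric_KRic: "KRic v w = Ric v w + (real CARD('m) - 1) * G v w"
  by (simp add: KRic_def Ric_def K_def trace_matrix_add trace_matrix_diff trace_matrix_scaleR
      trace_matrix_ident trace_matrix_rank_one[OF linear_G(2)] algebra_simps)

lemma Ric_sym: "Ric v w = Ric w v"
  using KRic_sym[of v w] sym[of v w] by (simp add: Ric_KRic)

lemma Ric_xi: "Ric v \<xi> = (1 - real CARD('m)) * \<eta> v"
proof -
  have "KRic v \<xi> = 0" by (simp add: KRic_def K_xi trace_matrix_zero)
  then show ?thesis by (simp add: Ric_KRic G_xi algebra_simps)
qed

text \<open>\<open>\<phi>\<close> comes out of the last slot by \<open>K_phi\<close>, is moved into
  the traced slot by cyclicity of the trace, and disappears by \<open>K_phi_phi\<close>.\<close>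

lemma KRic_phi_phi: "KRic (\<phi> v) (\<phi> w) = KRic v w"
proof -
  have "KRic (\<phi> v) (\<phi> w) = trace (matrix (\<lambda>u. \<phi> (K u (\<phi> v) w)))"
    by (simp add: KRic_def K_phi)
  also have "\<dots> = trace (matrix (\<lambda>u. K (\<phi> u) (\<phi> v) w))"
    by (rule trace_matrix_commute[OF linear_phi linear_K(1)])
  finally show ?thesis by (simp add: K_phi_phi KRic_def)
qed

text \<open>This is where the star-Ricci trace becomes a Ricci trace. The Bianchi identity brings
  the traced vector \<open>z\<close> into the first slot of both terms; each contributes one
  \<open>KRic\<close>, and the resulting 2 cancels the factor 1/2 of the star-Ricci tensor.\<close>

lemma trace_phi_K: "trace (matrix (\<lambda>z. \<phi> (K u (\<phi> v) z))) = 2 * KRic u v"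
proof -
  have "\<phi> (K u (\<phi> v) z) = K z (\<phi> v) (\<phi> u) + K z u v" for z
  proof -
    have "K u (\<phi> v) z = K z (\<phi> v) u - K z u (\<phi> v)"
      
    proof -
      have "K u (\<phi> v) z = - (K (\<phi> v) z u + K z u (\<phi> v))"
        using K_bianchi[of u "\<phi> v" z] by (simp only: eq_neg_iff_add_eq_0 add.assoc)
      then show ?thesis by (simp add: K_skew[of "\<phi> v" z u])
    qed
    then show ?thesis by (simp add: phi_linear K_phi phi_phi eta_K)
  qed
  then show ?thesis
    using KRic_phi_phi[of v u] KRic_sym[of v u] by (simp add: trace_matrix_add KRic_def)
qed

text \<open>Replacing \<open>R\<close> by \<open>K\<close> costs two rank-one corrections, which
  after halving give \<open>- G u v + \<eta> u * \<eta> v\<close>. Together with the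
  \<open>CARD('m) - 1\<close> of \<open>Ric_KRic\<close> this produces
  \<open>CARD('m) - 2\<close>.\<close>

lemma star_Ric:
  "1 / 2 * trace (matrix (\<lambda>z. \<phi> (R u (\<phi> v) z))) =
    Ric u v + (real CARD('m) - 2) * G u v + \<eta> u * \<eta> v"
proof -
  have "\<phi> (R u (\<phi> v) z) = \<phi> (K u (\<phi> v) z) - G (\<phi> v) z *\<^sub>R \<phi> u + G u z *\<^sub>R \<phi> (\<phi> v)" for z
    by (simp add: K_def phi_linear)
  then have "trace (matrix (\<lambda>z. \<phi> (R u (\<phi> v) z))) = 2 * KRic u v - G (\<phi> v) (\<phi> u) + G u (\<phi> (\<phi> v))"
    by (simp add: trace_matrix_add trace_matrix_diff trace_phi_K trace_matrix_rank_one[OF linear_G(1)])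
  also have "\<dots> = 2 * KRic u v - 2 * (G u v - \<eta> u * \<eta> v)"
    using G_phi_left[of u "\<phi> v"] G_phi_phi[of v u] G_phi_phi[of u v] sym[of u v]
    by (simp add: mult.commute[of "\<eta> v"])
  finally show ?thesis by (simp add: Ric_KRic algebra_simps)
qed

end

section \<open>Riemannian manifolds\<close>

text \<open>The Leibniz formula is polynomial in the entries; this serves Cramer's rule in
  \<open>gradient_V\<close>.\<close>

lemma smooth_on_det:
  fixes M :: "'e::euclidean_space \<Rightarrow> real ^ 'n ^ 'n"
  assumes "open S" "\<And>i j. smooth_on S (\<lambda>x. M x $ i $ j)"
  shows "smooth_on S (\<lambda>x. det (M x))"
  unfolding det_def
  by (intro smooth_on_sum smooth_on_mult smooth_on_prod smooth_on_const assms finite_permutations finite)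

context smooth_manifold
begin

section \<open>Tensorial operators and their traces\<close>

lemma extension_field: "extension A p v \<in> V" "extension A p v p = v"
proof -
  obtain E \<theta> w where f: "frame_at p E \<theta> w" by (rule frame_at_exists)
  \<comment> \<open>A combination of frame fields with constant coefficients is a witness for the
    choice made by \<open>extension\<close>.\<close>
  have "(\<lambda>q. \<Sum>i\<in>UNIV. v $ i *\<^sub>R E i q) \<in> V"
    using f by (auto simp: frame_at_def intro!: fields_sum fields_scaleR_const)
  moreover have "(\<Sum>i\<in>UNIV. v $ i *\<^sub>R E i p) = v"
    using f by (simp add: frame_at_def vec_axis_expansion)
  ultimately have "\<exists>Z. Z \<in> V \<and> Z p = v" by blast
  from someI_ex[OF this] show "extension A p v \<in> V" "extension A p v p = v"
    by (auto simp: extension_def)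
qed

text \<open>Linearity over the smooth functions, required only for values at \<open>p\<close>. The
  target type is left general because real-valued operators occur too, namely the covariant
  derivatives of coframe elements.\<close>

definition tensorial :: "'a \<Rightarrow> (('a \<Rightarrow> real ^ 'm) \<Rightarrow> 'a \<Rightarrow> 'b::real_vector) \<Rightarrow> bool" where
  "tensorial p T \<longleftrightarrow>
    (\<forall>Y\<in>V. \<forall>Z\<in>V. T (\<lambda>q. Y q + Z q) p = T Y p + T Z p) \<and>
    (\<forall>h\<in>C. \<forall>Z\<in>V. T (\<lambda>q. h q *\<^sub>R Z q) p = h p *\<^sub>R T Z p)"

lemma tensorial_sum:
  assumes "tensorial p T" "finite I" "\<And>i. h i \<in> C" "\<And>i. E i \<in> V"
  shows "T (\<lambda>q. \<Sum>i\<in>I. h i q *\<^sub>R E i q) p = (\<Sum>i\<in>I. h i p *\<^sub>R T (E i) p)"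
  using assms(2)
proof (induction I rule: finite_induct)
  case empty
  have "\<forall>h\<in>C. \<forall>Z\<in>V. T (\<lambda>q. h q *\<^sub>R Z q) p = h p *\<^sub>R T Z p"
    using assms(1) by (simp add: tensorial_def)
  from bspec[OF bspec[OF this functions_const[of 0]] fields_zero] show ?case by simp
next
  case (insert i I)
  have "T (\<lambda>q. h i q *\<^sub>R E i q + (\<Sum>i\<in>I. h i q *\<^sub>R E i q)) p =
      T (\<lambda>q. h i q *\<^sub>R E i q) p + T (\<lambda>q. \<Sum>i\<in>I. h i q *\<^sub>R E i q) p"
    using assms(1) by (simp add: tensorial_def fields_sum fields_scaleR assms(3,4))
  then show ?case using insert assms by (simp add: tensorial_def)
qed

text \<open>Multiplication by \<open>w\<close>, which is 1 at \<open>p\<close>, turns the local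
  expansion of \<open>Z\<close> in the frame into a global identity between fields, to which
  \<open>T\<close> can be applied.\<close>

lemma tensorial_expand:
  assumes T: "tensorial p T" and f: "frame_at p E \<theta> w" and Z: "Z \<in> V"
  shows "T Z p = (\<Sum>i\<in>UNIV. Z p $ i *\<^sub>R T (E i) p)"
proof -
  have "T Z p = w p *\<^sub>R T Z p" using f by (simp add: frame_at_def)
  also have "\<dots> = T (\<lambda>q. w q *\<^sub>R Z q) p" using T f Z by (simp add: tensorial_def frame_at_def)
  also have "\<dots> = T (\<lambda>q. \<Sum>i\<in>UNIV. \<theta> i q (Z q) *\<^sub>R E i q) p" using f by (simp add: frame_at_def)
  also have "\<dots> = (\<Sum>i\<in>UNIV. \<theta> i p (Z p) *\<^sub>R T (E i) p)"
    using f Z by (intro tensorial_sum[OF T]) (auto simp: frame_at_def)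
  finally show ?thesis using f by (simp add: frame_at_def)
qed

lemma tensorial_cong:
  assumes "tensorial p T" "Y \<in> V" "Z \<in> V" "Y p = Z p" shows "T Y p = T Z p"
proof -
  obtain E \<theta> w where f: "frame_at p E \<theta> w" by (rule frame_at_exists)
  show ?thesis using tensorial_expand[OF assms(1) f] assms by simp
qed

lemma tensorial_extension:
  assumes "tensorial p T" "Z \<in> V" shows "T (extension A p (Z p)) p = T Z p"
  by (rule tensorial_cong[OF assms(1) extension_field(1) assms(2) extension_field(2)])

lemma tensorial_linear:
  assumes T: "tensorial p T" shows "linear (\<lambda>v. T (extension A p v) p)"
proof (rule linearI)
  fix u v k
  have "T (extension A p (u + v)) p = T (\<lambda>q. extension A p u q + extension A p v q) p"
    by (rule tensorial_cong[OF T]) (auto intro: fields_add extension_field simp: extension_field(2))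
  then show "T (extension A p (u + v)) p = T (extension A p u) p + T (extension A p v) p"
    using T extension_field(1) by (simp add: tensorial_def)
  have "T (extension A p (k *\<^sub>R v)) p = T (\<lambda>q. k *\<^sub>R extension A p v q) p"
    by (rule tensorial_cong[OF T]) (auto intro: fields_scaleR_const extension_field simp: extension_field(2))
  then show "T (extension A p (k *\<^sub>R v)) p = k *\<^sub>R T (extension A p v) p"
    using T extension_field(1) functions_const[of k] by (simp add: tensorial_def)
qed

lemma trace_at_frame:
  assumes T: "tensorial p T" and f: "frame_at p E \<theta> w"
  shows "trace_at A p T = (\<Sum>i\<in>UNIV. T (E i) p $ i)"
proof -
  have "T (extension A p (axis i 1)) p = T (E i) p" for i
    using f tensorial_extension[OF T, of "E i"] by (simp add: frame_at_def)
  then show ?thesis by (simp add: trace_at_def trace_matrix)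
qed

text \<open>Unlike \<open>trace_at_frame\<close>, this holds at every \<open>q\<close> for a frame
  centred at \<open>p\<close>, so both sides can be differentiated at \<open>p\<close>.\<close>

lemma trace_at_weighted_frame:
  assumes T: "tensorial q T" and f: "frame_at p E \<theta> w"
  shows "w q * trace_at A q T = (\<Sum>i\<in>UNIV. \<theta> i q (T (E i) q))"
proof -
  let ?t = "\<lambda>v. T (extension A q v) q"
  note l = tensorial_linear[OF T]
  have \<theta>: "linear (\<theta> i q)" for i using f by (simp add: frame_at_def)
  have "w q *\<^sub>R ?t v = (\<Sum>i\<in>UNIV. \<theta> i q v *\<^sub>R ?t (E i q))" for v
  proof -
    have "?t (w q *\<^sub>R v) = ?t (\<Sum>i\<in>UNIV. \<theta> i q v *\<^sub>R E i q)" using f by (simp add: frame_at_def)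
    then show ?thesis unfolding linear_scale[OF l] linear_sum[OF l] by (simp only:)
  qed
  then have "trace (matrix (\<lambda>v. w q *\<^sub>R ?t v)) = trace (matrix (\<lambda>v. \<Sum>i\<in>UNIV. \<theta> i q v *\<^sub>R ?t (E i q)))"
    by simp
  then have "w q * trace_at A q T = (\<Sum>i\<in>UNIV. \<theta> i q (?t (E i q)))"
    unfolding trace_matrix_scaleR trace_matrix_sum trace_matrix_rank_one[OF \<theta>] trace_at_def .
  moreover have "?t (E i q) = T (E i) q" for i
    using f by (intro tensorial_extension[OF T]) (simp add: frame_at_def)
  ultimately show ?thesis by simp
qed

lemma open_nonzero: "w \<in> C \<Longrightarrow> open {q. w q \<noteq> 0}"
  using open_Collect_neq[OF function_continuous continuous_on_const, of w 0] by simp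

section \<open>Directional derivatives\<close>

definition dir :: "('a \<Rightarrow> real ^ 'm) \<Rightarrow> ('a \<Rightarrow> real) \<Rightarrow> 'a \<Rightarrow> real" where
  "dir X f p = differential A f p (X p)"

lemma dir_C: "f \<in> C \<Longrightarrow> X \<in> V \<Longrightarrow> dir X f \<in> C"
  using functions_differential by (simp add: dir_def[abs_def])

lemma dir_rules:
  "dir X (\<lambda>q. k) = (\<lambda>q. 0)"
  "f \<in> C \<Longrightarrow> h \<in> C \<Longrightarrow> dir X (\<lambda>q. f q + h q) = (\<lambda>q. dir X f q + dir X h q)"
  "f \<in> C \<Longrightarrow> h \<in> C \<Longrightarrow> dir X (\<lambda>q. f q - h q) = (\<lambda>q. dir X f q - dir X h q)"
  "f \<in> C \<Longrightarrow> dir X (\<lambda>q. - f q) = (\<lambda>q. - dir X f q)"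
  "f \<in> C \<Longrightarrow> h \<in> C \<Longrightarrow> dir X (\<lambda>q. f q * h q) = (\<lambda>q. dir X f q * h q + f q * dir X h q)"
  "f \<in> C \<Longrightarrow> dir (\<lambda>q. X q + Y q) f = (\<lambda>q. dir X f q + dir Y f q)"
  "f \<in> C \<Longrightarrow> dir (\<lambda>q. X q - Y q) f = (\<lambda>q. dir X f q - dir Y f q)"
  "f \<in> C \<Longrightarrow> dir (\<lambda>q. u q *\<^sub>R X q) f = (\<lambda>q. u q * dir X f q)"
  by (simp_all add: fun_eq_iff dir_def differential_const differential_add differential_diff differential_uminus
      differential_mult linear_add[OF differential_linear] linear_diff[OF differential_linear] linear_scale[OF differential_linear])

lemma dir_sum:
  "(\<And>i. i \<in> I \<Longrightarrow> f i \<in> C) \<Longrightarrow> dir X (\<lambda>q. \<Sum>i\<in>I. f i q) p = (\<Sum>i\<in>I. dir X (f i) p)"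
  by (simp add: dir_def differential_sum)

lemma dir_bracket:
  "f \<in> C \<Longrightarrow> X \<in> V \<Longrightarrow> Y \<in> V \<Longrightarrow> dir (lie_bracket A X Y) f = (\<lambda>p. dir X (dir Y f) p - dir Y (dir X f) p)"
  by (simp add: fun_eq_iff dir_def[abs_def] lie_bracket_differential)

lemmas C_closed = functions_const functions_add functions_mult functions_uminus functions_diff dir_C
lemmas V_closed = fields_add fields_scaleR fields_uminus fields_diff fields_zero

end

locale riemannian_manifold = smooth_manifold A
  for A :: "('a::{t2_space, second_countable_topology}, 'm::finite) chart set" +
  fixes g :: "'a \<Rightarrow> real ^ 'm \<Rightarrow> real ^ 'm \<Rightarrow> real" and D :: "('a, 'm) connection"
  assumes metric: "riemannian_metric A g" and levi_civita: "levi_civita_connection A g D"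
begin

section \<open>The metric and gradients\<close>

lemma g_bilinear: "bilinear (g p)" and g_sym: "g p u v = g p v u"
  and g_pos: "v \<noteq> 0 \<Longrightarrow> g p v v > 0"
  and g_C: "X \<in> V \<Longrightarrow> Y \<in> V \<Longrightarrow> (\<lambda>p. g p (X p) (Y p)) \<in> C"
  using metric by (auto simp: riemannian_metric_def)

lemmas g_linear = bilinear_ladd[OF g_bilinear] bilinear_radd[OF g_bilinear]
  bilinear_lsub[OF g_bilinear] bilinear_rsub[OF g_bilinear] bilinear_lmul[OF g_bilinear] bilinear_rmul[OF g_bilinear]
  bilinear_lneg[OF g_bilinear] bilinear_rneg[OF g_bilinear] bilinear_lzero[OF g_bilinear] bilinear_rzero[OF g_bilinear]

lemma linear_g: "linear (g p u)" "linear (\<lambda>u. g p u v)"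
  using g_bilinear by (auto simp: bilinear_def)

lemma g_eqI: assumes "\<And>w. g p u w = g p v w" shows "u = v"
proof (rule ccontr)
  assume "u \<noteq> v"
  then have "g p (u - v) (u - v) > 0" by (intro g_pos) simp
  then show False using assms[of "u - v"] by (simp add: g_linear)
qed

text \<open>Positive definiteness makes \<open>\<Gamma>\<close> injective, hence surjective by
  dimension. This supplies the vector that the \<open>THE\<close> in \<open>gradient\<close>
  selects.\<close>

lemma riesz:
  assumes "linear l" shows "\<exists>u. \<forall>v. g p u v = l v"
proof -
  define \<Gamma> :: "real ^ 'm \<Rightarrow> real ^ 'm" where "\<Gamma> u = (\<chi> i. g p u (axis i 1))" for u
  have \<Gamma>: "linear \<Gamma>" by (rule linearI) (simp_all add: \<Gamma>_def vec_eq_iff g_linear)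
  have e: "g p u v = (\<Sum>i\<in>UNIV. v $ i * \<Gamma> u $ i)" for u v
    using linear_axis_expansion[OF linear_g(1), of p u v] by (simp add: \<Gamma>_def)
  have "inj \<Gamma>"
  proof (rule linear_injective_0[OF \<Gamma>, THEN iffD2], intro allI impI)
    fix u assume "\<Gamma> u = 0"
    then have "g p u u = 0" by (simp add: e)
    then show "u = 0" using g_pos[of u p] by force
  qed
  then have "surj \<Gamma>" by (rule linear_injective_imp_surjective[OF \<Gamma>]) simp
  then obtain u where "\<Gamma> u = (\<chi> i. l (axis i 1))" by (metis surj_def)
  then have "g p u v = l v" for v
    using linear_axis_expansion[OF assms, of v] by (simp add: e)
  then show ?thesis by blast
qed

lemma gradient_differential:
  assumes "f \<in> C" shows "g p (gradient A g f p) v = differential A f p v"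
proof -
  have "\<exists>!u. \<forall>v. g p u v = differential A f p v"
    using riesz[OF differential_linear[OF assms], of p] g_eqI by metis
  from theI'[OF this] show ?thesis by (simp add: gradient_def)
qed

text \<open>The rules for \<open>D\<close> are available only for members of \<open>V\<close>, so
  this must precede any computation with the Hessian or with the curvature applied to Df.\<close>

lemma gradient_V:
  assumes f: "f \<in> C" shows "gradient A g f \<in> V"
  unfolding vector_fields_def
proof (intro CollectI ballI)
  fix d assume d: "d \<in> A"
  show "smooth_on (snd d ` fst d) (local_rep A d (gradient A g f))"
  proof (rule smooth_on_chart_local[OF d])
    fix p assume p: "p \<in> fst d"
    obtain E \<theta> w where fr: "frame_at p E \<theta> w" by (rule frame_at_exists)
    have EV: "E i \<in> V" for i using fr by (simp add: frame_at_def)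
    have wC: "w \<in> C" using fr by (simp add: frame_at_def)
    have span: "(\<Sum>i\<in>UNIV. \<theta> i q v *\<^sub>R E i q) = w q *\<^sub>R v" for q v
      using fr by (simp add: frame_at_def)
    let ?W = "{q. w q \<noteq> 0}"
    have W: "open ?W" "p \<in> ?W" using open_nonzero[OF wC] fr by (auto simp: frame_at_def)
    \<comment> \<open>The components \<open>y\<close> of the gradient in the frame solve \<open>M y = b\<close>, so Cramer's rule shows that
      they are smooth.\<close>
    define M where "M q = (\<chi> i j. g q (E j q) (E i q))" for q
    define b where "b q = (\<chi> i. differential A f q (E i q))" for q
    define y where "y q = (\<chi> k. det (\<chi> i j. if j = k then b q $ i else M q $ i $ j) / det (M q))" for q
    define N where "N q v = (\<Sum>j\<in>UNIV. v $ j *\<^sub>R E j q)" for q and v :: "real ^ 'm"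
    have Nlin: "linear (N q)" for q
      by (rule linearI) (simp_all add: N_def scaleR_sum_right scaleR_add_left sum.distrib)
    have MN: "(M q *v v) $ i = g q (N q v) (E i q)" for q v i
      by (simp add: M_def N_def matrix_vector_mult_def linear_sum[OF linear_g(2)] linear_scale[OF linear_g(2)] mult.commute)
    have detM: "det (M q) \<noteq> 0" and grad: "gradient A g f q = N q (y q)" if "q \<in> ?W" for q
    proof -
      have wq: "w q \<noteq> 0" using that by simp
      \<comment> \<open>Where \<open>w\<close> does not vanish the frame spans, so
        \<open>N q\<close> is surjective and, by equality of dimensions, injective. Definiteness of
        the metric then makes the Gram matrix \<open>M q\<close> invertible.\<close>
      have N_span: "v = N q (\<chi> i. \<theta> i q v / w q)" for v
      proof -
        have "w q *\<^sub>R N q (\<chi> i. \<theta> i q v / w q) = w q *\<^sub>R v"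
          using wq by (simp add: N_def scaleR_sum_right span[symmetric])
        then show ?thesis using wq by simp
      qed
      then have "surj (N q)" unfolding surj_def by blast
      then have "inj (N q)" by (rule linear_surjective_imp_injective[OF Nlin]) simp
      have orth: "v = 0" if "\<And>i. g q v (E i q) = 0" for v
      proof -
        have "g q v v = g q v (N q (\<chi> i. \<theta> i q v / w q))" using N_span[of v] by simp
        also have "\<dots> = 0" by (simp add: N_def linear_sum[OF linear_g(1)] linear_scale[OF linear_g(1)] that)
        finally show ?thesis using g_pos[of v q] by force
      qed
      have ker: "v = 0" if "M q *v v = 0" for v
      proof -
        have "g q (N q v) (E i q) = 0" for i using that MN[of q v i] by simp
        then have "N q v = 0" by (rule orth)
        then show ?thesis using \<open>inj (N q)\<close> linear_0[OF Nlin] by (metis injD)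
      qed
      then have "invertible (M q)"
        using matrix_left_invertible_ker[of "M q"] invertible_left_inverse by blast
      then show dM: "det (M q) \<noteq> 0" by (simp add: invertible_det_nz)
      then have "M q *v y q = b q"
        by (subst cramer) (simp_all add: y_def)
      then have "g q (N q (y q)) (E i q) = b q $ i" for i by (simp flip: MN)
      then have "g q (gradient A g f q - N q (y q)) (E i q) = 0" for i
        by (simp add: g_linear gradient_differential[OF f] b_def)
      then show "gradient A g f q = N q (y q)" using orth by (metis eq_iff_diff_eq_0)
    qed
    let ?S = "snd d ` (fst d \<inter> ?W)"
    have S: "open ?S" by (rule open_chart_image[OF d W(1)])
    have sm: "smooth_on ?S (\<lambda>x. h (chart_inv d x))" if "h \<in> C" for h
      using smooth_on_subset[OF function_smooth[OF that d], of ?S] by (auto simp: o_def)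
    have sM: "smooth_on ?S (\<lambda>x. M (chart_inv d x) $ i $ j)" for i j
      using sm[OF g_C[OF EV[of j] EV[of i]]] by (simp add: M_def)
    have sb: "smooth_on ?S (\<lambda>x. b (chart_inv d x) $ i)" for i
      using sm[OF functions_differential[OF f EV[of i]]] by (simp add: b_def)
    have "smooth_on ?S (\<lambda>x. if j = k then b (chart_inv d x) $ i else M (chart_inv d x) $ i $ j)" for i j k
      by (cases "j = k") (simp_all add: sb sM)
    then have sy1: "smooth_on ?S (\<lambda>x. det (\<chi> i j. if j = k then b (chart_inv d x) $ i else M (chart_inv d x) $ i $ j))" for k
      by (intro smooth_on_det[OF S]) simp
    have sy2: "smooth_on ?S (\<lambda>x. inverse (det (M (chart_inv d x))))"
      by (intro smooth_on_inverse[OF S] smooth_on_det[OF S] sM) (auto simp: chart_facts(5)[OF d] detM)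
    have sy: "smooth_on ?S (\<lambda>x. y (chart_inv d x) $ k)" for k
      using smooth_on_mult[OF S sy1 sy2] by (simp add: y_def divide_inverse)
    have "smooth_on ?S (\<lambda>x. \<Sum>j\<in>UNIV. y (chart_inv d x) $ j *\<^sub>R local_rep A d (E j) x)"
      by (intro smooth_on_sum smooth_on_scaleR S sy finite smooth_on_subset[OF field_smooth[OF EV d]]) auto
    then have "smooth_on ?S (local_rep A d (gradient A g f))"
    proof (rule smooth_on_cong[OF S, rotated])
      fix x assume "x \<in> ?S"
      then obtain q where q: "q \<in> fst d" "q \<in> ?W" "x = snd d q" by auto
      then show "(\<Sum>j\<in>UNIV. y (chart_inv d x) $ j *\<^sub>R local_rep A d (E j) x) = local_rep A d (gradient A g f) x"
        using components_linear[OF d q(1)]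
        by (simp add: local_rep_def chart_facts(5)[OF d] grad N_def linear_sum linear_scale)
    qed
    then show "\<exists>W. open W \<and> p \<in> W \<and> smooth_on (snd d ` (fst d \<inter> W)) (local_rep A d (gradient A g f))"
      using W by blast
  qed
qed

section \<open>Rules for the covariant derivative and the bracket\<close>

lemma D_V: "X \<in> V \<Longrightarrow> Y \<in> V \<Longrightarrow> D X Y \<in> V"
  and D_add_left: "X \<in> V \<Longrightarrow> Y \<in> V \<Longrightarrow> Z \<in> V \<Longrightarrow> D (\<lambda>q. X q + Y q) Z = (\<lambda>q. D X Z q + D Y Z q)"
  and D_add_right: "X \<in> V \<Longrightarrow> Y \<in> V \<Longrightarrow> Z \<in> V \<Longrightarrow> D X (\<lambda>q. Y q + Z q) = (\<lambda>q. D X Y q + D X Z q)"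
  and D_scaleR_left: "h \<in> C \<Longrightarrow> X \<in> V \<Longrightarrow> Y \<in> V \<Longrightarrow> D (\<lambda>q. h q *\<^sub>R X q) Y = (\<lambda>q. h q *\<^sub>R D X Y q)"
  and D_scaleR_right: "h \<in> C \<Longrightarrow> X \<in> V \<Longrightarrow> Y \<in> V \<Longrightarrow>
    D X (\<lambda>q. h q *\<^sub>R Y q) = (\<lambda>q. dir X h q *\<^sub>R Y q + h q *\<^sub>R D X Y q)"
  using levi_civita unfolding levi_civita_connection_def affine_connection_def by (auto simp: fun_eq_iff dir_def)

lemma bracket_eq: "X \<in> V \<Longrightarrow> Y \<in> V \<Longrightarrow> lie_bracket A X Y = (\<lambda>p. D X Y p - D Y X p)"
  and dir_g: "X \<in> V \<Longrightarrow> Y \<in> V \<Longrightarrow> Z \<in> V \<Longrightarrow>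
    dir X (\<lambda>q. g q (Y q) (Z q)) = (\<lambda>p. g p (D X Y p) (Z p) + g p (Y p) (D X Z p))"
  using levi_civita unfolding levi_civita_connection_def by (auto simp: fun_eq_iff dir_def)

lemma D_uminus_left: "X \<in> V \<Longrightarrow> Z \<in> V \<Longrightarrow> D (\<lambda>q. - X q) Z = (\<lambda>q. - D X Z q)"
  using D_scaleR_left[OF functions_const[of "-1"]] by simp

lemma D_uminus_right: "X \<in> V \<Longrightarrow> Z \<in> V \<Longrightarrow> D X (\<lambda>q. - Z q) = (\<lambda>q. - D X Z q)"
  using D_scaleR_right[OF functions_const[of "-1"]] by (simp add: dir_rules)

lemma D_diff_left: "X \<in> V \<Longrightarrow> Y \<in> V \<Longrightarrow> Z \<in> V \<Longrightarrow> D (\<lambda>q. X q - Y q) Z = (\<lambda>q. D X Z q - D Y Z q)"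
  using D_add_left[OF _ fields_uminus] by (simp add: D_uminus_left)

lemma D_diff_right: "X \<in> V \<Longrightarrow> Y \<in> V \<Longrightarrow> Z \<in> V \<Longrightarrow> D X (\<lambda>q. Y q - Z q) = (\<lambda>q. D X Y q - D X Z q)"
  using D_add_right[OF _ _ fields_uminus] by (simp add: D_uminus_right)

lemma D_zero_left: "Z \<in> V \<Longrightarrow> D (\<lambda>q. 0) Z = (\<lambda>q. 0)"
  using D_scaleR_left[OF functions_const[of 0] fields_zero] by simp

lemma D_zero_right: "X \<in> V \<Longrightarrow> D X (\<lambda>q. 0) = (\<lambda>q. 0)"
  using D_diff_right[OF _ fields_zero fields_zero] by simp

lemmas D_rules = D_add_left D_add_right D_diff_left D_diff_right D_uminus_left D_uminus_right
  D_scaleR_left D_scaleR_right D_zero_left D_zero_right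

lemma bracket_V: "X \<in> V \<Longrightarrow> Y \<in> V \<Longrightarrow> lie_bracket A X Y \<in> V"
  by (simp add: bracket_eq fields_diff D_V)

lemmas closed = C_closed V_closed g_C D_V bracket_V

text \<open>Tested on functions, where brackets act as commutators and all third-order terms
  cancel.\<close>

lemma jacobi:
  assumes "X \<in> V" "Y \<in> V" "Z \<in> V"
  shows "lie_bracket A (lie_bracket A X Y) Z p + lie_bracket A (lie_bracket A Y Z) X p +
    lie_bracket A (lie_bracket A Z X) Y p = 0"
proof (rule differentials_separate)
  fix h assume h: "h \<in> C"
  have "dir (lie_bracket A (lie_bracket A X Y) Z) h p + dir (lie_bracket A (lie_bracket A Y Z) X) h p +
      dir (lie_bracket A (lie_bracket A Z X) Y) h p = 0"
    using assms h by (simp add: dir_bracket dir_rules closed)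
  then show "differential A h p (lie_bracket A (lie_bracket A X Y) Z p + lie_bracket A (lie_bracket A Y Z) X p +
    lie_bracket A (lie_bracket A Z X) Y p) = differential A h p 0"
    by (simp add: dir_def linear_add[OF differential_linear[OF h]] linear_0[OF differential_linear[OF h]])
qed

section \<open>The curvature tensor and its symmetries\<close>

abbreviation R where "R \<equiv> curvature A D"

lemma R_eq: "R X Y Z = (\<lambda>p. D X (D Y Z) p - D Y (D X Z) p - D (lie_bracket A X Y) Z p)"
  by (simp add: curvature_def[abs_def])

lemma R_V: "X \<in> V \<Longrightarrow> Y \<in> V \<Longrightarrow> Z \<in> V \<Longrightarrow> R X Y Z \<in> V"
  by (simp add: R_eq closed)

lemma bracket_uminus: "X \<in> V \<Longrightarrow> Y \<in> V \<Longrightarrow> lie_bracket A Y X = (\<lambda>p. - lie_bracket A X Y p)"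
  by (simp add: bracket_eq)

lemma R_skew: "X \<in> V \<Longrightarrow> Y \<in> V \<Longrightarrow> Z \<in> V \<Longrightarrow> R Y X Z = (\<lambda>p. - R X Y Z p)"
  by (simp add: R_eq bracket_uminus[of X Y] D_rules closed algebra_simps)

lemma R_add1: "X \<in> V \<Longrightarrow> X' \<in> V \<Longrightarrow> Y \<in> V \<Longrightarrow> Z \<in> V \<Longrightarrow>
    R (\<lambda>q. X q + X' q) Y Z = (\<lambda>p. R X Y Z p + R X' Y Z p)"
  by (simp add: R_eq bracket_eq D_rules closed algebra_simps)

lemma R_scaleR1: "h \<in> C \<Longrightarrow> X \<in> V \<Longrightarrow> Y \<in> V \<Longrightarrow> Z \<in> V \<Longrightarrow>
    R (\<lambda>q. h q *\<^sub>R X q) Y Z = (\<lambda>p. h p *\<^sub>R R X Y Z p)"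
  by (simp add: R_eq bracket_eq D_rules closed algebra_simps)

lemma R_add2: "X \<in> V \<Longrightarrow> X' \<in> V \<Longrightarrow> Y \<in> V \<Longrightarrow> Z \<in> V \<Longrightarrow>
    R Y (\<lambda>q. X q + X' q) Z = (\<lambda>p. R Y X Z p + R Y X' Z p)"
  using R_add1[of X X' Y Z] by (simp add: R_skew[of _ Y] closed)

lemma R_scaleR2: "h \<in> C \<Longrightarrow> X \<in> V \<Longrightarrow> Y \<in> V \<Longrightarrow> Z \<in> V \<Longrightarrow>
    R Y (\<lambda>q. h q *\<^sub>R X q) Z = (\<lambda>p. h p *\<^sub>R R Y X Z p)"
  using R_scaleR1[of h X Y Z] by (simp add: R_skew[of _ Y] closed)

lemma R_add3: "X \<in> V \<Longrightarrow> Y \<in> V \<Longrightarrow> Z \<in> V \<Longrightarrow> Z' \<in> V \<Longrightarrow>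
    R X Y (\<lambda>q. Z q + Z' q) = (\<lambda>p. R X Y Z p + R X Y Z' p)"
  by (simp add: R_eq D_rules closed algebra_simps)

text \<open>The second derivatives of \<open>h\<close> combine to
  \<open>dir X (dir Y h) - dir Y (dir X h)\<close>, which cancels against the derivative of
  \<open>h\<close> along the bracket.\<close>

lemma R_scaleR3: "h \<in> C \<Longrightarrow> X \<in> V \<Longrightarrow> Y \<in> V \<Longrightarrow> Z \<in> V \<Longrightarrow>
    R X Y (\<lambda>q. h q *\<^sub>R Z q) = (\<lambda>p. h p *\<^sub>R R X Y Z p)"
  by (simp add: R_eq D_rules closed algebra_simps dir_bracket)

text \<open>Vanishing torsion turns the cyclic sum of second covariant derivatives into iterated
  brackets, and the Jacobi identity finishes.\<close>

lemma R_bianchi: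
  assumes "X \<in> V" "Y \<in> V" "Z \<in> V"
  shows "R X Y Z p + R Y Z X p + R Z X Y p = 0"
proof -
  have "R X Y Z p + R Y Z X p + R Z X Y p =
      lie_bracket A X (lie_bracket A Y Z) p + lie_bracket A Y (lie_bracket A Z X) p + lie_bracket A Z (lie_bracket A X Y) p"
    using assms by (simp add: R_eq bracket_eq D_rules closed)
  also have "\<dots> = - (lie_bracket A (lie_bracket A X Y) Z p + lie_bracket A (lie_bracket A Y Z) X p +
      lie_bracket A (lie_bracket A Z X) Y p)"
    using assms by (simp add: bracket_uminus[of "lie_bracket A Y Z" X] bracket_uminus[of "lie_bracket A Z X" Y]
        bracket_uminus[of "lie_bracket A X Y" Z] closed)
  finally show ?thesis using jacobi[OF assms, of p] by simp
qed

text \<open>The second Bianchi identity, with the derivatives of the first two arguments gathered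
  into brackets by vanishing torsion. In this form it is the Jacobi identity for commutators of the
  operators \<open>D X\<close>, \<open>D Y\<close>, \<open>D W\<close> together with the one for the
  fields.\<close>

lemma R_bianchi_derivative:
  assumes "X \<in> V" "Y \<in> V" "W \<in> V" "Z \<in> V"
  shows "(D W (R X Y Z) p - R X Y (D W Z) p - R (lie_bracket A W X) Y Z p) +
    (D X (R Y W Z) p - R Y W (D X Z) p - R (lie_bracket A X Y) W Z p) +
    (D Y (R W X Z) p - R W X (D Y Z) p - R (lie_bracket A Y W) X Z p) = 0"
proof -
  let ?b = "lie_bracket A"
  have "D (\<lambda>q. ?b (?b X Y) W q + ?b (?b Y W) X q + ?b (?b W X) Y q) Z p = 0"
    using jacobi[OF assms(1-3)] assms(4) by (simp add: D_zero_left)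
  then have "D (?b (?b X Y) W) Z p + D (?b (?b Y W) X) Z p + D (?b (?b W X) Y) Z p = 0"
    using assms by (simp add: D_rules closed)
  then show ?thesis
    using assms by (simp add: R_eq D_rules closed algebra_simps)
qed

text \<open>The bracket acts on the function \<open>g(Z,W)\<close> as a commutator; metric
  compatibility expands both sides, and the mixed terms cancel.\<close>

lemma g_R_skew:
  assumes "X \<in> V" "Y \<in> V" "Z \<in> V" "W \<in> V"
  shows "g p (R X Y Z p) (W p) = - g p (Z p) (R X Y W p)"
proof -
  let ?f = "\<lambda>q. g q (Z q) (W q)"
  have "dir (lie_bracket A X Y) ?f p = dir X (dir Y ?f) p - dir Y (dir X ?f) p"
    using assms by (simp add: dir_bracket closed)
  then show ?thesis
    using assms by (simp add: dir_g dir_rules closed R_eq g_linear)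
qed

definition Rp where "Rp p u v w = R (extension A p u) (extension A p v) (extension A p w) p"

lemma R_tensorial:
  "Y \<in> V \<Longrightarrow> Z \<in> V \<Longrightarrow> tensorial p (\<lambda>X. R X Y Z)"
  "X \<in> V \<Longrightarrow> Z \<in> V \<Longrightarrow> tensorial p (\<lambda>Y. R X Y Z)"
  "X \<in> V \<Longrightarrow> Y \<in> V \<Longrightarrow> tensorial p (\<lambda>Z. R X Y Z)"
  by (auto simp: tensorial_def R_add1 R_add2 R_add3 R_scaleR1 R_scaleR2 R_scaleR3)

text \<open>The fields are replaced one at a time by extensions of their values at \<open>p\<close>,
  using tensoriality in the corresponding slot.\<close>

lemma R_pointwise:
  assumes "X \<in> V" "Y \<in> V" "Z \<in> V" shows "R X Y Z p = Rp p (X p) (Y p) (Z p)"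
  using tensorial_extension[OF R_tensorial(1)[OF assms(2,3)] assms(1)]
    tensorial_extension[OF R_tensorial(2)[OF extension_field(1) assms(3)] assms(2)]
    tensorial_extension[OF R_tensorial(3)[OF extension_field(1) extension_field(1)] assms(3)]
  by (simp add: Rp_def)

lemma Rp_linear: "linear (\<lambda>u. Rp p u v w)" "linear (\<lambda>v. Rp p u v w)" "linear (\<lambda>w. Rp p u v w)"
  unfolding Rp_def by (intro tensorial_linear R_tensorial extension_field)+

text \<open>Contraction commutes with covariant differentiation: the operator on the right is the
  covariant derivative of \<open>T\<close> along \<open>X\<close>. It is applied to the Ricci tensor
  along \<xi>.\<close>

lemma trace_derivative:
  assumes T: "\<And>Z. Z \<in> V \<Longrightarrow> T Z \<in> V" "\<And>q. tensorial q T" and X: "X \<in> V"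
    and s: "s \<in> C" "\<And>q. s q = trace_at A q T"
  shows "dir X s p = trace_at A p (\<lambda>Z q. D X (T Z) q - T (D X Z) q)"
proof -
  obtain E \<theta> w where fr: "frame_at p E \<theta> w" by (rule frame_at_exists)
  have EV: "E i \<in> V" and \<theta>l: "linear (\<theta> i q)" and \<theta>C: "Z \<in> V \<Longrightarrow> (\<lambda>q. \<theta> i q (Z q)) \<in> C"
    and \<theta>p: "\<theta> i p v = v $ i" and Ep: "E i p = axis i 1" for i q v Z
    using fr by (auto simp: frame_at_def)
  have wC: "w \<in> C" and wp: "w p = 1" and dw: "dir X w p = 0"
    and span: "(\<Sum>i\<in>UNIV. \<theta> i q v *\<^sub>R E i q) = w q *\<^sub>R v" for q v
    using fr by (auto simp: frame_at_def dir_def)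
  have T_add: "T (\<lambda>q. Y q + Z q) = (\<lambda>q. T Y q + T Z q)" if "Y \<in> V" "Z \<in> V" for Y Z
    using T(2) that by (auto simp: tensorial_def)
  have T_scaleR: "T (\<lambda>q. h q *\<^sub>R Z q) = (\<lambda>q. h q *\<^sub>R T Z q)" if "h \<in> C" "Z \<in> V" for h Z
    using T(2) that by (auto simp: tensorial_def)
  have T': "tensorial p (\<lambda>Z q. D X (T Z) q - T (D X Z) q)"
    using X by (simp add: tensorial_def T T_add T_scaleR D_rules closed algebra_simps)
  \<comment> \<open>\<open>N i\<close> is the covariant derivative of \<open>\<theta> i\<close>; its contribution cancels that of the \<open>D X (E i)\<close>, as
    one sees by differentiating \<open>\<Sum>i. \<theta> i \<otimes> E i = w\<close>.\<close>
  define N where "N i Z q = dir X (\<lambda>q. \<theta> i q (Z q)) q - \<theta> i q (D X Z q)" for i Z q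
  have N: "tensorial p (N i)" for i
    using X by (simp add: tensorial_def N_def \<theta>C linear_add[OF \<theta>l] linear_scale[OF \<theta>l] dir_rules D_rules closed algebra_simps)
  define n where "n i v = N i (extension A p v) p" for i v
  have nl: "linear (n i)" for i unfolding n_def by (rule tensorial_linear[OF N])
  have nN: "n i (Z p) = N i Z p" if "Z \<in> V" for i Z
    unfolding n_def by (rule tensorial_extension[OF N that])
  define t where "t v = T (extension A p v) p" for v
  have tl: "linear t" unfolding t_def by (rule tensorial_linear[OF T(2)])
  have tT: "t (Z p) = T Z p" if "Z \<in> V" for Z
    unfolding t_def by (rule tensorial_extension[OF T(2) that])
  have "(\<Sum>i\<in>UNIV. n i v *\<^sub>R E i p + \<theta> i p v *\<^sub>R D X (E i) p) = 0" for v
  proof -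
    let ?Z = "extension A p v"
    have Z: "?Z \<in> V" "?Z p = v" by (rule extension_field)+
    have "D X (\<lambda>q. \<Sum>i\<in>I. \<theta> i q (?Z q) *\<^sub>R E i q) p =
        (\<Sum>i\<in>I. dir X (\<lambda>q. \<theta> i q (?Z q)) p *\<^sub>R E i p + \<theta> i p v *\<^sub>R D X (E i) p)" if "finite I" for I
      using that
    proof (induction I rule: finite_induct)
      case empty
      then show ?case using X by (simp add: D_rules)
    next
      case (insert i I)
      have "(\<lambda>q. \<Sum>i\<in>I. \<theta> i q (?Z q) *\<^sub>R E i q) \<in> V" by (intro fields_sum fields_scaleR \<theta>C Z EV)
      then show ?case using X insert by (simp add: D_rules closed \<theta>C Z EV)
    qed
    from this[of UNIV] have "D X (\<lambda>q. w q *\<^sub>R ?Z q) p =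
        (\<Sum>i\<in>UNIV. dir X (\<lambda>q. \<theta> i q (?Z q)) p *\<^sub>R E i p + \<theta> i p v *\<^sub>R D X (E i) p)"
      by (simp add: span)
    moreover have "D X (\<lambda>q. w q *\<^sub>R ?Z q) p = D X ?Z p"
      using X wC Z by (simp add: D_rules dw wp)
    moreover have "D X ?Z p = (\<Sum>i\<in>UNIV. \<theta> i p (D X ?Z p) *\<^sub>R E i p)"
      by (simp add: span wp)
    ultimately show ?thesis
      by (simp add: n_def N_def sum.distrib scaleR_diff_left sum_subtractf)
  qed
  \<comment> \<open>Applying \<open>T\<close> at \<open>p\<close> to this vector identity and
    tracing over \<open>v\<close> turns it into the scalar identity \<open>key\<close>.\<close>
  then have "t (\<Sum>i\<in>UNIV. n i v *\<^sub>R E i p + \<theta> i p v *\<^sub>R D X (E i) p) = 0" for v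
    using linear_0[OF tl] by simp
  then have "(\<Sum>i\<in>UNIV. n i v *\<^sub>R t (E i p) + \<theta> i p v *\<^sub>R t (D X (E i) p)) = 0" for v
    unfolding linear_sum[OF tl] linear_add[OF tl] linear_scale[OF tl] .
  then have "trace (matrix (\<lambda>v. \<Sum>i\<in>UNIV. n i v *\<^sub>R t (E i p) + \<theta> i p v *\<^sub>R t (D X (E i) p))) = 0"
    by (simp add: trace_matrix_zero)
  then have "(\<Sum>i\<in>UNIV. n i (t (E i p)) + \<theta> i p (t (D X (E i) p))) = 0"
    unfolding trace_matrix_sum trace_matrix_add trace_matrix_rank_one[OF nl] trace_matrix_rank_one[OF \<theta>l] .
  then have key: "(\<Sum>i\<in>UNIV. N i (T (E i)) p + \<theta> i p (T (D X (E i)) p)) = 0"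
    using X by (simp add: tT nN EV T closed)
  \<comment> \<open>The weight can be inserted freely, since it has value 1 and derivative 0 at
    \<open>p\<close>.\<close>
  have "dir X s p = dir X (\<lambda>q. w q * s q) p"
    using wC s(1) by (simp add: dir_rules dw wp)
  also have "\<dots> = dir X (\<lambda>q. \<Sum>i\<in>UNIV. \<theta> i q (T (E i) q)) p"
    by (simp add: s(2) trace_at_weighted_frame[OF T(2) fr])
  also have "\<dots> = (\<Sum>i\<in>UNIV. dir X (\<lambda>q. \<theta> i q (T (E i) q)) p)"
    by (intro dir_sum \<theta>C T EV)
  also have "\<dots> = (\<Sum>i\<in>UNIV. (N i (T (E i)) p + \<theta> i p (T (D X (E i)) p)) +
      \<theta> i p (D X (T (E i)) p - T (D X (E i)) p))"
    by (intro sum.cong refl) (simp add: N_def linear_diff[OF \<theta>l])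
  also have "\<dots> = (\<Sum>i\<in>UNIV. \<theta> i p (D X (T (E i)) p - T (D X (E i)) p))"
    unfolding sum.distrib[of "\<lambda>i. N i (T (E i)) p + \<theta> i p (T (D X (E i)) p)"] key by simp
  also have "\<dots> = trace_at A p (\<lambda>Z q. D X (T Z) q - T (D X Z) q)"
    unfolding trace_at_frame[OF T' fr] \<theta>p ..
  finally show ?thesis .
qed

end

section \<open>Kenmotsu manifolds\<close>

locale kenmotsu_manifold =
  fixes A :: "('a::{t2_space, second_countable_topology}, 'm::finite) chart set"
    and \<phi> :: "'a \<Rightarrow> real ^ 'm \<Rightarrow> real ^ 'm"
    and \<xi> :: "'a \<Rightarrow> real ^ 'm"
    and \<eta> :: "'a \<Rightarrow> real ^ 'm \<Rightarrow> real"
    and g :: "'a \<Rightarrow> real ^ 'm \<Rightarrow> real ^ 'm \<Rightarrow> real"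
    and D :: "('a, 'm) connection"
  assumes kenmotsu: "kenmotsu A \<phi> \<xi> \<eta> g D"

sublocale kenmotsu_manifold \<subseteq> riemannian_manifold A g D
  using kenmotsu by unfold_locales (simp_all add: kenmotsu_def almost_contact_metric_def)

lemma (in kenmotsu_manifold) tangent_space: "almost_contact_space (g p) (\<phi> p) (\<xi> p) (\<eta> p)"
proof (rule almost_contact_space.intro)
  have k: "almost_contact_metric A \<phi> \<xi> \<eta> g" using kenmotsu by (simp add: kenmotsu_def)
  fix u v
  show "bilinear (g p)" by (rule g_bilinear)
  show "g p u v = g p v u" by (rule g_sym)
  show "v \<noteq> 0 \<Longrightarrow> 0 < g p v v" by (rule g_pos)
  show "linear (\<phi> p)" "linear (\<eta> p)" "\<phi> p (\<phi> p v) = - v + \<eta> p v *\<^sub>R \<xi> p" "\<eta> p (\<xi> p) = 1"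
    "g p (\<phi> p u) (\<phi> p v) = g p u v - \<eta> p u * \<eta> p v"
    using k by (simp_all add: almost_contact_metric_def tensor_field_11_def one_form_def)
qed

sublocale kenmotsu_manifold \<subseteq> pt: almost_contact_space "g p" "\<phi> p" "\<xi> p" "\<eta> p" for p
  by (rule tangent_space)

context kenmotsu_manifold
begin

section \<open>Connection and curvature of a Kenmotsu manifold\<close>

lemma phi_V: "X \<in> V \<Longrightarrow> (\<lambda>p. \<phi> p (X p)) \<in> V"
  and xi_V: "\<xi> \<in> V"
  and eta_C: "X \<in> V \<Longrightarrow> (\<lambda>p. \<eta> p (X p)) \<in> C"
  and D_phi: "X \<in> V \<Longrightarrow> Y \<in> V \<Longrightarrow> D X (\<lambda>q. \<phi> q (Y q)) =
    (\<lambda>p. \<phi> p (D X Y p) + g p (\<phi> p (X p)) (Y p) *\<^sub>R \<xi> p - \<eta> p (Y p) *\<^sub>R \<phi> p (X p))"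
  using kenmotsu
  by (simp_all add: kenmotsu_def almost_contact_metric_def tensor_field_11_def one_form_def fun_eq_iff
      diff_eq_eq algebra_simps)

lemmas kclosed = closed phi_V xi_V eta_C R_V

text \<open>Differentiating \<open>\<phi> \<xi> = 0\<close> by the Kenmotsu condition determines the
  derivative of \<xi> up to a multiple of \<xi>; the unit length of \<xi> rules out that
  multiple.\<close>

lemma D_xi:
  assumes X: "X \<in> V" shows "D X \<xi> = (\<lambda>p. X p - \<eta> p (X p) *\<^sub>R \<xi> p)"
proof
  fix p
  have "D X (\<lambda>q. \<phi> q (\<xi> q)) p = 0" using X by (simp add: pt.phi_xi D_zero_right)
  then have "\<phi> p (D X \<xi> p) = \<phi> p (X p)"
    using X xi_V by (simp add: D_phi pt.G_xi pt.eta_phi pt.eta_xi)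
  then have "\<phi> p (\<phi> p (D X \<xi> p)) = \<phi> p (\<phi> p (X p))" by simp
  then have 1: "D X \<xi> p - \<eta> p (D X \<xi> p) *\<^sub>R \<xi> p = X p - \<eta> p (X p) *\<^sub>R \<xi> p"
    by (simp add: pt.phi_phi algebra_simps)
  have "dir X (\<lambda>q. g q (\<xi> q) (\<xi> q)) p = 0" by (simp add: pt.G_xi pt.eta_xi dir_rules)
  then have "\<eta> p (D X \<xi> p) = 0" unfolding dir_g[OF X xi_V xi_V] by (simp add: pt.G_xi)
  then show "D X \<xi> p = X p - \<eta> p (X p) *\<^sub>R \<xi> p" using 1 by simp
qed

lemma dir_eta:
  assumes "X \<in> V" "Y \<in> V"
  shows "dir X (\<lambda>q. \<eta> q (Y q)) = (\<lambda>p. \<eta> p (D X Y p) + g p (X p) (Y p) - \<eta> p (X p) * \<eta> p (Y p))"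
proof -
  have "dir X (\<lambda>q. \<eta> q (Y q)) = dir X (\<lambda>q. g q (Y q) (\<xi> q))" by (simp add: pt.G_xi)
  also note dir_g[OF assms xi_V]
  finally show ?thesis
    using assms by (simp add: D_xi g_linear pt.G_xi fun_eq_iff g_sym[of _ "Y _" "X _"])
qed

lemma R_xi:
  assumes "X \<in> V" "Y \<in> V"
  shows "R X Y \<xi> = (\<lambda>p. \<eta> p (X p) *\<^sub>R Y p - \<eta> p (Y p) *\<^sub>R X p)"
  using assms
  by (simp add: R_eq D_xi D_rules dir_eta bracket_eq kclosed pt.eta_linear pt.eta_xi fun_eq_iff
      g_sym[of _ "Y _" "X _"] algebra_simps)

text \<open>The Ricci identity for \<phi>: commuting two covariant derivatives past \<phi> by the
  Kenmotsu condition leaves exactly the metric terms that the tensor \<open>K\<close> is designed to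
  absorb.\<close>

lemma R_phi:
  assumes "X \<in> V" "Y \<in> V" "Z \<in> V"
  shows "R X Y (\<lambda>q. \<phi> q (Z q)) p = \<phi> p (R X Y Z p) + g p (Y p) (Z p) *\<^sub>R \<phi> p (X p)
    - g p (X p) (Z p) *\<^sub>R \<phi> p (Y p) + g p (X p) (\<phi> p (Z p)) *\<^sub>R Y p - g p (Y p) (\<phi> p (Z p)) *\<^sub>R X p"
  using assms
  by (simp add: R_eq D_phi D_xi D_rules dir_eta dir_g bracket_eq kclosed pt.eta_linear pt.phi_linear pt.phi_xi
      pt.eta_xi pt.eta_phi pt.G_xi g_linear pt.G_phi_left fun_eq_iff algebra_simps)

lemma curvature_space: "kenmotsu_curvature_space (g p) (\<phi> p) (\<xi> p) (\<eta> p) (Rp p)"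
proof (intro kenmotsu_curvature_space.intro kenmotsu_curvature_space_axioms.intro pt.almost_contact_space_axioms)
  fix u v w z
  let ?e = "extension A p"
  have e: "?e x \<in> V" "?e x p = x" for x by (rule extension_field)+
  show "linear (\<lambda>u. Rp p u v w)" "linear (\<lambda>v. Rp p u v w)" "linear (\<lambda>w. Rp p u v w)" by (rule Rp_linear)+
  show "Rp p u v w = - Rp p v u w" unfolding Rp_def by (rule fun_cong[OF R_skew[OF e(1) e(1) e(1)]])
  show "Rp p u v w + Rp p v w u + Rp p w u v = 0" unfolding Rp_def by (rule R_bianchi[OF e(1) e(1) e(1)])
  show "g p (Rp p u v w) z = - g p w (Rp p u v z)"
    using g_R_skew[OF e(1)[of u] e(1)[of v] e(1)[of w] e(1)[of z], of p] by (simp add: Rp_def e)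
  show "Rp p u v (\<xi> p) = \<eta> p u *\<^sub>R v - \<eta> p v *\<^sub>R u"
    using R_pointwise[OF e(1)[of u] e(1)[of v] xi_V, of p] R_xi[OF e(1)[of u] e(1)[of v]] by (simp add: e)
  show "Rp p u v (\<phi> p w) = \<phi> p (Rp p u v w) + g p v w *\<^sub>R \<phi> p u - g p u w *\<^sub>R \<phi> p v +
    g p u (\<phi> p w) *\<^sub>R v - g p v (\<phi> p w) *\<^sub>R u"
    using R_pointwise[OF e(1)[of u] e(1)[of v] phi_V[OF e(1)[of w]], of p] R_pointwise[OF e(1)[of u] e(1)[of v] e(1)[of w], of p]
      R_phi[OF e(1)[of u] e(1)[of v] e(1)[of w], of p] by (simp add: e)
qed

end

sublocale kenmotsu_manifold \<subseteq> cv: kenmotsu_curvature_space "g p" "\<phi> p" "\<xi> p" "\<eta> p" "Rp p" for p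
  by (rule curvature_space)

context kenmotsu_manifold
begin

section \<open>Ricci and star-Ricci tensors, derivatives along \<xi>\<close>

lemma trace_at_R: "X \<in> V \<Longrightarrow> Y \<in> V \<Longrightarrow> trace_at A p (\<lambda>Z. R Z X Y) = cv.Ric p (X p) (Y p)"
  by (simp add: trace_at_def R_pointwise extension_field cv.Ric_def)

lemma ricci_pointwise: "X \<in> V \<Longrightarrow> Y \<in> V \<Longrightarrow> ricci A D X Y p = cv.Ric p (X p) (Y p)"
  by (simp add: ricci_def trace_at_R)

lemma star_ricci_eq:
  assumes "X \<in> V" "Y \<in> V"
  shows "star_ricci A D \<phi> X Y p =
    ricci A D X Y p + (real CARD('m) - 2) * g p (X p) (Y p) + \<eta> p (X p) * \<eta> p (Y p)"
  unfolding star_ricci_def trace_at_def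
  by (simp add: R_pointwise assms phi_V extension_field ricci_pointwise cv.star_Ric[symmetric])

text \<open>Pair symmetry carries \<open>eta_K\<close> over to \<open>K u \<xi> w = 0\<close>, and
  unfolding \<open>K\<close> gives the formula.\<close>

lemma R_xi_right:
  assumes "X \<in> V" "Z \<in> V"
  shows "R X \<xi> Z = (\<lambda>p. g p (X p) (Z p) *\<^sub>R \<xi> p - \<eta> p (Z p) *\<^sub>R X p)"
proof
  fix p
  have "g p (Rp p u (\<xi> p) w) z = g p (g p u w *\<^sub>R \<xi> p - \<eta> p w *\<^sub>R u) z" for u w z
    using cv.K_pair[of p u "\<xi> p" w z] cv.eta_K[of p w z u]
    by (simp add: cv.K_def g_linear pt.G_xi pt.eta_linear algebra_simps)
  then have "Rp p u (\<xi> p) w = g p u w *\<^sub>R \<xi> p - \<eta> p w *\<^sub>R u" for u w by (rule g_eqI)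
  then show "R X \<xi> Z p = g p (X p) (Z p) *\<^sub>R \<xi> p - \<eta> p (Z p) *\<^sub>R X p"
    by (simp add: R_pointwise assms xi_V)
qed

lemma R_xi_left:
  assumes "X \<in> V" "Z \<in> V"
  shows "R \<xi> X Z = (\<lambda>p. \<eta> p (Z p) *\<^sub>R X p - g p (X p) (Z p) *\<^sub>R \<xi> p)"
  using R_skew[OF assms(1) xi_V assms(2)] R_xi_right[OF assms] by simp

text \<open>In the second Bianchi identity with one direction \<xi>, the other two cyclic terms
  contain curvature with an argument \<xi>, which has a closed form. Their derivatives and the
  brackets with \<xi> each contribute twice, which together makes -2K.\<close>

lemma R_derivative_xi:
  assumes X: "X \<in> V" and Y: "Y \<in> V" and Z: "Z \<in> V"
  shows "D \<xi> (R X Y Z) p = R (D \<xi> X) Y Z p + R X (D \<xi> Y) Z p + R X Y (D \<xi> Z) p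
    - 2 *\<^sub>R (R X Y Z p + g p (Y p) (Z p) *\<^sub>R X p - g p (X p) (Z p) *\<^sub>R Y p)"
proof -
  note rp = linear_add[OF Rp_linear(1)] linear_diff[OF Rp_linear(1)] linear_scale[OF Rp_linear(1)]
  have sk: "Rp p (D \<xi> Y p) (X p) (Z p) = - Rp p (X p) (D \<xi> Y p) (Z p)" "Rp p (Y p) (X p) (Z p) = - Rp p (X p) (Y p) (Z p)"
    by (rule cv.R_skew)+
  have xl: "Rp p (\<xi> p) (W p) (Z p) = \<eta> p (Z p) *\<^sub>R W p - g p (W p) (Z p) *\<^sub>R \<xi> p" if "W \<in> V" for W
    using R_pointwise[OF xi_V that Z, of p] R_xi_left[OF that Z] by simp
  have b1: "R (lie_bracket A \<xi> X) Y Z p = R (D \<xi> X) Y Z p - R X Y Z p +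
      \<eta> p (X p) *\<^sub>R (\<eta> p (Z p) *\<^sub>R Y p - g p (Y p) (Z p) *\<^sub>R \<xi> p)"
    using X Y Z by (simp add: R_pointwise kclosed bracket_eq D_xi rp xl)
  have b2: "R (lie_bracket A Y \<xi>) X Z p = R X (D \<xi> Y) Z p - R X Y Z p -
      \<eta> p (Y p) *\<^sub>R (\<eta> p (Z p) *\<^sub>R X p - g p (X p) (Z p) *\<^sub>R \<xi> p)"
    using X Y Z by (simp add: R_pointwise kclosed bracket_eq D_xi rp xl sk)
  have b3: "R (lie_bracket A X Y) \<xi> Z p = g p (D X Y p - D Y X p) (Z p) *\<^sub>R \<xi> p - \<eta> p (Z p) *\<^sub>R (D X Y p - D Y X p)"
    using X Y Z by (simp add: R_xi_right kclosed bracket_eq)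
  have c1: "D X (R Y \<xi> Z) p - R Y \<xi> (D X Z) p = g p (D X Y p) (Z p) *\<^sub>R \<xi> p - \<eta> p (Z p) *\<^sub>R D X Y p
      + g p (Y p) (Z p) *\<^sub>R (X p - \<eta> p (X p) *\<^sub>R \<xi> p) - (g p (X p) (Z p) - \<eta> p (X p) * \<eta> p (Z p)) *\<^sub>R Y p"
    using X Y Z xi_V by (simp add: R_xi_right D_rules D_xi dir_g dir_eta kclosed algebra_simps)
  have c2: "D Y (R \<xi> X Z) p - R \<xi> X (D Y Z) p = - g p (D Y X p) (Z p) *\<^sub>R \<xi> p + \<eta> p (Z p) *\<^sub>R D Y X p
      - g p (X p) (Z p) *\<^sub>R (Y p - \<eta> p (Y p) *\<^sub>R \<xi> p) + (g p (Y p) (Z p) - \<eta> p (Y p) * \<eta> p (Z p)) *\<^sub>R X p"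
    using X Y Z xi_V by (simp add: R_xi_left D_rules D_xi dir_g dir_eta kclosed algebra_simps)
  have bi: "(D \<xi> (R X Y Z) p - R X Y (D \<xi> Z) p - R (lie_bracket A \<xi> X) Y Z p) +
    ((D X (R Y \<xi> Z) p - R Y \<xi> (D X Z) p) - R (lie_bracket A X Y) \<xi> Z p) +
    ((D Y (R \<xi> X Z) p - R \<xi> X (D Y Z) p) - R (lie_bracket A Y \<xi>) X Z p) = 0"
    by (rule R_bianchi_derivative[OF X Y xi_V Z])
  show ?thesis
  proof (rule vec_eq_iff[THEN iffD2], rule allI)
    fix i
    show "D \<xi> (R X Y Z) p $ i = (R (D \<xi> X) Y Z p + R X (D \<xi> Y) Z p + R X Y (D \<xi> Z) p
      - 2 *\<^sub>R (R X Y Z p + g p (Y p) (Z p) *\<^sub>R X p - g p (X p) (Z p) *\<^sub>R Y p)) $ i"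
      using arg_cong[OF bi[unfolded b1 b2 b3 c1 c2], of "\<lambda>v. v $ i"]
      by (simp add: g_linear algebra_simps)
  qed
qed

text \<open>Trace of \<open>R_derivative_xi\<close>; the trace of its \<open>K\<close>-part gives
  the term with \<open>CARD('m) - 1\<close>.\<close>

lemma ricci_derivative_xi:
  assumes X: "X \<in> V" and Y: "Y \<in> V" and S: "ricci A D X Y \<in> C"
  shows "dir \<xi> (ricci A D X Y) p = ricci A D (D \<xi> X) Y p + ricci A D X (D \<xi> Y) p
    - 2 * (ricci A D X Y p + (real CARD('m) - 1) * g p (X p) (Y p))"
proof -
  have "dir \<xi> (ricci A D X Y) p = trace_at A p (\<lambda>Z q. D \<xi> (R Z X Y) q - R (D \<xi> Z) X Y q)"
    by (rule trace_derivative) (use X Y S in \<open>auto simp: kclosed R_tensorial ricci_def\<close>)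
  also have "\<dots> = trace (matrix (\<lambda>v. Rp p v (D \<xi> X p) (Y p) + Rp p v (X p) (D \<xi> Y p)
      - 2 *\<^sub>R (Rp p v (X p) (Y p) + g p (X p) (Y p) *\<^sub>R v - g p v (Y p) *\<^sub>R X p)))"
    unfolding trace_at_def
    by (intro arg_cong[of _ _ trace] arg_cong[of _ _ matrix] ext)
       (use X Y in \<open>simp add: R_derivative_xi extension_field kclosed R_pointwise\<close>)
  also have "\<dots> = cv.Ric p (D \<xi> X p) (Y p) + cv.Ric p (X p) (D \<xi> Y p)
    - 2 * (cv.Ric p (X p) (Y p) + (real CARD('m) - 1) * g p (X p) (Y p))"
    unfolding trace_matrix_add trace_matrix_diff trace_matrix_scaleR trace_matrix_ident
      trace_matrix_rank_one[OF linear_g(2)] cv.Ric_def by (simp add: algebra_simps)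
  finally show ?thesis using X Y by (simp add: ricci_pointwise kclosed)
qed

end

section \<open>Consequences of the soliton equation\<close>

locale kenmotsu_soliton = kenmotsu_manifold A \<phi> \<xi> \<eta> g D
  for A :: "('a::{t2_space, second_countable_topology}, 'm::finite) chart set"
    and \<phi> \<xi> \<eta> g D +
  fixes n :: nat and f lam :: "'a \<Rightarrow> real" and \<mu> P :: real
  assumes dim: "CARD('m) = 2 * n + 1"
    and soliton: "gradient_almost_star_conformal_eta_ricci_soliton n A \<phi> \<eta> g D f lam \<mu> P"
begin

abbreviation N where "N \<equiv> gradient A g f"

text \<open>By \<open>star_ricci_eq\<close>, the soliton equation reads \<open>Hess f + S + \<sigma> g + m \<eta>\<otimes>\<eta> = 0\<close>; thus \<open>Q\<close> below is the
  Ricci operator.\<close>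

definition \<sigma> where "\<sigma> p = lam p - (P / 2 + 1 / (2 * real n + 1)) + (2 * real n - 1)"

definition m where "m = \<mu> + 1"

definition Q where "Q X p = - D X N p - \<sigma> p *\<^sub>R X p - (m * \<eta> p (X p)) *\<^sub>R \<xi> p"

lemma f_C: "f \<in> C" and lam_C: "lam \<in> C"
  using soliton by (auto simp: gradient_almost_star_conformal_eta_ricci_soliton_def)

lemma sigma_C: "\<sigma> \<in> C"
  unfolding \<sigma>_def[abs_def] by (intro functions_add functions_diff functions_const lam_C)

lemma N_V: "N \<in> V" by (rule gradient_V[OF f_C])

lemmas sclosed = kclosed f_C sigma_C N_V

lemma Q_V: "X \<in> V \<Longrightarrow> Q X \<in> V"
  unfolding Q_def[abs_def] by (simp add: sclosed)

lemma g_N: "g p (Y p) (N p) = dir Y f p"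
  by (simp add: g_sym[of p "Y p"] gradient_differential[OF f_C] dir_def)

lemma eta_N: "\<eta> p (N p) = dir \<xi> f p"
  using g_N[of p \<xi>] by (simp add: pt.G_xi)

lemma ricci_Q:
  assumes "X \<in> V" "Y \<in> V"
  shows "g p (Q X p) (Y p) = ricci A D X Y p"
proof -
  have "hessian A g D f X Y p + star_ricci A D \<phi> X Y p +
        (lam p - (P / 2 + 1 / (2 * real n + 1))) * g p (X p) (Y p) +
        \<mu> * (\<eta> p (X p) * \<eta> p (Y p)) = 0"
    using soliton assms by (auto simp: gradient_almost_star_conformal_eta_ricci_soliton_def)
  then show ?thesis
    using assms by (simp add: Q_def g_linear pt.G_xi star_ricci_eq hessian_def dim \<sigma>_def m_def algebra_simps)
qed

text \<open>The smoothness that \<open>ricci_derivative_xi\<close> asks for is read off from the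
  soliton equation: \<open>Q X\<close> is built from \<open>D X N\<close>, \<open>\<sigma>\<close>,
  \<open>\<eta>\<close> and \<open>\<xi>\<close>, all of them smooth.\<close>

lemma ricci_C: "X \<in> V \<Longrightarrow> Y \<in> V \<Longrightarrow> ricci A D X Y \<in> C"
  using g_C[OF Q_V, of X Y] by (simp add: ricci_Q)

lemma field_eqI:
  assumes "\<And>Y. Y \<in> V \<Longrightarrow> g p u (Y p) = g p v (Y p)" shows "u = v"
proof (rule g_eqI)
  show "g p u w = g p v w" for w
    using assms[OF extension_field(1)[of p w]] by (simp add: extension_field)
qed

lemma Q_xi: "Q \<xi> = (\<lambda>p. (- 2 * real n) *\<^sub>R \<xi> p)"
proof
  fix p show "Q \<xi> p = (- 2 * real n) *\<^sub>R \<xi> p"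
  proof (rule field_eqI)
    fix Y assume Y: "Y \<in> V"
    have "g p (Q \<xi> p) (Y p) = cv.Ric p (Y p) (\<xi> p)"
      using Y xi_V by (simp add: ricci_Q ricci_pointwise cv.Ric_sym)
    then show "g p (Q \<xi> p) (Y p) = g p ((- 2 * real n) *\<^sub>R \<xi> p) (Y p)"
      by (simp add: cv.Ric_xi dim g_linear pt.G_xi)
  qed
qed

text \<open>\<open>ricci_derivative_xi\<close> with one index raised: by metric compatibility the
  terms with \<open>D \<xi> Y\<close> cancel, so the pairing with every \<open>Y\<close> can be
  removed.\<close>

lemma D_xi_Q:
  assumes X: "X \<in> V"
  shows "D \<xi> (Q X) p = Q (D \<xi> X) p - 2 *\<^sub>R Q X p - (4 * real n) *\<^sub>R X p"
proof (rule field_eqI)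
  fix Y assume Y: "Y \<in> V"
  have "dir \<xi> (\<lambda>q. g q (Q X q) (Y q)) p = dir \<xi> (ricci A D X Y) p"
    using X Y by (simp add: ricci_Q)
  then have "g p (D \<xi> (Q X) p) (Y p) + g p (Q X p) (D \<xi> Y p) =
      g p (Q (D \<xi> X) p) (Y p) + g p (Q X p) (D \<xi> Y p) - 2 * (g p (Q X p) (Y p) + (2 * real n) * g p (X p) (Y p))"
    unfolding dir_g[OF xi_V Q_V[OF X] Y] ricci_derivative_xi[OF X Y ricci_C[OF X Y]]
    using X Y xi_V by (simp add: ricci_Q D_V dim)
  then show "g p (D \<xi> (Q X) p) (Y p) = g p (Q (D \<xi> X) p - 2 *\<^sub>R Q X p - (4 * real n) *\<^sub>R X p) (Y p)"
    by (simp add: g_linear)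
qed

lemma D_N: "X \<in> V \<Longrightarrow> D X N = (\<lambda>p. - Q X p - \<sigma> p *\<^sub>R X p - (m * \<eta> p (X p)) *\<^sub>R \<xi> p)"
  by (simp add: Q_def)

text \<open>In R(\<xi>,Y)Df the curvature side supplies df and the soliton side supplies d\<sigma>;
  the two occur only through the differential of this sum.\<close>

definition F where "F p = f p + \<sigma> p"

lemma F_C: "F \<in> C" unfolding F_def[abs_def] by (intro functions_add f_C sigma_C)

lemma dir_F: "dir X F p = dir X f p + dir X \<sigma> p"
  unfolding F_def[abs_def] by (simp add: dir_rules f_C sigma_C)

text \<open>R(\<xi>,Y)Df is known from \<open>R_xi_left\<close> and is also computed from the
  soliton equation. In the latter, \<open>D_xi_Q\<close> removes the derivative of \<open>Q\<close>:
  the terms \<open>Q (D \<xi> Y)\<close> cancel, and of the two copies of \<open>Q Y\<close> from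
  its coefficient -2 the bracket takes one back. The remaining one is solved for.\<close>

lemma Q_formula:
  assumes Y: "Y \<in> V"
  shows "Q Y p = (dir \<xi> F p - 2 * real n - m) *\<^sub>R Y p - (dir Y F p) *\<^sub>R \<xi> p + (m * \<eta> p (Y p)) *\<^sub>R \<xi> p"
proof -
  have br: "lie_bracket A \<xi> Y = (\<lambda>p. D \<xi> Y p - (Y p - \<eta> p (Y p) *\<^sub>R \<xi> p))"
    using Y xi_V by (simp add: bracket_eq D_xi)
  have Qbr: "Q (lie_bracket A \<xi> Y) p = Q (D \<xi> Y) p - (Q Y p + (2 * real n * \<eta> p (Y p)) *\<^sub>R \<xi> p)"
  proof -
    have "Q (lie_bracket A \<xi> Y) p = Q (D \<xi> Y) p - (Q Y p - \<eta> p (Y p) *\<^sub>R Q \<xi> p)"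
      using Y unfolding br Q_def by (simp add: D_rules sclosed pt.eta_linear pt.eta_xi algebra_simps)
    then show ?thesis by (simp add: Q_xi mult.commute)
  qed
  have 1: "R \<xi> Y N p = dir \<xi> f p *\<^sub>R Y p - dir Y f p *\<^sub>R \<xi> p"
    using Y by (simp add: R_xi_left N_V eta_N g_N)
  have D1: "D \<xi> (D Y N) p = - D \<xi> (Q Y) p - dir \<xi> \<sigma> p *\<^sub>R Y p - \<sigma> p *\<^sub>R D \<xi> Y p - (m * \<eta> p (D \<xi> Y p)) *\<^sub>R \<xi> p"
    using Y xi_V by (simp add: D_N Q_V D_rules dir_rules dir_eta D_xi sclosed pt.G_xi pt.eta_xi algebra_simps)
  have D2: "D Y (D \<xi> N) p = (2 * real n - \<sigma> p - m) *\<^sub>R (Y p - \<eta> p (Y p) *\<^sub>R \<xi> p) - dir Y \<sigma> p *\<^sub>R \<xi> p"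
    using Y xi_V by (simp add: D_N Q_xi D_rules dir_rules D_xi sclosed pt.eta_xi algebra_simps)
  have D3: "D (lie_bracket A \<xi> Y) N p = - Q (lie_bracket A \<xi> Y) p - \<sigma> p *\<^sub>R (D \<xi> Y p - (Y p - \<eta> p (Y p) *\<^sub>R \<xi> p))
      - (m * \<eta> p (D \<xi> Y p)) *\<^sub>R \<xi> p"
    using Y xi_V by (simp add: D_N bracket_V) (simp add: br pt.eta_linear pt.eta_xi)
  have "R \<xi> Y N p = D \<xi> (D Y N) p - D Y (D \<xi> N) p - D (lie_bracket A \<xi> Y) N p"
    by (simp add: R_eq)
  then have 2: "dir \<xi> f p *\<^sub>R Y p - dir Y f p *\<^sub>R \<xi> p = Q Y p + (2 * real n) *\<^sub>R Y p - dir \<xi> \<sigma> p *\<^sub>R Y p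
      + dir Y \<sigma> p *\<^sub>R \<xi> p + m *\<^sub>R (Y p - \<eta> p (Y p) *\<^sub>R \<xi> p)"
    unfolding 1 D1 D2 D3 Qbr D_xi_Q[OF Y] by (simp add: vec_eq_iff algebra_simps)
  then show ?thesis by (simp add: dir_F vec_eq_iff algebra_simps)
qed

definition h where "h = dir \<xi> F"

lemma h_C: "h \<in> C" unfolding h_def by (intro dir_C F_C xi_V)

text \<open>The \<xi>-component of \<open>Q_formula\<close> is compared with the universal value
  S(Y,\<xi>) = -2n \<eta>(Y).\<close>

lemma dir_F_eta:
  assumes Y: "Y \<in> V" shows "dir Y F = (\<lambda>p. h p * \<eta> p (Y p))"
proof
  fix p
  have "g p (Q Y p) (\<xi> p) = - 2 * real n * \<eta> p (Y p)"
    using Y xi_V by (simp add: ricci_Q ricci_pointwise cv.Ric_xi dim)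
  then show "dir Y F p = h p * \<eta> p (Y p)"
    by (simp add: Q_formula[OF Y] g_linear pt.G_xi pt.eta_linear pt.eta_xi h_def algebra_simps)
qed

text \<open>The derivative of \<open>F\<close> along [\<xi>,Y] is evaluated in two ways. Since
  \<eta>([\<xi>,Y]) is the derivative of \<eta>(Y) along \<xi>, the undifferentiated terms in
  \<open>h\<close> cancel.\<close>

lemma dir_h_eta:
  assumes Y: "Y \<in> V" shows "dir Y h p = dir \<xi> h p * \<eta> p (Y p)"
proof -
  have e: "\<eta> p (lie_bracket A \<xi> Y p) = \<eta> p (D \<xi> Y p)"
    using Y xi_V by (simp add: bracket_eq D_xi pt.eta_linear pt.eta_xi)
  have "h p * \<eta> p (lie_bracket A \<xi> Y p) = dir \<xi> (dir Y F) p - dir Y (dir \<xi> F) p"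
    using dir_bracket[OF F_C xi_V Y] unfolding dir_F_eta[OF bracket_V[OF xi_V Y]] by (rule fun_cong)
  also have "dir \<xi> (dir Y F) p = dir \<xi> h p * \<eta> p (Y p) + h p * \<eta> p (D \<xi> Y p)"
    unfolding dir_F_eta[OF Y] dir_rules(5)[OF h_C eta_C[OF Y]] dir_eta[OF xi_V Y]
    by (simp add: pt.eta_xi pt.G_xi)
  finally show ?thesis by (simp add: e h_def)
qed

definition a where "a p = h p - m"

lemma a_C: "a \<in> C" unfolding a_def[abs_def] by (intro functions_diff functions_const h_C)

lemma dir_a: "dir X a p = dir X h p"
  unfolding a_def[abs_def] by (simp add: dir_rules h_C functions_const)

lemma Q_eq: "Y \<in> V \<Longrightarrow> Q Y p = (a p - 2 * real n) *\<^sub>R Y p - (a p * \<eta> p (Y p)) *\<^sub>R \<xi> p"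
  by (simp add: Q_formula dir_F_eta) (simp add: a_def h_def algebra_simps)

lemma ricci_eq:
  "X \<in> V \<Longrightarrow> Y \<in> V \<Longrightarrow>
    ricci A D X Y p = (a p - 2 * real n) * g p (X p) (Y p) - a p * \<eta> p (X p) * \<eta> p (Y p)"
  by (simp add: Q_eq g_linear pt.G_xi flip: ricci_Q)

lemma a_gradient:
  "a p *\<^sub>R N p = (a p * dir \<xi> f p + 2 * real n * (dir \<xi> h p + h p + a p - m)) *\<^sub>R \<xi> p"
proof (rule field_eqI)
  fix Y assume Y: "Y \<in> V"
  define u where "u q = 2 * real n - a q - \<sigma> q" for q
  define b where "b q = a q - m" for q
  have uC: "u \<in> C" unfolding u_def[abs_def] by (intro functions_diff functions_const a_C sigma_C)
  have bC: "b \<in> C" unfolding b_def[abs_def] by (intro functions_diff functions_const a_C)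
  have du: "dir X u p = - dir X h p - dir X \<sigma> p" for X
    unfolding u_def[abs_def] by (simp add: dir_rules C_closed a_C sigma_C dir_a)
  have db: "dir X b p = dir X h p" for X
    unfolding b_def[abs_def] by (simp add: dir_rules C_closed a_C dir_a)
  have DN: "D X N = (\<lambda>q. u q *\<^sub>R X q + (b q * \<eta> q (X q)) *\<^sub>R \<xi> q)" if "X \<in> V" for X
    using that by (simp add: D_N Q_eq u_def b_def fun_eq_iff algebra_simps)
  have RN: "R X Y N p = dir X u p *\<^sub>R Y p - dir Y u p *\<^sub>R X p +
      (dir X b p * \<eta> p (Y p)) *\<^sub>R \<xi> p - (dir Y b p * \<eta> p (X p)) *\<^sub>R \<xi> p +
      b p *\<^sub>R (\<eta> p (Y p) *\<^sub>R X p - \<eta> p (X p) *\<^sub>R Y p)" if X: "X \<in> V" for X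
    using X Y xi_V
    by (simp add: R_eq DN bracket_V)
       (simp add: D_rules dir_rules dir_eta D_xi bracket_eq sclosed uC bC pt.eta_linear g_sym[of p "Y p" "X p"] algebra_simps)
  have lin: "linear (differential A u p)" "linear (differential A b p)" by (intro differential_linear uC bC)+
  have "ricci A D Y N p = trace (matrix (\<lambda>v. differential A u p v *\<^sub>R Y p - dir Y u p *\<^sub>R v +
      differential A b p v *\<^sub>R (\<eta> p (Y p) *\<^sub>R \<xi> p) - \<eta> p v *\<^sub>R (dir Y b p *\<^sub>R \<xi> p) +
      ((b p * \<eta> p (Y p)) *\<^sub>R v - \<eta> p v *\<^sub>R (b p *\<^sub>R Y p))))"
    unfolding ricci_def trace_at_def
    by (intro arg_cong[of _ _ trace] arg_cong[of _ _ matrix] ext)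
       (simp add: RN extension_field dir_def algebra_simps)
  \<comment> \<open>Each identity map contributes 2n+1, and a rank-one term lowers it to 2n. The
    derivatives of \<open>b\<close> cancel because db = dh is a multiple of \<eta>.\<close>
  also have "\<dots> = - 2 * real n * dir Y u p + (dir \<xi> b p - dir \<xi> h p) * \<eta> p (Y p) + 2 * real n * b p * \<eta> p (Y p)"
    unfolding trace_matrix_add trace_matrix_diff trace_matrix_scaleR trace_matrix_ident
      trace_matrix_rank_one[OF lin(1)] trace_matrix_rank_one[OF lin(2)] trace_matrix_rank_one[OF pt.linear_eta]
      linear_scale[OF lin(2)] pt.eta_linear dir_def[symmetric]
    by (simp add: dim pt.eta_xi db dir_h_eta[OF Y] dir_def[symmetric]) (simp add: algebra_simps)
  finally have "ricci A D Y N p = - 2 * real n * dir Y u p + 2 * real n * b p * \<eta> p (Y p)"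
    by (simp add: db)
  moreover have "dir Y u p = dir Y f p - (dir \<xi> h p + h p) * \<eta> p (Y p)"
    using dir_F[of Y p] by (simp add: du dir_F_eta[OF Y] dir_h_eta[OF Y] algebra_simps)
  moreover have "ricci A D Y N p = (a p - 2 * real n) * dir Y f p - a p * \<eta> p (Y p) * dir \<xi> f p"
    using Y by (simp add: ricci_eq N_V g_N eta_N)
  \<comment> \<open>The term -2n df(Y) appears in both evaluations of the Ricci tensor and drops
    out, leaving \<open>a p * dir Y f p\<close> against multiples of \<eta>(Y).\<close>
  ultimately have "a p * dir Y f p =
      (a p * dir \<xi> f p + 2 * real n * (dir \<xi> h p + h p + a p - m)) * \<eta> p (Y p)"
    by (simp add: b_def algebra_simps)
  then show "g p (a p *\<^sub>R N p) (Y p) =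
      g p ((a p * dir \<xi> f p + 2 * real n * (dir \<xi> h p + h p + a p - m)) *\<^sub>R \<xi> p) (Y p)"
    by (simp add: g_linear pt.G_xi g_sym[of p "N p"] g_N)
qed

lemma einstein_or_collinear:
  "einstein A g D \<or> (\<exists>U. open U \<and> U \<noteq> {} \<and> (\<exists>c. \<forall>p\<in>U. N p = c p *\<^sub>R \<xi> p))"
proof (cases "\<forall>p. a p = 0")
  case True
  then have "\<forall>X\<in>V. \<forall>Y\<in>V. \<forall>p. ricci A D X Y p = (- 2 * real n) * g p (X p) (Y p)"
    by (simp add: ricci_eq)
  then show ?thesis unfolding einstein_def by blast
next
  case False
  let ?c = "\<lambda>p. (a p * dir \<xi> f p + 2 * real n * (dir \<xi> h p + h p + a p - m)) / a p"
  have "N p = ?c p *\<^sub>R \<xi> p" if "a p \<noteq> 0" for p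
  proof -
    have "N p = inverse (a p) *\<^sub>R (a p *\<^sub>R N p)" using that by simp
    then show ?thesis unfolding a_gradient by (simp add: divide_inverse mult.commute)
  qed
  moreover have "open {p. a p \<noteq> 0}" by (rule open_nonzero[OF a_C])
  moreover have "{p. a p \<noteq> 0} \<noteq> {}" using False by simp
  ultimately show ?thesis
    by (intro disjI2 exI[of _ "{p. a p \<noteq> 0}"] conjI exI[of _ ?c]) simp_all
qed

end

theorem theorem3p5:
  fixes n :: nat
    and A :: "('a::{t2_space, second_countable_topology}, 'm::finite) chart set"
    and \<phi> :: "'a \<Rightarrow> real ^ 'm \<Rightarrow> real ^ 'm"
    and \<xi> :: "'a \<Rightarrow> real ^ 'm"
    and \<eta> :: "'a \<Rightarrow> real ^ 'm \<Rightarrow> real"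
    and g :: "'a \<Rightarrow> real ^ 'm \<Rightarrow> real ^ 'm \<Rightarrow> real"
    and D :: "('a, 'm) connection"
    and f lam :: "'a \<Rightarrow> real"
    and \<mu> P :: real
  assumes "n \<ge> 1"
    and "CARD('m) = 2 * n + 1"
    and "kenmotsu A \<phi> \<xi> \<eta> g D"
    and "gradient_almost_star_conformal_eta_ricci_soliton n A \<phi> \<eta> g D f lam \<mu> P"
  shows "einstein A g D \<or>
    (\<exists>U. open U \<and> U \<noteq> {} \<and> (\<exists>c. \<forall>p\<in>U. gradient A g f p = c p *\<^sub>R \<xi> p))"
proof -
  interpret kenmotsu_soliton A \<phi> \<xi> \<eta> g D n f lam \<mu> P
    using assms by unfold_locales
  show ?thesis by (rule einstein_or_collinear)
qed

end
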